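(* Let $\mathfrak g$ be a finite-dimensional simple Lie algebra over $\Bbbk$ not of type $A_{2n}$, let $A$ be a finitely generated commutative associative unital $\Bbbk$-algebra with zero Jacobson radical, and let $\Gamma$ be a nontrivial finite cyclic group acting faithfully on $\mathfrak g$ by diagram automorphisms and on $A$ by algebra automorphisms such that the induced action on $\operatorname{maxSpec}A$ is free. Let $\lambda=\sum_{\mathbf i\in I_\Gamma}r_{\mathbf i}\omega_{\mathbf i}\in\Lambda_\Gamma^+$. If $(S^{r_i|\Gamma_i|}A)_{\Gamma_i}$ is reduced for all $i\in I$, then $$\mathbb A_\Gamma^\lambda\cong(\mathbb A^\lambda)_\Gamma$$ as algebras, where $(\mathbb A^\lambda)_\Gamma$ is the algebra of $\Gamma$-coinvariants of $\mathbb A^\lambda$.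
   Context: $\Bbbk$ is an algebraically closed field of characteristic zero. $I$ is the set of nodes of the Dynkin diagram of $\mathfrak g$; "acting by diagram automorphisms" means the action on $\mathfrak g$ is induced by an action of $\Gamma$ on the Dynkin diagram via $e_i\mapsto e_{\gamma i}$, $f_i\mapsto f_{\gamma i}$, $h_i\mapsto h_{\gamma i}$ on Chevalley generators. The set $I_\Gamma$ of nodes of the Dynkin diagram of the fixed-point algebra $\mathfrak g^\Gamma$ is identified with the set of $\Gamma$-orbits in $I$; $\omega_{\mathbf i}$ ($\mathbf i\in I_\Gamma$) are the fundamental weights of $\mathfrak g^\Gamma$ and $\Lambda_\Gamma^+=\bigoplus_{\mathbf i\in I_\Gamma}\mathbb N\omega_{\mathbf i}$. For $i\in\mathbf i\in I_\Gamma$ put $r_i=r_{\mathbf i}$, and $\Gamma_i=\{\gamma\in\Gamma\mid\gamma i=i\}$. Let $J\subseteq I$ contain exactly one point of each $\Gamma$-orbit in $I$. For an algebra $B$, $S^nB=(B^{\otimes n})^{S_n}$. Define $$\mathbb A_\Gamma^\lambda=\bigotimes_{j\in J}S^{r_j}(A^{\Gamma_j}),\qquad\mathbb A^\lambda=\bigotimes_{i\in I}S^{r_i|\Gamma_i|}A.$$ The diagonal action of $\Gamma$ on $A^{\otimes r_i|\Gamma_i|}$ induces an action on $S^{r_i|\Gamma_i|}A$, and $\Gamma$ acts on $\mathbb A^\lambda$ by $\gamma(\bigotimes_{i\in I}a_i)=\bigotimes_{i\in I}\gamma a_{\gamma^{-1}i}$, with $a_i\in S^{r_i|\Gamma_i|}A$.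 For a commutative algebra $B$ with an action of a finite group $\Upsilon$ by automorphisms, $B_{(\Upsilon)}$ is the ideal of $B$ generated by $\{b-\gamma b\mid b\in B,\gamma\in\Upsilon\}$ and $B_\Upsilon=B/B_{(\Upsilon)}$ is the algebra of coinvariants. (Here $\mathbb A_\Gamma^\lambda$ is the algebra defined by the displayed formula, not a priori an algebra of coinvariants.) *)

theory Defs
  imports "HOL-Algebra.Algebra" "HOL-Combinatorics.Permutations"
begin

section \<open>Lie algebras\<close>

text \<open>As for every module in HOL-Algebra, the multiplication and the unit of the underlying ring
  record are irrelevant here; the product of a Lie algebra is \<open>bracket\<close>.\<close>

record ('k, 'l) lie_alg = "('k, 'l) module" +
  bracket :: "'l \<Rightarrow> 'l \<Rightarrow> 'l"

locale lie_algebra = module K L + field K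
  for K :: "('k, 'km) ring_scheme" and L :: "('k, 'l, 'lm) lie_alg_scheme" +
  assumes bracket_closed:
      "x \<in> carrier L \<Longrightarrow> y \<in> carrier L \<Longrightarrow> bracket L x y \<in> carrier L"
    and bracket_add_left:
      "x \<in> carrier L \<Longrightarrow> y \<in> carrier L \<Longrightarrow> z \<in> carrier L \<Longrightarrow>
        bracket L (x \<oplus>\<^bsub>L\<^esub> y) z = bracket L x z \<oplus>\<^bsub>L\<^esub> bracket L y z"
    and bracket_add_right:
      "x \<in> carrier L \<Longrightarrow> y \<in> carrier L \<Longrightarrow> z \<in> carrier L \<Longrightarrow>
        bracket L x (y \<oplus>\<^bsub>L\<^esub> z) = bracket L x y \<oplus>\<^bsub>L\<^esub> bracket L x z"
    and bracket_smult_left: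
      "c \<in> carrier K \<Longrightarrow> x \<in> carrier L \<Longrightarrow> y \<in> carrier L \<Longrightarrow>
        bracket L (c \<odot>\<^bsub>L\<^esub> x) y = c \<odot>\<^bsub>L\<^esub> bracket L x y"
    and bracket_smult_right:
      "c \<in> carrier K \<Longrightarrow> x \<in> carrier L \<Longrightarrow> y \<in> carrier L \<Longrightarrow>
        bracket L x (c \<odot>\<^bsub>L\<^esub> y) = c \<odot>\<^bsub>L\<^esub> bracket L x y"
    and bracket_self: "x \<in> carrier L \<Longrightarrow> bracket L x x = \<zero>\<^bsub>L\<^esub>"
    and jacobi:
      "x \<in> carrier L \<Longrightarrow> y \<in> carrier L \<Longrightarrow> z \<in> carrier L \<Longrightarrow>
        bracket L x (bracket L y z) \<oplus>\<^bsub>L\<^esub> bracket L y (bracket L z x) \<oplus>\<^bsub>L\<^esub> bracket L z (bracket L x y)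
          = \<zero>\<^bsub>L\<^esub>"

definition lin_span ::
    "('k, 'km) ring_scheme \<Rightarrow> ('k, 'l, 'lm) module_scheme \<Rightarrow> 'l set \<Rightarrow> 'l set" where
  "lin_span K L S = \<Inter>{N. submodule N K L \<and> S \<subseteq> N}"

definition finite_dimensional ::
    "('k, 'km) ring_scheme \<Rightarrow> ('k, 'l, 'lm) module_scheme \<Rightarrow> bool" where
  "finite_dimensional K L \<longleftrightarrow> (\<exists>B. finite B \<and> B \<subseteq> carrier L \<and> lin_span K L B = carrier L)"

definition lie_subalgebra ::
    "('k, 'km) ring_scheme \<Rightarrow> ('k, 'l, 'lm) lie_alg_scheme \<Rightarrow> 'l set \<Rightarrow> bool" where
  "lie_subalgebra K L H \<longleftrightarrow> submodule H K L \<and> (\<forall>x\<in>H. \<forall>y\<in>H. bracket L x y \<in> H)"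

definition lie_ideal ::
    "('k, 'km) ring_scheme \<Rightarrow> ('k, 'l, 'lm) lie_alg_scheme \<Rightarrow> 'l set \<Rightarrow> bool" where
  "lie_ideal K L N \<longleftrightarrow> submodule N K L \<and> (\<forall>x\<in>carrier L. \<forall>y\<in>N. bracket L x y \<in> N)"

definition simple_lie_algebra ::
    "('k, 'km) ring_scheme \<Rightarrow> ('k, 'l, 'lm) lie_alg_scheme \<Rightarrow> bool" where
  "simple_lie_algebra K L \<longleftrightarrow>
     lie_algebra K L \<and>
     (\<exists>x\<in>carrier L. \<exists>y\<in>carrier L. bracket L x y \<noteq> \<zero>\<^bsub>L\<^esub>) \<and>
     (\<forall>N. lie_ideal K L N \<longrightarrow> N = {\<zero>\<^bsub>L\<^esub>} \<or> N = carrier L)"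

primrec lower_central ::
    "('k, 'km) ring_scheme \<Rightarrow> ('k, 'l, 'lm) lie_alg_scheme \<Rightarrow> 'l set \<Rightarrow> nat \<Rightarrow> 'l set" where
  "lower_central K L H 0 = H"
| "lower_central K L H (Suc n) =
     lin_span K L {bracket L x y | x y. x \<in> H \<and> y \<in> lower_central K L H n}"

definition cartan_subalgebra ::
    "('k, 'km) ring_scheme \<Rightarrow> ('k, 'l, 'lm) lie_alg_scheme \<Rightarrow> 'l set \<Rightarrow> bool" where
  "cartan_subalgebra K L H \<longleftrightarrow>
     lie_subalgebra K L H \<and>
     (\<exists>n. lower_central K L H n = {\<zero>\<^bsub>L\<^esub>}) \<and>
     (\<forall>x\<in>carrier L. (\<forall>t\<in>H. bracket L x t \<in> H) \<longrightarrow> x \<in> H)"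

definition root_space ::
    "('k, 'km) ring_scheme \<Rightarrow> ('k, 'l, 'lm) lie_alg_scheme \<Rightarrow> 'l set \<Rightarrow> ('l \<Rightarrow> 'k) \<Rightarrow> 'l set" where
  "root_space K L H \<alpha> = {x \<in> carrier L. \<forall>t\<in>H. bracket L t x = \<alpha> t \<odot>\<^bsub>L\<^esub> x}"

text \<open>Functionals on \<open>H\<close> are total functions of which only the values on \<open>H\<close> matter.\<close>

definition is_root ::
    "('k, 'km) ring_scheme \<Rightarrow> ('k, 'l, 'lm) lie_alg_scheme \<Rightarrow> 'l set \<Rightarrow> ('l \<Rightarrow> 'k) \<Rightarrow> bool" where
  "is_root K L H \<alpha> \<longleftrightarrow>
     (\<forall>t\<in>H. \<alpha> t \<in> carrier K) \<and>
     (\<forall>s\<in>H. \<forall>t\<in>H. \<alpha> (s \<oplus>\<^bsub>L\<^esub> t) = \<alpha> s \<oplus>\<^bsub>K\<^esub> \<alpha> t) \<and>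
     (\<forall>c\<in>carrier K. \<forall>t\<in>H. \<alpha> (c \<odot>\<^bsub>L\<^esub> t) = c \<otimes>\<^bsub>K\<^esub> \<alpha> t) \<and>
     (\<exists>t\<in>H. \<alpha> t \<noteq> \<zero>\<^bsub>K\<^esub>) \<and>
     root_space K L H \<alpha> \<noteq> {\<zero>\<^bsub>L\<^esub>}"

definition simple_roots ::
    "('k, 'km) ring_scheme \<Rightarrow> ('k, 'l, 'lm) lie_alg_scheme \<Rightarrow> 'l set \<Rightarrow>
      'i set \<Rightarrow> ('i \<Rightarrow> 'l \<Rightarrow> 'k) \<Rightarrow> bool" where
  "simple_roots K L H I \<alpha> \<longleftrightarrow>
     finite I \<and>
     (\<forall>i\<in>I. is_root K L H (\<alpha> i)) \<and>
     (\<forall>c\<in>I \<rightarrow> carrier K.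
        (\<forall>t\<in>H. (\<Oplus>\<^bsub>K\<^esub>i\<in>I. c i \<otimes>\<^bsub>K\<^esub> \<alpha> i t) = \<zero>\<^bsub>K\<^esub>) \<longrightarrow> (\<forall>i\<in>I. c i = \<zero>\<^bsub>K\<^esub>)) \<and>
     (\<forall>\<beta>. is_root K L H \<beta> \<longrightarrow>
        (\<exists>n :: 'i \<Rightarrow> nat.
           (\<forall>t\<in>H. \<beta> t = (\<Oplus>\<^bsub>K\<^esub>i\<in>I. [n i] \<cdot>\<^bsub>K\<^esub> \<alpha> i t)) \<or>
           (\<forall>t\<in>H. \<beta> t = \<ominus>\<^bsub>K\<^esub> (\<Oplus>\<^bsub>K\<^esub>i\<in>I. [n i] \<cdot>\<^bsub>K\<^esub> \<alpha> i t))))"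

text \<open>\<open>I\<close> is the set of nodes of the Dynkin diagram, the diagram itself being encoded by the
  Cartan matrix \<open>C i j = \<alpha>\<^sub>j(h\<^sub>i)\<close>.\<close>

definition chevalley_generators ::
    "('k, 'km) ring_scheme \<Rightarrow> ('k, 'l, 'lm) lie_alg_scheme \<Rightarrow> 'i set \<Rightarrow> ('i \<Rightarrow> 'i \<Rightarrow> int) \<Rightarrow>
      ('i \<Rightarrow> 'l) \<Rightarrow> ('i \<Rightarrow> 'l) \<Rightarrow> ('i \<Rightarrow> 'l) \<Rightarrow> bool" where
  "chevalley_generators K L I C e f h \<longleftrightarrow>
     (\<exists>H \<alpha>. cartan_subalgebra K L H \<and> simple_roots K L H I \<alpha> \<and>
        (\<forall>i\<in>I.
           e i \<in> root_space K L H (\<alpha> i) \<and>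
           f i \<in> root_space K L H (\<lambda>t. \<ominus>\<^bsub>K\<^esub> \<alpha> i t) \<and>
           h i = bracket L (e i) (f i) \<and> h i \<in> H \<and>
           C i i = 2 \<and>
           (\<forall>j\<in>I. \<alpha> j (h i) = [C i j] \<cdot>\<^bsub>K\<^esub> \<one>\<^bsub>K\<^esub>)))"

definition dynkin_type_A :: "'i set \<Rightarrow> ('i \<Rightarrow> 'i \<Rightarrow> int) \<Rightarrow> nat \<Rightarrow> bool" where
  "dynkin_type_A I C m \<longleftrightarrow>
     (\<exists>b. bij_betw b {..<m} I \<and>
        (\<forall>p<m. \<forall>q<m. C (b p) (b q) =
           (if p = q then 2 else if p = Suc q \<or> q = Suc p then - 1 else 0)))"

definition lie_action ::
    "('k, 'km) ring_scheme \<Rightarrow> ('k, 'l, 'lm) lie_alg_scheme \<Rightarrow> ('g, 'gm) monoid_scheme \<Rightarrow>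
      ('g \<Rightarrow> 'l \<Rightarrow> 'l) \<Rightarrow> bool" where
  "lie_action K L G \<rho> \<longleftrightarrow>
     group_action G (carrier L) \<rho> \<and>
     (\<forall>g\<in>carrier G.
        (\<forall>x\<in>carrier L. \<forall>y\<in>carrier L. \<rho> g (x \<oplus>\<^bsub>L\<^esub> y) = \<rho> g x \<oplus>\<^bsub>L\<^esub> \<rho> g y) \<and>
        (\<forall>c\<in>carrier K. \<forall>x\<in>carrier L. \<rho> g (c \<odot>\<^bsub>L\<^esub> x) = c \<odot>\<^bsub>L\<^esub> \<rho> g x) \<and>
        (\<forall>x\<in>carrier L. \<forall>y\<in>carrier L. \<rho> g (bracket L x y) = bracket L (\<rho> g x) (\<rho> g y)))"

definition dynkin_action ::
    "'i set \<Rightarrow> ('i \<Rightarrow> 'i \<Rightarrow> int) \<Rightarrow> ('g, 'gm) monoid_scheme \<Rightarrow> ('g \<Rightarrow> 'i \<Rightarrow> 'i) \<Rightarrow> bool" where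
  "dynkin_action I C G \<tau> \<longleftrightarrow>
     group_action G I \<tau> \<and>
     (\<forall>g\<in>carrier G. \<forall>i\<in>I. \<forall>j\<in>I. C (\<tau> g i) (\<tau> g j) = C i j)"

text \<open>\<open>G\<close> acts on the Dynkin diagram by \<open>\<tau>\<close> and, through it, on \<open>L\<close> by \<open>\<rho>\<close>.\<close>

definition diagram_automorphism_action ::
    "('k, 'km) ring_scheme \<Rightarrow> ('k, 'l, 'lm) lie_alg_scheme \<Rightarrow> 'i set \<Rightarrow> ('i \<Rightarrow> 'i \<Rightarrow> int) \<Rightarrow>
      ('i \<Rightarrow> 'l) \<Rightarrow> ('i \<Rightarrow> 'l) \<Rightarrow> ('i \<Rightarrow> 'l) \<Rightarrow>
      ('g, 'gm) monoid_scheme \<Rightarrow> ('g \<Rightarrow> 'i \<Rightarrow> 'i) \<Rightarrow> ('g \<Rightarrow> 'l \<Rightarrow> 'l) \<Rightarrow> bool" where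
  "diagram_automorphism_action K L I C e f h G \<tau> \<rho> \<longleftrightarrow>
     dynkin_action I C G \<tau> \<and> lie_action K L G \<rho> \<and>
     (\<forall>g\<in>carrier G. \<forall>i\<in>I.
        \<rho> g (e i) = e (\<tau> g i) \<and> \<rho> g (f i) = f (\<tau> g i) \<and> \<rho> g (h i) = h (\<tau> g i))"

section \<open>Commutative algebras\<close>

definition char_zero :: "('k, 'km) ring_scheme \<Rightarrow> bool" where
  "char_zero K \<longleftrightarrow> (\<forall>n::nat. n > 0 \<longrightarrow> [n] \<cdot>\<^bsub>K\<^esub> \<one>\<^bsub>K\<^esub> \<noteq> \<zero>\<^bsub>K\<^esub>)"

definition alg_hom ::
    "('k, 'km) ring_scheme \<Rightarrow> ('k, 'a, 'am) module_scheme \<Rightarrow> ('k, 'b, 'bm) module_scheme \<Rightarrow>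
      ('a \<Rightarrow> 'b) set" where
  "alg_hom K A B =
     {u \<in> ring_hom A B. \<forall>c\<in>carrier K. \<forall>x\<in>carrier A. u (c \<odot>\<^bsub>A\<^esub> x) = c \<odot>\<^bsub>B\<^esub> u x}"

definition alg_isomorphic ::
    "('k, 'km) ring_scheme \<Rightarrow> ('k, 'a, 'am) module_scheme \<Rightarrow> ('k, 'b, 'bm) module_scheme \<Rightarrow>
      bool" where
  "alg_isomorphic K A B \<longleftrightarrow> (\<exists>u\<in>alg_hom K A B. bij_betw u (carrier A) (carrier B))"

definition finitely_generated_algebra ::
    "('k, 'km) ring_scheme \<Rightarrow> ('k, 'a, 'am) module_scheme \<Rightarrow> bool" where
  "finitely_generated_algebra K A \<longleftrightarrow>
     (\<exists>S. finite S \<and> S \<subseteq> carrier A \<and>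
        generate_ring A ((\<lambda>c. c \<odot>\<^bsub>A\<^esub> \<one>\<^bsub>A\<^esub>) ` carrier K \<union> S) = carrier A)"

definition max_spec :: "('a, 'am) ring_scheme \<Rightarrow> 'a set set" where
  "max_spec A = {M. maximalideal M A}"

text \<open>The intersection with the carrier gives the empty intersection its usual meaning.\<close>

definition jacobson_radical :: "('a, 'am) ring_scheme \<Rightarrow> 'a set" where
  "jacobson_radical A = carrier A \<inter> \<Inter>(max_spec A)"

definition reduced :: "('a, 'am) ring_scheme \<Rightarrow> bool" where
  "reduced A \<longleftrightarrow> (\<forall>x\<in>carrier A. \<forall>n::nat. x [^]\<^bsub>A\<^esub> n = \<zero>\<^bsub>A\<^esub> \<longrightarrow> x = \<zero>\<^bsub>A\<^esub>)"

definition algebra_action ::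
    "('k, 'km) ring_scheme \<Rightarrow> ('k, 'a, 'am) module_scheme \<Rightarrow> ('g, 'gm) monoid_scheme \<Rightarrow>
      ('g \<Rightarrow> 'a \<Rightarrow> 'a) \<Rightarrow> bool" where
  "algebra_action K A G \<phi> \<longleftrightarrow>
     group_action G (carrier A) \<phi> \<and> (\<forall>g\<in>carrier G. \<phi> g \<in> alg_hom K A A)"

definition free_on_max_spec ::
    "('a, 'am) ring_scheme \<Rightarrow> ('g, 'gm) monoid_scheme \<Rightarrow> ('g \<Rightarrow> 'a \<Rightarrow> 'a) \<Rightarrow> bool" where
  "free_on_max_spec A G \<phi> \<longleftrightarrow>
     (\<forall>M\<in>max_spec A. stabilizer G (\<lambda>g N. \<phi> g ` N) M = {\<one>\<^bsub>G\<^esub>})"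

definition fixed_subalgebra ::
    "('k, 'a, 'am) module_scheme \<Rightarrow> 'g set \<Rightarrow> ('g \<Rightarrow> 'a \<Rightarrow> 'a) \<Rightarrow> ('k, 'a, 'am) module_scheme"
  where
  "fixed_subalgebra A U \<phi> = A\<lparr>carrier := {a \<in> carrier A. \<forall>g\<in>U. \<phi> g a = a}\<rparr>"

text \<open>The library quotient ring, equipped with the scalar multiplication \<open>c (N + x) = N + c x\<close>.\<close>

definition quot_algebra ::
    "('k, 'a, 'am) module_scheme \<Rightarrow> 'a set \<Rightarrow> ('k, 'a set) module" where
  "quot_algebra A N =
     ring.extend (A Quot N) (module.fields (\<lambda>c S. \<Union>x\<in>S. N +>\<^bsub>A\<^esub> (c \<odot>\<^bsub>A\<^esub> x)))"

definition coinvariant_ideal ::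
    "('a, 'am) ring_scheme \<Rightarrow> 'g set \<Rightarrow> ('g \<Rightarrow> 'a \<Rightarrow> 'a) \<Rightarrow> 'a set" where
  "coinvariant_ideal B U \<psi> = Idl\<^bsub>B\<^esub> {b \<ominus>\<^bsub>B\<^esub> \<psi> g b | b g. b \<in> carrier B \<and> g \<in> U}"

definition coinvariants ::
    "('k, 'a, 'am) module_scheme \<Rightarrow> 'g set \<Rightarrow> ('g \<Rightarrow> 'a \<Rightarrow> 'a) \<Rightarrow> ('k, 'a set) module" where
  "coinvariants B U \<psi> = quot_algebra B (coinvariant_ideal B U \<psi>)"

section \<open>Tensor products of algebras\<close>

definition basis_vector :: "('k, 'km) ring_scheme \<Rightarrow> 'x \<Rightarrow> 'x \<Rightarrow> 'k" where
  "basis_vector K x = (\<lambda>y. if y = x then \<one>\<^bsub>K\<^esub> else \<zero>\<^bsub>K\<^esub>)"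

text \<open>The free \<open>K\<close>-module on the elements of a monoid, with multiplication
  \<open>e\<^sub>x e\<^sub>y = e\<^bsub>x y\<^esub>\<close>.\<close>

definition monoid_algebra ::
    "('k, 'km) ring_scheme \<Rightarrow> ('x, 'xm) monoid_scheme \<Rightarrow> ('k, 'x \<Rightarrow> 'k) module" where
  "monoid_algebra K M =
     \<lparr>carrier = {u. (\<forall>x\<in>carrier M. u x \<in> carrier K) \<and> (\<forall>x. x \<notin> carrier M \<longrightarrow> u x = \<zero>\<^bsub>K\<^esub>) \<and>
                    finite {x. u x \<noteq> \<zero>\<^bsub>K\<^esub>}},
      monoid.mult = (\<lambda>u v z. \<Oplus>\<^bsub>K\<^esub>p\<in>{p. u (fst p) \<noteq> \<zero>\<^bsub>K\<^esub> \<and> v (snd p) \<noteq> \<zero>\<^bsub>K\<^esub> \<and> fst p \<otimes>\<^bsub>M\<^esub> snd p = z}.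
                u (fst p) \<otimes>\<^bsub>K\<^esub> v (snd p)),
      one = basis_vector K \<one>\<^bsub>M\<^esub>,
      ring.zero = (\<lambda>_. \<zero>\<^bsub>K\<^esub>),
      ring.add = (\<lambda>u v x. u x \<oplus>\<^bsub>K\<^esub> v x),
      smult = (\<lambda>c u x. c \<otimes>\<^bsub>K\<^esub> u x)\<rparr>"

text \<open>The free module on the product of the (multiplicative monoids of the) \<open>B i\<close>; the basis vector
  of \<open>x\<close> represents the pure tensor of the \<open>x i\<close>.\<close>

abbreviation free_tensors ::
    "('k, 'km) ring_scheme \<Rightarrow> 'i set \<Rightarrow> ('i \<Rightarrow> ('k, 'b, 'bm) module_scheme) \<Rightarrow>
      ('k, ('i \<Rightarrow> 'b) \<Rightarrow> 'k) module" where
  "free_tensors K I B \<equiv> monoid_algebra K (product_group I B)"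

text \<open>The ideal generated by the multilinearity relations. Multiplying a relation by a basis vector
  gives a relation again, so this ideal is also the linear span of the relations.\<close>

definition tensor_relations ::
    "('k, 'km) ring_scheme \<Rightarrow> 'i set \<Rightarrow> ('i \<Rightarrow> ('k, 'b, 'bm) module_scheme) \<Rightarrow>
      (('i \<Rightarrow> 'b) \<Rightarrow> 'k) set" where
  "tensor_relations K I B = Idl\<^bsub>free_tensors K I B\<^esub>
     ({basis_vector K (x(i := a \<oplus>\<^bsub>B i\<^esub> b))
         \<ominus>\<^bsub>free_tensors K I B\<^esub>
         (basis_vector K (x(i := a)) \<oplus>\<^bsub>free_tensors K I B\<^esub> basis_vector K (x(i := b))) |
         x i a b. x \<in> (\<Pi>\<^sub>E i\<in>I. carrier (B i)) \<and> i \<in> I \<and> a \<in> carrier (B i) \<and> b \<in> carrier (B i)}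
      \<union>
      {basis_vector K (x(i := c \<odot>\<^bsub>B i\<^esub> a))
         \<ominus>\<^bsub>free_tensors K I B\<^esub>
         (c \<odot>\<^bsub>free_tensors K I B\<^esub> basis_vector K (x(i := a))) |
         x i a c. x \<in> (\<Pi>\<^sub>E i\<in>I. carrier (B i)) \<and> i \<in> I \<and> a \<in> carrier (B i) \<and> c \<in> carrier K})"

definition tensor_product ::
    "('k, 'km) ring_scheme \<Rightarrow> 'i set \<Rightarrow> ('i \<Rightarrow> ('k, 'b, 'bm) module_scheme) \<Rightarrow>
      ('k, (('i \<Rightarrow> 'b) \<Rightarrow> 'k) set) module" where
  "tensor_product K I B = quot_algebra (free_tensors K I B) (tensor_relations K I B)"

text \<open>The linear map \<open>e\<^sub>x \<mapsto> e\<^bsub>w x\<^esub>\<close>.\<close>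

definition pushforward ::
    "('k, 'km) ring_scheme \<Rightarrow> ('x \<Rightarrow> 'y) \<Rightarrow> ('x \<Rightarrow> 'k) \<Rightarrow> 'y \<Rightarrow> 'k" where
  "pushforward K w u = (\<lambda>y. \<Oplus>\<^bsub>K\<^esub>x\<in>{x. u x \<noteq> \<zero>\<^bsub>K\<^esub> \<and> w x = y}. u x)"

text \<open>The endomorphism of the tensor product sending the pure tensor of a family \<open>x\<close> to the pure
  tensor of \<open>w x\<close>. It is meaningful for those \<open>w\<close> that respect the multilinearity relations.\<close>

definition tensor_map ::
    "('k, 'km) ring_scheme \<Rightarrow> 'i set \<Rightarrow> ('i \<Rightarrow> ('k, 'b, 'bm) module_scheme) \<Rightarrow>
      (('i \<Rightarrow> 'b) \<Rightarrow> ('i \<Rightarrow> 'b)) \<Rightarrow> (('i \<Rightarrow> 'b) \<Rightarrow> 'k) set \<Rightarrow> (('i \<Rightarrow> 'b) \<Rightarrow> 'k) set" where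
  "tensor_map K I B w S =
     (\<Union>u\<in>S. tensor_relations K I B +>\<^bsub>free_tensors K I B\<^esub> pushforward K w u)"

abbreviation tensor_power ::
    "('k, 'km) ring_scheme \<Rightarrow> nat \<Rightarrow> ('k, 'b, 'bm) module_scheme \<Rightarrow>
      ('k, ((nat \<Rightarrow> 'b) \<Rightarrow> 'k) set) module" where
  "tensor_power K n B \<equiv> tensor_product K {..<n} (\<lambda>_. B)"

text \<open>The permutations act here on the right, which does not affect the fixed points.\<close>

definition sym_power ::
    "('k, 'km) ring_scheme \<Rightarrow> nat \<Rightarrow> ('k, 'b, 'bm) module_scheme \<Rightarrow>
      ('k, ((nat \<Rightarrow> 'b) \<Rightarrow> 'k) set) module" where
  "sym_power K n B =
     fixed_subalgebra (tensor_power K n B) {\<sigma>. \<sigma> permutes {..<n}}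
       (\<lambda>\<sigma>. tensor_map K {..<n} (\<lambda>_. B) (\<lambda>x. \<lambda>l\<in>{..<n}. x (\<sigma> l)))"

definition diagonal_action ::
    "('k, 'km) ring_scheme \<Rightarrow> nat \<Rightarrow> ('k, 'b, 'bm) module_scheme \<Rightarrow> ('g \<Rightarrow> 'b \<Rightarrow> 'b) \<Rightarrow>
      'g \<Rightarrow> ((nat \<Rightarrow> 'b) \<Rightarrow> 'k) set \<Rightarrow> ((nat \<Rightarrow> 'b) \<Rightarrow> 'k) set" where
  "diagonal_action K n B \<phi> g =
     tensor_map K {..<n} (\<lambda>_. B) (\<lambda>x. \<lambda>l\<in>{..<n}. \<phi> g (x l))"

section \<open>The algebras attached to a dominant weight\<close>

text \<open>The free commutative monoid on the fundamental weights, which are indexed by the set \<open>I\<^sub>\<Gamma>\<close> of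
  orbits of nodes: \<open>\<lambda>\<close> is the family of its coefficients \<open>r\<close>, and the fundamental weight of an orbit
  is the indicator function of that orbit.\<close>

definition dominant_weights ::
    "('g, 'gm) monoid_scheme \<Rightarrow> 'i set \<Rightarrow> ('g \<Rightarrow> 'i \<Rightarrow> 'i) \<Rightarrow> ('i set \<Rightarrow> nat) set" where
  "dominant_weights G I \<tau> = {r. \<forall>Q. Q \<notin> orbits G I \<tau> \<longrightarrow> r Q = 0}"

definition orbit_transversal ::
    "('g, 'gm) monoid_scheme \<Rightarrow> 'i set \<Rightarrow> ('g \<Rightarrow> 'i \<Rightarrow> 'i) \<Rightarrow> 'i set \<Rightarrow> bool" where
  "orbit_transversal G I \<tau> J \<longleftrightarrow> J \<subseteq> I \<and> (\<forall>Q\<in>orbits G I \<tau>. \<exists>!j. j \<in> J \<inter> Q)"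

definition coeff ::
    "('g, 'gm) monoid_scheme \<Rightarrow> ('g \<Rightarrow> 'i \<Rightarrow> 'i) \<Rightarrow> ('i set \<Rightarrow> nat) \<Rightarrow> 'i \<Rightarrow> nat" where
  "coeff G \<tau> r i = r (orbit G \<tau> i)"

text \<open>\<open>r\<^sub>i |\<Gamma>\<^sub>i|\<close>\<close>

definition mult_coeff ::
    "('g, 'gm) monoid_scheme \<Rightarrow> ('g \<Rightarrow> 'i \<Rightarrow> 'i) \<Rightarrow> ('i set \<Rightarrow> nat) \<Rightarrow> 'i \<Rightarrow> nat" where
  "mult_coeff G \<tau> r i = coeff G \<tau> r i * card (stabilizer G \<tau> i)"

definition A_Gamma ::
    "('k, 'km) ring_scheme \<Rightarrow> ('k, 'a, 'am) module_scheme \<Rightarrow> ('g, 'gm) monoid_scheme \<Rightarrow>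
      ('g \<Rightarrow> 'a \<Rightarrow> 'a) \<Rightarrow> ('g \<Rightarrow> 'i \<Rightarrow> 'i) \<Rightarrow> 'i set \<Rightarrow> ('i set \<Rightarrow> nat) \<Rightarrow>
      ('k, (('i \<Rightarrow> ((nat \<Rightarrow> 'a) \<Rightarrow> 'k) set) \<Rightarrow> 'k) set) module" where
  "A_Gamma K A G \<phi> \<tau> J r =
     tensor_product K J
       (\<lambda>j. sym_power K (coeff G \<tau> r j) (fixed_subalgebra A (stabilizer G \<tau> j) \<phi>))"

definition A_full ::
    "('k, 'km) ring_scheme \<Rightarrow> ('k, 'a, 'am) module_scheme \<Rightarrow> ('g, 'gm) monoid_scheme \<Rightarrow>
      'i set \<Rightarrow> ('g \<Rightarrow> 'i \<Rightarrow> 'i) \<Rightarrow> ('i set \<Rightarrow> nat) \<Rightarrow>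
      ('k, (('i \<Rightarrow> ((nat \<Rightarrow> 'a) \<Rightarrow> 'k) set) \<Rightarrow> 'k) set) module" where
  "A_full K A G I \<tau> r = tensor_product K I (\<lambda>i. sym_power K (mult_coeff G \<tau> r i) A)"

definition A_full_action ::
    "('k, 'km) ring_scheme \<Rightarrow> ('k, 'a, 'am) module_scheme \<Rightarrow> ('g, 'gm) monoid_scheme \<Rightarrow>
      ('g \<Rightarrow> 'a \<Rightarrow> 'a) \<Rightarrow> 'i set \<Rightarrow> ('g \<Rightarrow> 'i \<Rightarrow> 'i) \<Rightarrow> ('i set \<Rightarrow> nat) \<Rightarrow> 'g \<Rightarrow>
      (('i \<Rightarrow> ((nat \<Rightarrow> 'a) \<Rightarrow> 'k) set) \<Rightarrow> 'k) set \<Rightarrow> (('i \<Rightarrow> ((nat \<Rightarrow> 'a) \<Rightarrow> 'k) set) \<Rightarrow> 'k) set" where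
  "A_full_action K A G \<phi> I \<tau> r g =
     tensor_map K I (\<lambda>i. sym_power K (mult_coeff G \<tau> r i) A)
       (\<lambda>x. \<lambda>i\<in>I. diagonal_action K (mult_coeff G \<tau> r i) A \<phi> g (x (\<tau> (inv\<^bsub>G\<^esub> g) i)))"

end

theory Submission
  imports Defs
begin

text \<open>
  The isomorphism is a statement about one node at a time, glued along the orbits of nodes.

  Let \<open>U = \<Gamma>\<^sub>i\<close> be the stabilizer of a node, \<open>m\<close> its order and \<open>r = r\<^sub>i\<close>. The points of the spectrum of
  \<open>S\<^bsup>rm\<^esup>A\<close> are the multisets of \<open>rm\<close> points of the spectrum of \<open>A\<close>, and the coinvariants cut out those
  multisets that are stable under \<open>U\<close>. As \<open>U\<close> acts freely, these are the unions of \<open>r\<close> orbits, that is,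
  multisets of \<open>r\<close> points of the spectrum of \<open>A\<^bsup>U\<^esup>\<close>. This suggests \<open>(S\<^bsup>rm\<^esup>A)\<^sub>U \<cong> S\<^bsup>r\<^esup>(A\<^bsup>U\<^esup>)\<close>
  (\<open>sym_power_coinvariants\<close>).

  The map is the fold \<open>A\<^bsup>\<otimes>rm\<^esup> \<rightarrow> A\<^bsup>\<otimes>r\<^esup>\<close>, which multiplies together blocks of \<open>m\<close> factors after
  translating them by the different elements of \<open>U\<close>. It sends the power sum of \<open>a\<close> to the power sum of
  the trace of \<open>a\<close>. In characteristic zero the symmetric tensors are generated by power sums
  (\<open>power_sums_generate\<close>), and therefore the fold maps \<open>S\<^bsup>rm\<^esup>A\<close> onto \<open>S\<^bsup>r\<^esup>(A\<^bsup>U\<^esup>)\<close> and does not see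
  the action of \<open>U\<close>.

  It remains to show that an element \<open>x\<close> killed by the fold lies in the coinvariant ideal \<open>N\<close>
  (\<open>fold_kernel\<close>). By hypothesis \<open>N\<close> is a radical ideal. If \<open>x\<close> were not in \<open>N\<close>, averaging over the
  permutations and a prime ideal avoiding the powers of \<open>x\<close> would give a homomorphism \<open>q\<close> from the
  tensor power to a domain \<open>D\<close> that kills \<open>N\<close> but not \<open>x\<close>. The restrictions of \<open>q\<close> to the \<open>rm\<close> factors are
  homomorphisms \<open>\<chi>\<^sub>l : A \<rightarrow> D\<close>, and their sum is \<open>U\<close>-invariant since \<open>q\<close> kills \<open>N\<close>. By independence
  of characters, in characteristic zero, the family of the \<open>\<chi>\<^sub>l\<close> is then stable under \<open>U\<close>. Freeness says
  that the elements \<open>a - g a\<close> generate the unit ideal of \<open>A\<close> for each \<open>g \<noteq> 1\<close>, so \<open>U\<close> acts freely on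
  homomorphisms to \<open>D\<close> and the family is a union of \<open>r\<close> orbits (\<open>invariant_family_decomposition\<close>).
  Hence, on power sums and so on all symmetric tensors, \<open>q\<close> factors through the fold, and \<open>q x = 0\<close>.

  For the gluing (\<open>coinvariants_tensor_product\<close>), the tensor product is the coproduct of commutative
  algebras. Passing to \<open>\<Gamma>\<close>-coinvariants identifies the factors along an orbit and leaves, for a
  representative \<open>j \<in> J\<close>, the coinvariants of its factor under \<open>\<Gamma>\<^sub>j\<close>.

  Tensor products, defined as quotients of monoid algebras, enter the argument through their universal
  properties, with respect to multilinear maps (\<open>tensor_lift\<close>) and as coproducts (\<open>coproduct\<close>), and
  through the pure tensors, which span them.
\<close>

section \<open>Homomorphisms, subalgebras and quotients of commutative algebras\<close>

lemma alg_homI: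
  assumes "\<And>x. x \<in> carrier A \<Longrightarrow> u x \<in> carrier B"
    and "\<And>x y. x \<in> carrier A \<Longrightarrow> y \<in> carrier A \<Longrightarrow> u (x \<otimes>\<^bsub>A\<^esub> y) = u x \<otimes>\<^bsub>B\<^esub> u y"
    and "\<And>x y. x \<in> carrier A \<Longrightarrow> y \<in> carrier A \<Longrightarrow> u (x \<oplus>\<^bsub>A\<^esub> y) = u x \<oplus>\<^bsub>B\<^esub> u y"
    and "u \<one>\<^bsub>A\<^esub> = \<one>\<^bsub>B\<^esub>"
    and "\<And>c x. c \<in> carrier K \<Longrightarrow> x \<in> carrier A \<Longrightarrow> u (c \<odot>\<^bsub>A\<^esub> x) = c \<odot>\<^bsub>B\<^esub> u x"
  shows "u \<in> alg_hom K A B"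
  using assms by (auto simp: alg_hom_def ring_hom_def)

lemma alg_hom_closed: "u \<in> alg_hom K A B \<Longrightarrow> x \<in> carrier A \<Longrightarrow> u x \<in> carrier B"
  by (auto simp: alg_hom_def ring_hom_def)

lemma alg_hom_comp:
  assumes "u \<in> alg_hom K A B" "v \<in> alg_hom K B C"
  shows "(\<lambda>x. v (u x)) \<in> alg_hom K A C"
  using assms unfolding alg_hom_def ring_hom_def by (auto simp: Pi_iff)

locale algebra_hom = A: algebra K A + B: algebra K B
  for K :: "('k, 'km) ring_scheme" and A :: "('k, 'a, 'am) module_scheme"
    and B :: "('k, 'b, 'bm) module_scheme" +
  fixes u :: "'a \<Rightarrow> 'b"
  assumes hom: "u \<in> alg_hom K A B"
begin

lemma closed [simp, intro]: "x \<in> carrier A \<Longrightarrow> u x \<in> carrier B"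
  and mult [simp]: "x \<in> carrier A \<Longrightarrow> y \<in> carrier A \<Longrightarrow> u (x \<otimes>\<^bsub>A\<^esub> y) = u x \<otimes>\<^bsub>B\<^esub> u y"
  and add [simp]: "x \<in> carrier A \<Longrightarrow> y \<in> carrier A \<Longrightarrow> u (x \<oplus>\<^bsub>A\<^esub> y) = u x \<oplus>\<^bsub>B\<^esub> u y"
  and one [simp]: "u \<one>\<^bsub>A\<^esub> = \<one>\<^bsub>B\<^esub>"
  and smult [simp]: "c \<in> carrier K \<Longrightarrow> x \<in> carrier A \<Longrightarrow> u (c \<odot>\<^bsub>A\<^esub> x) = c \<odot>\<^bsub>B\<^esub> u x"
  using hom by (auto simp: alg_hom_def ring_hom_def)

lemma ring_hom_cring: "ring_hom_cring A B u"
  by (intro ring_hom_cringI A.M_cring B.M_cring ring_hom_ringI2 cring.axioms(1))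
     (use hom in \<open>auto simp: alg_hom_def\<close>)

sublocale ring_hom_cring A B u
  by (rule ring_hom_cring)

lemma a_minus [simp]:
  "x \<in> carrier A \<Longrightarrow> y \<in> carrier A \<Longrightarrow> u (x \<ominus>\<^bsub>A\<^esub> y) = u x \<ominus>\<^bsub>B\<^esub> u y"
  by (simp add: a_minus_def)

lemma sum:
  assumes "\<And>i. i \<in> F \<Longrightarrow> f i \<in> carrier A"
  shows "u (finsum A f F) = finsum B (\<lambda>i. u (f i)) F"
proof -
  have "f \<in> F \<rightarrow> carrier A" using assms by auto
  then show ?thesis by (simp add: o_def)
qed

lemma prod:
  assumes "\<And>i. i \<in> F \<Longrightarrow> f i \<in> carrier A"
  shows "u (finprod A f F) = finprod B (\<lambda>i. u (f i)) F"
proof -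
  have "f \<in> F \<rightarrow> carrier A" using assms by auto
  then show ?thesis by (subst hom_finprod) (simp_all add: o_def)
qed

lemma kernel_ideal: "ideal {x \<in> carrier A. u x = \<zero>\<^bsub>B\<^esub>} A"
  using ring.kernel_is_ideal by (simp only: a_kernel_def')

lemma eq_if_diff_zero:
  "x \<in> carrier A \<Longrightarrow> y \<in> carrier A \<Longrightarrow> u (x \<ominus>\<^bsub>A\<^esub> y) = \<zero>\<^bsub>B\<^esub> \<longleftrightarrow> u x = u y"
  by (simp only: a_minus B.r_right_minus_eq closed)

end

lemma algebra_homI:
  "algebra K A \<Longrightarrow> algebra K B \<Longrightarrow> u \<in> alg_hom K A B \<Longrightarrow> algebra_hom K A B u"
  by (intro algebra_hom.intro algebra_hom_axioms.intro)

definition subalg ::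
    "('k, 'km) ring_scheme \<Rightarrow> ('k, 'a, 'am) module_scheme \<Rightarrow> 'a set \<Rightarrow> bool" where
  "subalg K A W \<longleftrightarrow> W \<subseteq> carrier A \<and> \<one>\<^bsub>A\<^esub> \<in> W \<and>
     (\<forall>x\<in>W. \<forall>y\<in>W. x \<oplus>\<^bsub>A\<^esub> y \<in> W \<and> x \<otimes>\<^bsub>A\<^esub> y \<in> W) \<and>
     (\<forall>c\<in>carrier K. \<forall>x\<in>W. c \<odot>\<^bsub>A\<^esub> x \<in> W)"

lemma (in algebra) subalgI:
  assumes "W \<subseteq> carrier M" "\<one>\<^bsub>M\<^esub> \<in> W"
    and "\<And>x y. x \<in> W \<Longrightarrow> y \<in> W \<Longrightarrow> x \<oplus>\<^bsub>M\<^esub> y \<in> W"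
    and "\<And>x y. x \<in> W \<Longrightarrow> y \<in> W \<Longrightarrow> x \<otimes>\<^bsub>M\<^esub> y \<in> W"
    and "\<And>c x. c \<in> carrier R \<Longrightarrow> x \<in> W \<Longrightarrow> c \<odot>\<^bsub>M\<^esub> x \<in> W"
  shows "subalg R M W"
  using assms by (auto simp: subalg_def)

context algebra
begin

context
  fixes W assumes W: "subalg R M W"
begin

lemma subalg_carrier: "x \<in> W \<Longrightarrow> x \<in> carrier M"
  and subalg_one: "\<one>\<^bsub>M\<^esub> \<in> W"
  and subalg_add: "x \<in> W \<Longrightarrow> y \<in> W \<Longrightarrow> x \<oplus>\<^bsub>M\<^esub> y \<in> W"
  and subalg_mult: "x \<in> W \<Longrightarrow> y \<in> W \<Longrightarrow> x \<otimes>\<^bsub>M\<^esub> y \<in> W"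
  and subalg_smult: "c \<in> carrier R \<Longrightarrow> x \<in> W \<Longrightarrow> c \<odot>\<^bsub>M\<^esub> x \<in> W"
  using W by (auto simp: subalg_def)

lemma subalg_zero: "\<zero>\<^bsub>M\<^esub> \<in> W"
  using subalg_smult[OF R.zero_closed subalg_one] by simp

lemma subalg_a_inv: "x \<in> W \<Longrightarrow> \<ominus>\<^bsub>M\<^esub> x \<in> W"
  using subalg_smult[of "\<ominus>\<^bsub>R\<^esub> \<one>\<^bsub>R\<^esub>" x] subalg_carrier[of x] by (simp add: smult_l_minus)

lemma subalg_minus: "x \<in> W \<Longrightarrow> y \<in> W \<Longrightarrow> x \<ominus>\<^bsub>M\<^esub> y \<in> W"
  by (simp add: a_minus_def subalg_add subalg_a_inv)

lemma subalg_finsum: "(\<And>i. i \<in> F \<Longrightarrow> f i \<in> W) \<Longrightarrow> finsum M f F \<in> W"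
proof (induction F rule: infinite_finite_induct)
  case (insert x F)
  then have "f \<in> F \<rightarrow> carrier M" "f x \<in> carrier M"
    using subalg_carrier by auto
  with insert show ?case by (simp add: M.finsum_insert subalg_add)
qed (simp_all add: subalg_zero)

lemma subalg_finprod: "(\<And>i. i \<in> F \<Longrightarrow> f i \<in> W) \<Longrightarrow> finprod M f F \<in> W"
proof (induction F rule: infinite_finite_induct)
  case (insert x F)
  then have "f \<in> F \<rightarrow> carrier M" "f x \<in> carrier M"
    using subalg_carrier by auto
  with insert show ?case by (simp add: subalg_mult)
qed (simp_all add: subalg_one)

lemma subalg_algebra: "algebra R (M\<lparr>carrier := W\<rparr>)"
proof (rule algebraI)
  show "cring R" by (rule R_cring)
  show "cring (M\<lparr>carrier := W\<rparr>)"
  proof (rule cringI)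
    show "abelian_group (M\<lparr>carrier := W\<rparr>)"
    proof (rule abelian_groupI)
      fix x assume "x \<in> carrier (M\<lparr>carrier := W\<rparr>)"
      then have "\<ominus>\<^bsub>M\<^esub> x \<in> W" "\<ominus>\<^bsub>M\<^esub> x \<oplus>\<^bsub>M\<^esub> x = \<zero>\<^bsub>M\<^esub>"
        using subalg_a_inv subalg_carrier by (auto simp: M.l_neg)
      then show "\<exists>y\<in>carrier (M\<lparr>carrier := W\<rparr>). y \<oplus>\<^bsub>M\<lparr>carrier := W\<rparr>\<^esub> x = \<zero>\<^bsub>M\<lparr>carrier := W\<rparr>\<^esub>"
        by auto
    qed (auto simp: subalg_add subalg_zero subalg_carrier M.a_ac)
    show "comm_monoid (M\<lparr>carrier := W\<rparr>)"
      by (rule comm_monoidI) (auto simp: subalg_mult subalg_one subalg_carrier m_ac)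
  qed (auto simp: subalg_carrier l_distr)
qed (auto simp: subalg_smult subalg_carrier smult_l_distr smult_r_distr smult_assoc1 smult_assoc2)

end

lemma subalg_carrier_self: "subalg R M (carrier M)"
  by (rule subalgI) auto

end

lemma (in algebra_hom) subalg_vimage:
  assumes "subalg K B W"
  shows "subalg K A {x \<in> carrier A. u x \<in> W}"
  by (rule A.subalgI)
     (auto simp: B.subalg_one[OF assms] B.subalg_add[OF assms] B.subalg_mult[OF assms]
        B.subalg_smult[OF assms])

lemma (in algebra_hom) subalg_image:
  assumes W: "subalg K A W"
  shows "subalg K B (u ` W)"
proof (rule B.subalgI)
  note c = A.subalg_carrier[OF W]
  show "u ` W \<subseteq> carrier B" using c by auto
  show "\<one>\<^bsub>B\<^esub> \<in> u ` W" using A.subalg_one[OF W] by (rule rev_image_eqI) simp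
  show "x \<oplus>\<^bsub>B\<^esub> y \<in> u ` W" if "x \<in> u ` W" "y \<in> u ` W" for x y
  proof -
    obtain x' y' where "x = u x'" "y = u y'" "x' \<in> W" "y' \<in> W" using \<open>x \<in> u ` W\<close> \<open>y \<in> u ` W\<close> by auto
    then have "x \<oplus>\<^bsub>B\<^esub> y = u (x' \<oplus>\<^bsub>A\<^esub> y')" "x' \<oplus>\<^bsub>A\<^esub> y' \<in> W" using c A.subalg_add[OF W] by auto
    then show ?thesis by auto
  qed
  show "x \<otimes>\<^bsub>B\<^esub> y \<in> u ` W" if "x \<in> u ` W" "y \<in> u ` W" for x y
  proof -
    obtain x' y' where "x = u x'" "y = u y'" "x' \<in> W" "y' \<in> W" using \<open>x \<in> u ` W\<close> \<open>y \<in> u ` W\<close> by auto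
    then have "x \<otimes>\<^bsub>B\<^esub> y = u (x' \<otimes>\<^bsub>A\<^esub> y')" "x' \<otimes>\<^bsub>A\<^esub> y' \<in> W" using c A.subalg_mult[OF W] by auto
    then show ?thesis by auto
  qed
  show "k \<odot>\<^bsub>B\<^esub> x \<in> u ` W" if "k \<in> carrier K" "x \<in> u ` W" for k x
  proof -
    obtain x' where "x = u x'" "x' \<in> W" using \<open>x \<in> u ` W\<close> by auto
    then have "k \<odot>\<^bsub>B\<^esub> x = u (k \<odot>\<^bsub>A\<^esub> x')" "k \<odot>\<^bsub>A\<^esub> x' \<in> W" using \<open>k \<in> carrier K\<close> c A.subalg_smult[OF W] by auto
    then show ?thesis by auto
  qed
qed

lemma subalg_equalizer:
  assumes "algebra_hom K A B u" "algebra_hom K A B v"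
  shows "subalg K A {x \<in> carrier A. u x = v x}"
proof -
  interpret U: algebra_hom K A B u by fact
  interpret V: algebra_hom K A B v by fact
  show ?thesis by (rule U.A.subalgI) auto
qed

text \<open>Each law in \<open>B\<close> is the image of the same law in \<open>A\<close>. This is how quotients are recognised as
  algebras.\<close>

lemma algebra_surj:
  fixes K :: "('k, 'km) ring_scheme" and A :: "('k, 'a, 'am) module_scheme"
    and B :: "('k, 'b, 'bm) module_scheme"
  assumes "algebra K A" and surj: "u ` carrier A = carrier B"
    and mult: "\<And>x y. x \<in> carrier A \<Longrightarrow> y \<in> carrier A \<Longrightarrow> u (x \<otimes>\<^bsub>A\<^esub> y) = u x \<otimes>\<^bsub>B\<^esub> u y"
    and add: "\<And>x y. x \<in> carrier A \<Longrightarrow> y \<in> carrier A \<Longrightarrow> u (x \<oplus>\<^bsub>A\<^esub> y) = u x \<oplus>\<^bsub>B\<^esub> u y"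
    and one: "u \<one>\<^bsub>A\<^esub> = \<one>\<^bsub>B\<^esub>" and zero: "u \<zero>\<^bsub>A\<^esub> = \<zero>\<^bsub>B\<^esub>"
    and smult: "\<And>c x. c \<in> carrier K \<Longrightarrow> x \<in> carrier A \<Longrightarrow> u (c \<odot>\<^bsub>A\<^esub> x) = c \<odot>\<^bsub>B\<^esub> u x"
  shows "algebra K B"
proof -
  interpret A: algebra K A by fact
  have ex: "\<exists>x\<in>carrier A. y = u x" if "y \<in> carrier B" for y using surj that by auto
  have cl: "x \<in> carrier A \<Longrightarrow> u x \<in> carrier B" for x using surj by auto
  note sym = mult[symmetric] add[symmetric] one[symmetric] zero[symmetric] smult[symmetric]
  show ?thesis
  proof (rule algebraI)
    show "cring K" by (rule A.R_cring)
    show "cring B"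
    proof (rule cringI)
      show "abelian_group B"
      proof (rule abelian_groupI)
        fix x assume "x \<in> carrier B"
        then obtain x' where "x = u x'" "x' \<in> carrier A" using ex by auto
        then have "u (\<ominus>\<^bsub>A\<^esub> x') \<oplus>\<^bsub>B\<^esub> x = \<zero>\<^bsub>B\<^esub>" "u (\<ominus>\<^bsub>A\<^esub> x') \<in> carrier B"
          by (auto simp: sym A.l_neg cl)
        then show "\<exists>y\<in>carrier B. y \<oplus>\<^bsub>B\<^esub> x = \<zero>\<^bsub>B\<^esub>" by blast
      qed (auto dest!: ex simp: sym cl A.a_ac)
      show "comm_monoid B"
        by (rule comm_monoidI) (auto dest!: ex simp: sym cl A.m_ac)
    qed (auto dest!: ex simp: sym A.l_distr)
  qed (auto dest!: ex simp: sym cl A.smult_l_distr A.smult_r_distr A.smult_assoc1 A.smult_assoc2)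
qed

lemma quot_algebra_simps:
  "carrier (quot_algebra A N) = a_rcosets\<^bsub>A\<^esub> N"
  "monoid.mult (quot_algebra A N) = rcoset_mult A N"
  "one (quot_algebra A N) = N +>\<^bsub>A\<^esub> \<one>\<^bsub>A\<^esub>"
  "ring.zero (quot_algebra A N) = N"
  "ring.add (quot_algebra A N) = set_add A"
  "module.smult (quot_algebra A N) = (\<lambda>c S. \<Union>x\<in>S. N +>\<^bsub>A\<^esub> (c \<odot>\<^bsub>A\<^esub> x))"
  by (simp_all add: quot_algebra_def FactRing_def ring.defs module.defs)

locale algebra_ideal = algebra K A + ideal N A
  for K :: "('k, 'km) ring_scheme" and A :: "('k, 'a, 'am) module_scheme" and N
begin

lemma ideal_smult: "c \<in> carrier K \<Longrightarrow> x \<in> N \<Longrightarrow> c \<odot>\<^bsub>A\<^esub> x \<in> N"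
  using I_l_closed[of x "c \<odot>\<^bsub>A\<^esub> \<one>\<^bsub>A\<^esub>"] Icarr[of x] by (simp add: smult_assoc2)

lemma coset_eq_iff:
  assumes "x \<in> carrier A" "y \<in> carrier A"
  shows "N +>\<^bsub>A\<^esub> x = N +>\<^bsub>A\<^esub> y \<longleftrightarrow> x \<ominus>\<^bsub>A\<^esub> y \<in> N"
  using assms quotient_eq_iff_same_a_r_cos[OF is_ideal] by auto

lemma coset_smult:
  assumes "c \<in> carrier K" "x \<in> carrier A"
  shows "c \<odot>\<^bsub>quot_algebra A N\<^esub> (N +>\<^bsub>A\<^esub> x) = N +>\<^bsub>A\<^esub> (c \<odot>\<^bsub>A\<^esub> x)"
proof -
  have "N +>\<^bsub>A\<^esub> (c \<odot>\<^bsub>A\<^esub> y) = N +>\<^bsub>A\<^esub> (c \<odot>\<^bsub>A\<^esub> x)" if y: "y \<in> N +>\<^bsub>A\<^esub> x" for y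
  proof -
    obtain n where n: "n \<in> N" "y = n \<oplus>\<^bsub>A\<^esub> x" using y unfolding a_r_coset_def' by auto
    then have "c \<odot>\<^bsub>A\<^esub> y \<ominus>\<^bsub>A\<^esub> c \<odot>\<^bsub>A\<^esub> x = c \<odot>\<^bsub>A\<^esub> n"
      using assms Icarr[OF n(1)] by (simp add: smult_r_distr a_minus_def a_assoc M.r_neg)
    then show ?thesis
      using n assms Icarr[OF n(1)] ideal_smult by (subst coset_eq_iff) auto
  qed
  moreover have "x \<in> N +>\<^bsub>A\<^esub> x" using assms a_rcos_self by auto
  ultimately show ?thesis unfolding quot_algebra_simps by (intro SUP_eq_const) blast+
qed

lemma coset_surj: "(\<lambda>x. N +>\<^bsub>A\<^esub> x) ` carrier A = carrier (quot_algebra A N)"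
  by (auto simp: quot_algebra_simps A_RCOSETS_def' )

lemma coset_zero: "N +>\<^bsub>A\<^esub> \<zero>\<^bsub>A\<^esub> = N"
  by (rule a_rcos_const[OF zero_closed])

lemma quot_algebra_algebra: "algebra K (quot_algebra A N)"
  by (rule algebra_surj[where A = A and u = "\<lambda>x. N +>\<^bsub>A\<^esub> x"])
     (auto simp: coset_surj coset_smult[symmetric] algebra_axioms,
      auto simp: quot_algebra_simps rcoset_mult_add a_rcos_sum coset_zero)

lemma coset_hom: "(\<lambda>x. N +>\<^bsub>A\<^esub> x) \<in> alg_hom K A (quot_algebra A N)"
  by (rule alg_homI)
     (use coset_surj in \<open>auto simp: coset_smult[symmetric]\<close>,
      auto simp: quot_algebra_simps rcoset_mult_add a_rcos_sum)

sublocale coset: algebra_hom K A "quot_algebra A N" "\<lambda>x. N +>\<^bsub>A\<^esub> x"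
  by (intro algebra_homI algebra_axioms quot_algebra_algebra coset_hom)

lemma coset_zero_iff: "x \<in> carrier A \<Longrightarrow> N +>\<^bsub>A\<^esub> x = \<zero>\<^bsub>quot_algebra A N\<^esub> \<longleftrightarrow> x \<in> N"
  using a_rcos_const a_rcos_self by (auto simp: quot_algebra_simps)

end

text \<open>Stated for an arbitrary surjection \<open>p\<close> and not just for the projection to a quotient: below, \<open>p\<close>
  is the fold of a symmetric power, of which only the kernel is known.\<close>

lemma alg_hom_factor:
  assumes "algebra_hom K A B p" "algebra_hom K A C q"
    and surj: "p ` carrier A = carrier B"
    and ker: "\<And>x. x \<in> carrier A \<Longrightarrow> p x = \<zero>\<^bsub>B\<^esub> \<Longrightarrow> q x = \<zero>\<^bsub>C\<^esub>"
  shows "\<exists>v\<in>alg_hom K B C. \<forall>x\<in>carrier A. v (p x) = q x"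
proof -
  interpret P: algebra_hom K A B p by fact
  interpret Q: algebra_hom K A C q by fact
  have eq: "q x = q y" if "x \<in> carrier A" "y \<in> carrier A" "p x = p y" for x y
  proof -
    have "p (x \<ominus>\<^bsub>A\<^esub> y) = \<zero>\<^bsub>B\<^esub>" using that by (simp add: P.B.r_neg a_minus_def)
    then have "q x \<ominus>\<^bsub>C\<^esub> q y = \<zero>\<^bsub>C\<^esub>" using ker[of "x \<ominus>\<^bsub>A\<^esub> y"] that by simp
    then show ?thesis using that by simp
  qed
  define v where "v y = q (SOME x. x \<in> carrier A \<and> p x = y)" for y
  have v: "v (p x) = q x" if "x \<in> carrier A" for x
  proof -
    have "(SOME z. z \<in> carrier A \<and> p z = p x) \<in> carrier A \<and> p (SOME z. z \<in> carrier A \<and> p z = p x) = p x"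
      by (rule someI[of _ x]) (use that in auto)
    then show ?thesis unfolding v_def by (intro eq that) auto
  qed
  have ex: "\<exists>x\<in>carrier A. y = p x" if "y \<in> carrier B" for y using surj that by auto
  have "v \<in> alg_hom K B C"
  proof (rule alg_homI)
    fix y assume "y \<in> carrier B"
    then obtain x where x: "x \<in> carrier A" "y = p x" using ex by auto
    show "v y \<in> carrier C" using x v by simp
    fix c assume "c \<in> carrier K"
    then show "v (c \<odot>\<^bsub>B\<^esub> y) = c \<odot>\<^bsub>C\<^esub> v y"
      using x v[of x] v[of "c \<odot>\<^bsub>A\<^esub> x"] by simp
  next
    fix y z assume "y \<in> carrier B" "z \<in> carrier B"
    then obtain x x' where "x \<in> carrier A" "y = p x" "x' \<in> carrier A" "z = p x'" using ex by metis
    then show "v (y \<otimes>\<^bsub>B\<^esub> z) = v y \<otimes>\<^bsub>C\<^esub> v z" "v (y \<oplus>\<^bsub>B\<^esub> z) = v y \<oplus>\<^bsub>C\<^esub> v z"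
      using v[of x] v[of x'] v[of "x \<otimes>\<^bsub>A\<^esub> x'"] v[of "x \<oplus>\<^bsub>A\<^esub> x'"] by simp_all
  next
    show "v \<one>\<^bsub>B\<^esub> = \<one>\<^bsub>C\<^esub>" using v[OF P.A.one_closed] by simp
  qed
  with v show ?thesis by auto
qed

text \<open>The setting in which a coinvariant ideal makes sense. It is applied to a symmetric power with the
  action of a stabilizer, and to the big tensor product with the action of the whole group.\<close>

locale algebra_with_endos = algebra K B for K :: "('k, 'km) ring_scheme" and B :: "('k, 'b, 'bm) module_scheme" +
  fixes U :: "'g set" and d :: "'g \<Rightarrow> 'b \<Rightarrow> 'b"
  assumes endo_closed: "g \<in> U \<Longrightarrow> b \<in> carrier B \<Longrightarrow> d g b \<in> carrier B"
begin

lemma generators_closed: "{b \<ominus>\<^bsub>B\<^esub> d g b | b g. b \<in> carrier B \<and> g \<in> U} \<subseteq> carrier B"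
  using endo_closed by auto

lemma coinv_ideal: "ideal (coinvariant_ideal B U d) B"
  unfolding coinvariant_ideal_def by (rule genideal_ideal[OF generators_closed])

lemma coinv_mem: "b \<in> carrier B \<Longrightarrow> g \<in> U \<Longrightarrow> b \<ominus>\<^bsub>B\<^esub> d g b \<in> coinvariant_ideal B U d"
  unfolding coinvariant_ideal_def using genideal_self[OF generators_closed] by blast

lemma coinv_minimal:
  assumes "ideal N B" "\<And>b g. b \<in> carrier B \<Longrightarrow> g \<in> U \<Longrightarrow> b \<ominus>\<^bsub>B\<^esub> d g b \<in> N"
  shows "coinvariant_ideal B U d \<subseteq> N"
  unfolding coinvariant_ideal_def using assms(2) by (intro genideal_minimal[OF assms(1)]) blast

text \<open>A homomorphism kills the generators of the coinvariant ideal exactly when it does not change along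
  the maps \<open>d g\<close>; this is how maps out of coinvariants are produced.\<close>

lemma coinv_vanish:
  assumes "algebra_hom K B C u" "\<And>b g. b \<in> carrier B \<Longrightarrow> g \<in> U \<Longrightarrow> u (d g b) = u b"
    and "x \<in> coinvariant_ideal B U d"
  shows "u x = \<zero>\<^bsub>C\<^esub>"
proof -
  interpret u: algebra_hom K B C u by fact
  have "coinvariant_ideal B U d \<subseteq> {x \<in> carrier B. u x = \<zero>\<^bsub>C\<^esub>}"
  proof (rule coinv_minimal[OF u.kernel_ideal])
    fix b g assume b: "b \<in> carrier B" and g: "g \<in> U"
    have "u (b \<ominus>\<^bsub>B\<^esub> d g b) = \<zero>\<^bsub>C\<^esub>"
      using u.eq_if_diff_zero[OF b endo_closed[OF g b]] assms(2)[OF b g] by simp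
    then show "b \<ominus>\<^bsub>B\<^esub> d g b \<in> {x \<in> carrier B. u x = \<zero>\<^bsub>C\<^esub>}"
      using minus_closed[OF b endo_closed[OF g b]] by blast
  qed
  then show ?thesis using assms(3) by blast
qed

end

section \<open>Monoid algebras\<close>

locale monoid_alg = K: cring K + M: comm_monoid M
  for K :: "('k, 'km) ring_scheme" and M :: "('x, 'xm) monoid_scheme"
begin

abbreviation P :: "('k, 'x \<Rightarrow> 'k) module" where "P \<equiv> monoid_algebra K M"
abbreviation e :: "'x \<Rightarrow> 'x \<Rightarrow> 'k" where "e \<equiv> basis_vector K"
abbreviation supp :: "('x \<Rightarrow> 'k) \<Rightarrow> 'x set" where "supp u \<equiv> {x. u x \<noteq> \<zero>\<^bsub>K\<^esub>}"

lemma P_simps: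
  "\<zero>\<^bsub>P\<^esub> = (\<lambda>_. \<zero>\<^bsub>K\<^esub>)" "u \<oplus>\<^bsub>P\<^esub> v = (\<lambda>x. u x \<oplus>\<^bsub>K\<^esub> v x)" "c \<odot>\<^bsub>P\<^esub> u = (\<lambda>x. c \<otimes>\<^bsub>K\<^esub> u x)"
  "\<one>\<^bsub>P\<^esub> = e \<one>\<^bsub>M\<^esub>"
  and P_mult: "(u \<otimes>\<^bsub>P\<^esub> v) z = (\<Oplus>\<^bsub>K\<^esub>p\<in>{p. u (fst p) \<noteq> \<zero>\<^bsub>K\<^esub> \<and> v (snd p) \<noteq> \<zero>\<^bsub>K\<^esub> \<and> fst p \<otimes>\<^bsub>M\<^esub> snd p = z}.
                u (fst p) \<otimes>\<^bsub>K\<^esub> v (snd p))"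
  by (simp_all add: monoid_algebra_def)

lemma P_carrier: "u \<in> carrier P \<longleftrightarrow> (\<forall>x. u x \<in> carrier K) \<and> supp u \<subseteq> carrier M \<and> finite (supp u)"
  by (auto simp: monoid_algebra_def)

lemma P_memI:
  assumes "\<And>x. u x \<in> carrier K" "\<And>x. u x \<noteq> \<zero>\<^bsub>K\<^esub> \<Longrightarrow> x \<in> F" "F \<subseteq> carrier M" "finite F"
  shows "u \<in> carrier P"
  unfolding P_carrier using assms by (auto intro: finite_subset[of _ F])

lemma P_val [simp]: "u \<in> carrier P \<Longrightarrow> u x \<in> carrier K"
  and P_supp: "u \<in> carrier P \<Longrightarrow> supp u \<subseteq> carrier M"
  and P_fin [simp]: "u \<in> carrier P \<Longrightarrow> finite (supp u)"
  by (auto simp: P_carrier)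

lemma P_zero [simp]: "(\<lambda>_. \<zero>\<^bsub>K\<^esub>) \<in> carrier P"
  by (rule P_memI[where F = "{}"]) auto

lemma e_closed [simp]: "x \<in> carrier M \<Longrightarrow> e x \<in> carrier P"
  by (rule P_memI[where F = "{x}"]) (auto simp: basis_vector_def split: if_splits)

lemma P_add [simp]: "u \<in> carrier P \<Longrightarrow> v \<in> carrier P \<Longrightarrow> (\<lambda>x. u x \<oplus>\<^bsub>K\<^esub> v x) \<in> carrier P"
proof -
  assume u: "u \<in> carrier P" and v: "v \<in> carrier P"
  show ?thesis
    by (rule P_memI[where F = "supp u \<union> supp v"]) (use u v P_supp[OF u] P_supp[OF v] in auto)
qed

lemma P_smult [simp]: "c \<in> carrier K \<Longrightarrow> u \<in> carrier P \<Longrightarrow> (\<lambda>x. c \<otimes>\<^bsub>K\<^esub> u x) \<in> carrier P"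
proof -
  assume c: "c \<in> carrier K" and u: "u \<in> carrier P"
  show ?thesis
    by (rule P_memI[where F = "supp u"]) (use c u P_supp[OF u] in auto)
qed

text \<open>The product is rewritten as a sum over a rectangle that may be larger than the supports: two
  products can then be compared over a common rectangle, which gives bilinearity.\<close>

lemma P_mult_eq:
  assumes u: "u \<in> carrier P" and v: "v \<in> carrier P"
    and XX: "finite XX" "supp u \<subseteq> XX" and YY: "finite YY" "supp v \<subseteq> YY"
  shows "(u \<otimes>\<^bsub>P\<^esub> v) z =
    (\<Oplus>\<^bsub>K\<^esub>p\<in>XX \<times> YY. if fst p \<otimes>\<^bsub>M\<^esub> snd p = z then u (fst p) \<otimes>\<^bsub>K\<^esub> v (snd p) else \<zero>\<^bsub>K\<^esub>)"
proof -
  have "(u \<otimes>\<^bsub>P\<^esub> v) z = (\<Oplus>\<^bsub>K\<^esub>p\<in>{p. u (fst p) \<noteq> \<zero>\<^bsub>K\<^esub> \<and> v (snd p) \<noteq> \<zero>\<^bsub>K\<^esub> \<and> fst p \<otimes>\<^bsub>M\<^esub> snd p = z}.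
                u (fst p) \<otimes>\<^bsub>K\<^esub> v (snd p))"
    by (rule P_mult)
  also have "\<dots> = (\<Oplus>\<^bsub>K\<^esub>p\<in>XX \<times> YY. if fst p \<otimes>\<^bsub>M\<^esub> snd p = z then u (fst p) \<otimes>\<^bsub>K\<^esub> v (snd p) else \<zero>\<^bsub>K\<^esub>)"
    using assms by (intro K.add.finprod_mono_neutral_cong_left) auto
  finally show ?thesis .
qed

lemma P_mult_closed [simp]:
  assumes u: "u \<in> carrier P" and v: "v \<in> carrier P"
  shows "u \<otimes>\<^bsub>P\<^esub> v \<in> carrier P"
proof -
  let ?Z = "(\<lambda>p. fst p \<otimes>\<^bsub>M\<^esub> snd p) ` (supp u \<times> supp v)"
  note eq = P_mult_eq[OF u v P_fin[OF u] order_refl P_fin[OF v] order_refl]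
  have "(u \<otimes>\<^bsub>P\<^esub> v) z = \<zero>\<^bsub>K\<^esub>" if "z \<notin> ?Z" for z
    unfolding eq using that by (intro K.add.finprod_one_eqI) (auto simp: image_iff, blast)
  moreover have "finite ?Z" using u v by auto
  moreover have "?Z \<subseteq> carrier M" using P_supp[OF u] P_supp[OF v] by (auto simp: subset_iff)
  moreover have "(u \<otimes>\<^bsub>P\<^esub> v) z \<in> carrier K" for z
    unfolding eq using u v by (intro K.finsum_closed) auto
  ultimately show ?thesis by (intro P_memI[where F = ?Z]) blast+
qed

lemma P_abelian_group: "abelian_group P"
proof (rule abelian_groupI)
  fix u assume u: "u \<in> carrier P"
  have "(\<lambda>x. \<ominus>\<^bsub>K\<^esub> u x) \<in> carrier P"
    by (rule P_memI[where F = "supp u"]) (use u P_supp[OF u] in auto)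
  moreover have "(\<lambda>x. \<ominus>\<^bsub>K\<^esub> u x) \<oplus>\<^bsub>P\<^esub> u = \<zero>\<^bsub>P\<^esub>"
    using u by (simp add: P_simps K.l_neg)
  ultimately show "\<exists>y\<in>carrier P. y \<oplus>\<^bsub>P\<^esub> u = \<zero>\<^bsub>P\<^esub>" by blast
qed (auto simp: P_simps K.a_ac)

lemma P_module: "module K P"
  by (rule moduleI)
     (simp_all add: P_simps P_abelian_group K.is_cring K.l_distr K.r_distr K.m_assoc K.ring_axioms)

interpretation P: module K P by (rule P_module)

text \<open>The basis vectors span; a linear statement therefore needs to be checked on them only.\<close>

lemma P_induct [consumes 1, case_names zero step]:
  assumes u: "u \<in> carrier P" and zero: "Q \<zero>\<^bsub>P\<^esub>"
    and step: "\<And>c x u. c \<in> carrier K \<Longrightarrow> x \<in> carrier M \<Longrightarrow> u \<in> carrier P \<Longrightarrow> Q u \<Longrightarrow> Q (c \<odot>\<^bsub>P\<^esub> e x \<oplus>\<^bsub>P\<^esub> u)"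
  shows "Q u"
proof -
  have "finite F \<Longrightarrow> \<forall>u\<in>carrier P. supp u \<subseteq> F \<longrightarrow> Q u" for F
  proof (induction F rule: finite_induct)
    case empty
    have "u = \<zero>\<^bsub>P\<^esub>" if "supp u \<subseteq> {}" for u :: "'x \<Rightarrow> 'k" using that by (auto simp: P_simps)
    then show ?case using zero by auto
  next
    case (insert x F)
    show ?case
    proof (intro ballI impI)
      fix u assume u: "u \<in> carrier P" and F: "supp u \<subseteq> insert x F"
      show "Q u"
      proof (cases "u x = \<zero>\<^bsub>K\<^esub>")
        case True
        then have "supp u \<subseteq> F" using F by auto
        then show ?thesis using insert u by blast
      next
        case False
        then have x: "x \<in> carrier M" using P_supp[OF u] by auto
        have s: "supp (u(x := \<zero>\<^bsub>K\<^esub>)) \<subseteq> F" "supp (u(x := \<zero>\<^bsub>K\<^esub>)) \<subseteq> supp u" using F by auto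
        have u': "u(x := \<zero>\<^bsub>K\<^esub>) \<in> carrier P"
          by (rule P_memI[where F = "supp u"]) (use u P_supp[OF u] s(2) in auto)
        then have "Q (u x \<odot>\<^bsub>P\<^esub> e x \<oplus>\<^bsub>P\<^esub> u(x := \<zero>\<^bsub>K\<^esub>))"
          using insert s x u by (intro step) auto
        moreover have "u x \<odot>\<^bsub>P\<^esub> e x \<oplus>\<^bsub>P\<^esub> u(x := \<zero>\<^bsub>K\<^esub>) = u"
          using u by (auto simp: P_simps basis_vector_def)
        ultimately show ?thesis by simp
      qed
    qed
  qed
  from this[of "supp u"] show ?thesis using u by auto
qed

lemma P_comm:
  assumes u: "u \<in> carrier P" and v: "v \<in> carrier P"
  shows "u \<otimes>\<^bsub>P\<^esub> v = v \<otimes>\<^bsub>P\<^esub> u"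
proof
  fix z
  note a = P_fin[OF u] order_refl P_fin[OF v] order_refl
  note b = P_fin[OF v] order_refl P_fin[OF u] order_refl
  have "(v \<otimes>\<^bsub>P\<^esub> u) z = (\<Oplus>\<^bsub>K\<^esub>p\<in>prod.swap ` (supp u \<times> supp v).
      if fst p \<otimes>\<^bsub>M\<^esub> snd p = z then v (fst p) \<otimes>\<^bsub>K\<^esub> u (snd p) else \<zero>\<^bsub>K\<^esub>)"
    unfolding P_mult_eq[OF v u b] by (simp add: product_swap)
  also have "\<dots> = (\<Oplus>\<^bsub>K\<^esub>p\<in>supp u \<times> supp v.
      if snd p \<otimes>\<^bsub>M\<^esub> fst p = z then v (snd p) \<otimes>\<^bsub>K\<^esub> u (fst p) else \<zero>\<^bsub>K\<^esub>)"
    using u v by (subst K.finsum_reindex) (auto simp: fst_swap snd_swap intro!: K.finsum_cong')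
  also have "\<dots> = (u \<otimes>\<^bsub>P\<^esub> v) z"
    unfolding P_mult_eq[OF u v a] using u v P_supp[OF u] P_supp[OF v]
    by (intro K.finsum_cong') (auto simp: K.m_comm M.m_comm subset_iff)
  finally show "(u \<otimes>\<^bsub>P\<^esub> v) z = (v \<otimes>\<^bsub>P\<^esub> u) z" ..
qed

lemma P_l_distr:
  assumes u: "u \<in> carrier P" and v: "v \<in> carrier P" and w: "w \<in> carrier P"
  shows "(u \<oplus>\<^bsub>P\<^esub> v) \<otimes>\<^bsub>P\<^esub> w = u \<otimes>\<^bsub>P\<^esub> w \<oplus>\<^bsub>P\<^esub> v \<otimes>\<^bsub>P\<^esub> w"
proof
  fix z
  let ?XX = "supp u \<union> supp v" and ?YY = "supp w"
  have XX: "finite ?XX" "supp u \<subseteq> ?XX" "supp v \<subseteq> ?XX" using u v by auto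
  have uv: "u \<oplus>\<^bsub>P\<^esub> v \<in> carrier P" "supp (u \<oplus>\<^bsub>P\<^esub> v) \<subseteq> ?XX" using u v by (auto simp: P_simps)
  note YY = P_fin[OF w] order_refl
  have "((u \<oplus>\<^bsub>P\<^esub> v) \<otimes>\<^bsub>P\<^esub> w) z = (\<Oplus>\<^bsub>K\<^esub>p\<in>?XX \<times> ?YY.
     (if fst p \<otimes>\<^bsub>M\<^esub> snd p = z then u (fst p) \<otimes>\<^bsub>K\<^esub> w (snd p) else \<zero>\<^bsub>K\<^esub>) \<oplus>\<^bsub>K\<^esub>
     (if fst p \<otimes>\<^bsub>M\<^esub> snd p = z then v (fst p) \<otimes>\<^bsub>K\<^esub> w (snd p) else \<zero>\<^bsub>K\<^esub>))"
    unfolding P_mult_eq[OF uv(1) w XX(1) uv(2) YY] using u v w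
    by (intro K.finsum_cong') (auto simp: P_simps K.l_distr)
  also have "\<dots> = (u \<otimes>\<^bsub>P\<^esub> w) z \<oplus>\<^bsub>K\<^esub> (v \<otimes>\<^bsub>P\<^esub> w) z"
    unfolding P_mult_eq[OF u w XX(1,2) YY] P_mult_eq[OF v w XX(1,3) YY] using u v w
    by (intro K.finsum_addf) auto
  finally show "((u \<oplus>\<^bsub>P\<^esub> v) \<otimes>\<^bsub>P\<^esub> w) z = (u \<otimes>\<^bsub>P\<^esub> w \<oplus>\<^bsub>P\<^esub> v \<otimes>\<^bsub>P\<^esub> w) z"
    by (simp add: P_simps)
qed

lemma P_smult_l:
  assumes c: "c \<in> carrier K" and u: "u \<in> carrier P" and v: "v \<in> carrier P"
  shows "(c \<odot>\<^bsub>P\<^esub> u) \<otimes>\<^bsub>P\<^esub> v = c \<odot>\<^bsub>P\<^esub> (u \<otimes>\<^bsub>P\<^esub> v)"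
proof
  fix z
  note a = P_fin[OF u] order_refl P_fin[OF v] order_refl
  have cu: "c \<odot>\<^bsub>P\<^esub> u \<in> carrier P" "supp (c \<odot>\<^bsub>P\<^esub> u) \<subseteq> supp u" using c u by (auto simp: P_simps)
  have "((c \<odot>\<^bsub>P\<^esub> u) \<otimes>\<^bsub>P\<^esub> v) z = (\<Oplus>\<^bsub>K\<^esub>p\<in>supp u \<times> supp v.
     c \<otimes>\<^bsub>K\<^esub> (if fst p \<otimes>\<^bsub>M\<^esub> snd p = z then u (fst p) \<otimes>\<^bsub>K\<^esub> v (snd p) else \<zero>\<^bsub>K\<^esub>))"
    unfolding P_mult_eq[OF cu(1) v P_fin[OF u] cu(2) a(3,4)] using c u v
    by (intro K.finsum_cong') (auto simp: P_simps K.m_assoc)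
  also have "\<dots> = c \<otimes>\<^bsub>K\<^esub> (u \<otimes>\<^bsub>P\<^esub> v) z"
    unfolding P_mult_eq[OF u v a] using c u v by (intro K.finsum_rdistr[symmetric]) auto
  finally show "((c \<odot>\<^bsub>P\<^esub> u) \<otimes>\<^bsub>P\<^esub> v) z = (c \<odot>\<^bsub>P\<^esub> (u \<otimes>\<^bsub>P\<^esub> v)) z"
    by (simp add: P_simps)
qed

lemma e_mult:
  assumes x: "x \<in> carrier M" and y: "y \<in> carrier M"
  shows "e x \<otimes>\<^bsub>P\<^esub> e y = e (x \<otimes>\<^bsub>M\<^esub> y)"
proof
  fix z
  have s: "finite {x}" "supp (e x) \<subseteq> {x}" "finite {y}" "supp (e y) \<subseteq> {y}"
    by (auto simp: basis_vector_def)
  show "(e x \<otimes>\<^bsub>P\<^esub> e y) z = e (x \<otimes>\<^bsub>M\<^esub> y) z"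
    unfolding P_mult_eq[OF e_closed[OF x] e_closed[OF y] s]
    by (simp add: K.finsum_insert) (auto simp: basis_vector_def)
qed

lemma P_r_distr:
  assumes "u \<in> carrier P" "v \<in> carrier P" "w \<in> carrier P"
  shows "w \<otimes>\<^bsub>P\<^esub> (u \<oplus>\<^bsub>P\<^esub> v) = w \<otimes>\<^bsub>P\<^esub> u \<oplus>\<^bsub>P\<^esub> w \<otimes>\<^bsub>P\<^esub> v"
  using assms by (simp add: P_comm[of w] P_l_distr)

lemma P_smult_r:
  assumes "c \<in> carrier K" "u \<in> carrier P" "v \<in> carrier P"
  shows "u \<otimes>\<^bsub>P\<^esub> (c \<odot>\<^bsub>P\<^esub> v) = c \<odot>\<^bsub>P\<^esub> (u \<otimes>\<^bsub>P\<^esub> v)"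
  using assms by (simp add: P_comm[of u] P_smult_l)

lemma P_mult_zero: "u \<in> carrier P \<Longrightarrow> \<zero>\<^bsub>P\<^esub> \<otimes>\<^bsub>P\<^esub> u = \<zero>\<^bsub>P\<^esub>" "u \<in> carrier P \<Longrightarrow> u \<otimes>\<^bsub>P\<^esub> \<zero>\<^bsub>P\<^esub> = \<zero>\<^bsub>P\<^esub>"
  using P_smult_l[of "\<zero>\<^bsub>K\<^esub>" u u] P_comm[of "\<zero>\<^bsub>P\<^esub>" u] by simp_all

lemmas P_bilin = P_l_distr P_r_distr P_smult_l P_smult_r P_mult_zero

lemma P_assoc:
  assumes u: "u \<in> carrier P" and v: "v \<in> carrier P" and w: "w \<in> carrier P"
  shows "(u \<otimes>\<^bsub>P\<^esub> v) \<otimes>\<^bsub>P\<^esub> w = u \<otimes>\<^bsub>P\<^esub> (v \<otimes>\<^bsub>P\<^esub> w)"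
proof -
  \<comment> \<open>Both sides are trilinear: reduce to basis vectors, one argument at a time.\<close>
  have 1: "(e x \<otimes>\<^bsub>P\<^esub> e y) \<otimes>\<^bsub>P\<^esub> w = e x \<otimes>\<^bsub>P\<^esub> (e y \<otimes>\<^bsub>P\<^esub> w)" if "x \<in> carrier M" "y \<in> carrier M" for x y
    using w by (induction w rule: P_induct) (simp_all add: that P_bilin e_mult M.m_assoc)
  have 2: "(e x \<otimes>\<^bsub>P\<^esub> v) \<otimes>\<^bsub>P\<^esub> w = e x \<otimes>\<^bsub>P\<^esub> (v \<otimes>\<^bsub>P\<^esub> w)" if "x \<in> carrier M" for x
    using v by (induction v rule: P_induct) (simp_all add: that w P_bilin 1)
  show ?thesis
    using u by (induction u rule: P_induct) (simp_all add: v w P_bilin 2)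
qed

lemma P_one: assumes u: "u \<in> carrier P" shows "\<one>\<^bsub>P\<^esub> \<otimes>\<^bsub>P\<^esub> u = u"
  unfolding P_simps using u
  by (induction u rule: P_induct) (simp_all only: P_bilin e_mult e_closed M.one_closed P.smult_closed M.l_one)

lemma P_one_closed: "\<one>\<^bsub>P\<^esub> \<in> carrier P"
  by (simp add: P_simps)

lemma monoid_algebra_algebra: "algebra K P"
proof (rule algebraI)
  show "cring P"
    by (rule cringI[OF P_abelian_group])
       (auto intro!: comm_monoidI simp: P_assoc P_l_distr P_one P_one_closed intro: P_comm)
qed (simp_all add: K.is_cring P.smult_l_distr P.smult_r_distr P.smult_assoc1 P_smult_l)

end

definition lin_ext ::
    "('k, 'km) ring_scheme \<Rightarrow> ('k, 'v, 'vm) module_scheme \<Rightarrow> ('x \<Rightarrow> 'v) \<Rightarrow> ('x \<Rightarrow> 'k) \<Rightarrow> 'v" where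
  "lin_ext K V f u = finsum V (\<lambda>x. u x \<odot>\<^bsub>V\<^esub> f x) {x. u x \<noteq> \<zero>\<^bsub>K\<^esub>}"

locale monoid_alg_lin_ext = monoid_alg K M + V: algebra K V
  for K :: "('k, 'km) ring_scheme" and M :: "('x, 'xm) monoid_scheme"
    and V :: "('k, 'v, 'vm) module_scheme" +
  fixes f :: "'x \<Rightarrow> 'v"
  assumes f_closed: "x \<in> carrier M \<Longrightarrow> f x \<in> carrier V"
begin

abbreviation ext :: "('x \<Rightarrow> 'k) \<Rightarrow> 'v" where "ext \<equiv> lin_ext K V f"

lemma ext_superset:
  assumes u: "u \<in> carrier P" and F: "finite F" "supp u \<subseteq> F" "F \<subseteq> carrier M"
  shows "ext u = finsum V (\<lambda>x. u x \<odot>\<^bsub>V\<^esub> f x) F"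
  unfolding lin_ext_def using F u f_closed
  by (intro V.M.add.finprod_mono_neutral_cong_left) (auto simp: subset_iff)

lemma ext_closed [simp]:
  assumes u: "u \<in> carrier P"
  shows "ext u \<in> carrier V"
  unfolding lin_ext_def using u P_supp[OF u] f_closed by (intro V.M.finsum_closed) auto

lemma ext_zero: "ext \<zero>\<^bsub>P\<^esub> = \<zero>\<^bsub>V\<^esub>"
  by (simp add: lin_ext_def P_simps)

lemma ext_add:
  assumes u: "u \<in> carrier P" and v: "v \<in> carrier P"
  shows "ext (u \<oplus>\<^bsub>P\<^esub> v) = ext u \<oplus>\<^bsub>V\<^esub> ext v"
proof -
  let ?F = "supp u \<union> supp v"
  have uv: "u \<oplus>\<^bsub>P\<^esub> v \<in> carrier P" "supp (u \<oplus>\<^bsub>P\<^esub> v) \<subseteq> ?F" using u v by (auto simp: P_simps)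
  have F: "finite ?F" "?F \<subseteq> carrier M" "supp u \<subseteq> ?F" "supp v \<subseteq> ?F"
    using u v P_supp[OF u] P_supp[OF v] by auto
  have "ext (u \<oplus>\<^bsub>P\<^esub> v) = finsum V (\<lambda>x. u x \<odot>\<^bsub>V\<^esub> f x \<oplus>\<^bsub>V\<^esub> v x \<odot>\<^bsub>V\<^esub> f x) ?F"
    unfolding ext_superset[OF uv(1) F(1) uv(2) F(2)] using u v F(2) f_closed
    by (intro V.M.finsum_cong') (auto simp: P_simps V.smult_l_distr subset_iff)
  also have "\<dots> = ext u \<oplus>\<^bsub>V\<^esub> ext v"
    unfolding ext_superset[OF u F(1,3,2)] ext_superset[OF v F(1,4,2)] using u v F(2) f_closed
    by (intro V.M.finsum_addf) (auto simp: subset_iff)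
  finally show ?thesis .
qed

lemma ext_smult:
  assumes c: "c \<in> carrier K" and u: "u \<in> carrier P"
  shows "ext (c \<odot>\<^bsub>P\<^esub> u) = c \<odot>\<^bsub>V\<^esub> ext u"
proof -
  have cu: "c \<odot>\<^bsub>P\<^esub> u \<in> carrier P" "supp (c \<odot>\<^bsub>P\<^esub> u) \<subseteq> supp u" using c u by (auto simp: P_simps)
  have "ext (c \<odot>\<^bsub>P\<^esub> u) = finsum V (\<lambda>x. c \<odot>\<^bsub>V\<^esub> (u x \<odot>\<^bsub>V\<^esub> f x)) (supp u)"
    unfolding ext_superset[OF cu(1) P_fin[OF u] cu(2) P_supp[OF u]] using c u P_supp[OF u] f_closed
    by (intro V.M.finsum_cong') (auto simp: P_simps V.smult_assoc1 subset_iff)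
  also have "\<dots> = c \<odot>\<^bsub>V\<^esub> ext u"
    unfolding lin_ext_def using c u P_supp[OF u] f_closed
    by (intro V.finsum_smult_ldistr[symmetric]) (auto simp: subset_iff)
  finally show ?thesis .
qed

lemma ext_e:
  assumes x: "x \<in> carrier M"
  shows "ext (e x) = f x"
proof -
  have s: "supp (e x) \<subseteq> {x}" by (auto simp: basis_vector_def)
  have "ext (e x) = finsum V (\<lambda>y. e x y \<odot>\<^bsub>V\<^esub> f y) {x}"
    by (rule ext_superset) (use x s in auto)
  then show ?thesis using x f_closed by (simp add: V.M.finsum_insert basis_vector_def)
qed

end

text \<open>Identifying the push-forward as a linear extension gives its linearity.\<close>

lemma (in monoid_alg) pushforward_eq_lin_ext:
  assumes w: "\<And>x. x \<in> carrier M \<Longrightarrow> w x \<in> carrier M" and u: "u \<in> carrier P"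
  shows "pushforward K w u = lin_ext K P (\<lambda>x. e (w x)) u"
proof
  fix y
  interpret P: algebra K P by (rule monoid_algebra_algebra)
  have eval: "finsum P g F y = finsum K (\<lambda>i. g i y) F" if "finite F" "g \<in> F \<rightarrow> carrier P" for g F
    using that
  proof (induction F rule: finite_induct)
    case (insert x F)
    then have "(\<lambda>i. g i y) \<in> F \<rightarrow> carrier K" by (auto simp: Pi_iff)
    with insert show ?case by (simp add: P.M.finsum_insert K.finsum_insert Pi_iff) (simp add: P_simps)
  qed (simp add: P_simps)
  have "lin_ext K P (\<lambda>x. e (w x)) u y = finsum K (\<lambda>x. (u x \<odot>\<^bsub>P\<^esub> e (w x)) y) (supp u)"
    unfolding lin_ext_def using u P_supp[OF u] w by (intro eval) (auto simp: subset_iff)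
  also have "\<dots> = finsum K u {x. u x \<noteq> \<zero>\<^bsub>K\<^esub> \<and> w x = y}"
    using u P_supp[OF u] w
    by (intro K.add.finprod_mono_neutral_cong_right) (auto simp: P_simps basis_vector_def)
  finally show "pushforward K w u y = lin_ext K P (\<lambda>x. e (w x)) u y"
    by (simp add: pushforward_def)
qed

section \<open>Tensor products of commutative algebras\<close>

definition multilinear ::
    "('k, 'km) ring_scheme \<Rightarrow> 'i set \<Rightarrow> ('i \<Rightarrow> ('k, 'b, 'bm) module_scheme) \<Rightarrow>
      ('k, 'v, 'vm) module_scheme \<Rightarrow> (('i \<Rightarrow> 'b) \<Rightarrow> 'v) \<Rightarrow> bool" where
  "multilinear K I B V f \<longleftrightarrow>
     (\<forall>x\<in>(\<Pi>\<^sub>E i\<in>I. carrier (B i)). f x \<in> carrier V \<and>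
       (\<forall>i\<in>I. \<forall>a\<in>carrier (B i).
          (\<forall>b\<in>carrier (B i). f (x(i := a \<oplus>\<^bsub>B i\<^esub> b)) = f (x(i := a)) \<oplus>\<^bsub>V\<^esub> f (x(i := b))) \<and>
          (\<forall>c\<in>carrier K. f (x(i := c \<odot>\<^bsub>B i\<^esub> a)) = c \<odot>\<^bsub>V\<^esub> f (x(i := a)))))"

definition pure ::
    "('k, 'km) ring_scheme \<Rightarrow> 'i set \<Rightarrow> ('i \<Rightarrow> ('k, 'b, 'bm) module_scheme) \<Rightarrow>
      ('i \<Rightarrow> 'b) \<Rightarrow> (('i \<Rightarrow> 'b) \<Rightarrow> 'k) set" where
  "pure K I B x = tensor_relations K I B +>\<^bsub>free_tensors K I B\<^esub> basis_vector K x"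

definition incl ::
    "('k, 'km) ring_scheme \<Rightarrow> 'i set \<Rightarrow> ('i \<Rightarrow> ('k, 'b, 'bm) module_scheme) \<Rightarrow>
      'i \<Rightarrow> 'b \<Rightarrow> (('i \<Rightarrow> 'b) \<Rightarrow> 'k) set" where
  "incl K I B i a = pure K I B ((\<lambda>j\<in>I. \<one>\<^bsub>B j\<^esub>)(i := a))"

locale tensor_alg =
  fixes K :: "('k, 'km) ring_scheme" and I :: "'i set" and B :: "'i \<Rightarrow> ('k, 'b, 'bm) module_scheme"
  assumes K_cring: "cring K" and finite_index: "finite I"
    and factor_algebra: "i \<in> I \<Longrightarrow> algebra K (B i)"
begin

abbreviation "families \<equiv> (\<Pi>\<^sub>E i\<in>I. carrier (B i))"
abbreviation "T \<equiv> tensor_product K I B"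

lemma product_comm_monoid: "comm_monoid (product_group I B)"
proof -
  have B: "comm_monoid (B i)" if "i \<in> I" for i
    using factor_algebra[OF that] by (simp add: algebra_def cring_def)
  note monoid = comm_monoid.axioms(1)[OF B]
  show ?thesis
  proof (rule comm_monoidI)
    fix x y z assume xyz: "x \<in> carrier (product_group I B)" "y \<in> carrier (product_group I B)"
      "z \<in> carrier (product_group I B)"
    show "x \<otimes>\<^bsub>product_group I B\<^esub> y \<otimes>\<^bsub>product_group I B\<^esub> z =
      x \<otimes>\<^bsub>product_group I B\<^esub> (y \<otimes>\<^bsub>product_group I B\<^esub> z)"
      using xyz by (auto intro!: restrict_ext simp: PiE_iff monoid.m_assoc[OF monoid])
  next
    fix x y assume xy: "x \<in> carrier (product_group I B)" "y \<in> carrier (product_group I B)"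
    show "x \<otimes>\<^bsub>product_group I B\<^esub> y \<in> carrier (product_group I B)"
      using xy by (auto simp: PiE_iff monoid.m_closed[OF monoid])
    show "x \<otimes>\<^bsub>product_group I B\<^esub> y = y \<otimes>\<^bsub>product_group I B\<^esub> x"
      using xy by (auto intro!: restrict_ext simp: PiE_iff comm_monoid.m_comm[OF B])
    show "\<one>\<^bsub>product_group I B\<^esub> \<otimes>\<^bsub>product_group I B\<^esub> x = x"
      using xy by (auto intro!: extensionalityI[of _ I] simp: PiE_iff monoid.l_one[OF monoid])
  qed (simp add: PiE_iff monoid.one_closed[OF monoid])
qed

sublocale free: monoid_alg K "product_group I B"
  by (intro monoid_alg.intro K_cring product_comm_monoid)

abbreviation "FT \<equiv> free_tensors K I B"
abbreviation "Rel \<equiv> tensor_relations K I B"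

sublocale FT: algebra K FT
  by (rule free.monoid_algebra_algebra)

lemma families_update: "x \<in> families \<Longrightarrow> i \<in> I \<Longrightarrow> a \<in> carrier (B i) \<Longrightarrow> x(i := a) \<in> families"
  by (auto simp: PiE_iff extensional_def)

lemma families_one: "(\<lambda>j\<in>I. \<one>\<^bsub>B j\<^esub>) \<in> families"
  using free.M.one_closed by simp

lemma families_mult: "x \<in> families \<Longrightarrow> y \<in> families \<Longrightarrow> (\<lambda>j\<in>I. x j \<otimes>\<^bsub>B j\<^esub> y j) \<in> families"
  using free.M.m_closed[of x y] by simp

lemma factor_add: "i \<in> I \<Longrightarrow> a \<in> carrier (B i) \<Longrightarrow> b \<in> carrier (B i) \<Longrightarrow> a \<oplus>\<^bsub>B i\<^esub> b \<in> carrier (B i)"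
  using factor_algebra[of i] by (simp add: abelian_groupE(1) algebra_def module_def)

lemma factor_smult: "i \<in> I \<Longrightarrow> c \<in> carrier K \<Longrightarrow> a \<in> carrier (B i) \<Longrightarrow> c \<odot>\<^bsub>B i\<^esub> a \<in> carrier (B i)"
  using module.smult_closed[of K "B i"] factor_algebra[of i] by (simp add: algebra_def)

lemma factor_one: "i \<in> I \<Longrightarrow> \<one>\<^bsub>B i\<^esub> \<in> carrier (B i)"
  using families_one by (auto simp: PiE_iff)

lemma e_closed [simp]: "x \<in> families \<Longrightarrow> basis_vector K x \<in> carrier FT"
  by (rule free.e_closed) simp

abbreviation relators where "relators \<equiv>
     ({basis_vector K (x(i := a \<oplus>\<^bsub>B i\<^esub> b))
         \<ominus>\<^bsub>free_tensors K I B\<^esub>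
         (basis_vector K (x(i := a)) \<oplus>\<^bsub>free_tensors K I B\<^esub> basis_vector K (x(i := b))) |
         x i a b. x \<in> (\<Pi>\<^sub>E i\<in>I. carrier (B i)) \<and> i \<in> I \<and> a \<in> carrier (B i) \<and> b \<in> carrier (B i)}
      \<union>
      {basis_vector K (x(i := c \<odot>\<^bsub>B i\<^esub> a))
         \<ominus>\<^bsub>free_tensors K I B\<^esub>
         (c \<odot>\<^bsub>free_tensors K I B\<^esub> basis_vector K (x(i := a))) |
         x i a c. x \<in> (\<Pi>\<^sub>E i\<in>I. carrier (B i)) \<and> i \<in> I \<and> a \<in> carrier (B i) \<and> c \<in> carrier K})"

lemma relators_closed: "relators \<subseteq> carrier FT"
  by (auto intro!: FT.minus_closed e_closed FT.add.m_closed FT.smult_closed families_update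
      factor_add factor_smult)

lemma Rel_eq: "Rel = Idl\<^bsub>FT\<^esub> relators"
  by (simp add: tensor_relations_def)

lemma Rel_ideal: "ideal Rel FT"
  unfolding Rel_eq by (rule FT.genideal_ideal[OF relators_closed])

lemma relators_in_Rel: "relators \<subseteq> Rel"
  unfolding Rel_eq by (rule FT.genideal_self[OF relators_closed])

sublocale Rel: algebra_ideal K FT Rel
  by (intro algebra_ideal.intro FT.algebra_axioms Rel_ideal)

lemma T_eq: "T = quot_algebra FT Rel"
  by (simp add: tensor_product_def)

text \<open>As a simplification rule this hides the quotient construction again wherever the facts about
  cosets expose it.\<close>

lemma quot_eq_T [simp]: "quot_algebra FT Rel = T"
  by (simp add: T_eq)

sublocale T: algebra K T
  unfolding T_eq by (rule Rel.quot_algebra_algebra)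

abbreviation "\<pi> \<equiv> (\<lambda>u. Rel +>\<^bsub>FT\<^esub> u)"

sublocale \<pi>: algebra_hom K FT T \<pi>
  unfolding T_eq by (rule Rel.coset.algebra_hom_axioms)

lemma \<pi>_surj: "s \<in> carrier T \<Longrightarrow> \<exists>u\<in>carrier FT. s = \<pi> u"
  using Rel.coset_surj unfolding T_eq by blast

lemma \<pi>_eq_iff: "u \<in> carrier FT \<Longrightarrow> v \<in> carrier FT \<Longrightarrow> \<pi> u = \<pi> v \<longleftrightarrow> u \<ominus>\<^bsub>FT\<^esub> v \<in> Rel"
  by (rule Rel.coset_eq_iff)

abbreviation "p \<equiv> pure K I B"
abbreviation "\<iota> \<equiv> incl K I B"

lemma pure_eq: "p x = \<pi> (basis_vector K x)"
  by (simp add: pure_def)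

lemma pure_closed [simp]: "x \<in> families \<Longrightarrow> p x \<in> carrier T"
  by (simp add: pure_eq)

lemma pure_mult: "x \<in> families \<Longrightarrow> y \<in> families \<Longrightarrow> p x \<otimes>\<^bsub>T\<^esub> p y = p (\<lambda>j\<in>I. x j \<otimes>\<^bsub>B j\<^esub> y j)"
  using free.e_mult[of x y] by (simp add: pure_eq flip: \<pi>.mult)

lemma pure_one: "p (\<lambda>j\<in>I. \<one>\<^bsub>B j\<^esub>) = \<one>\<^bsub>T\<^esub>"
  using \<pi>.one unfolding pure_eq free.P_simps by simp

lemma multilinear_pure: "multilinear K I B T p"
  unfolding multilinear_def
proof (intro ballI conjI)
  fix x i a assume x: "x \<in> families" and i: "i \<in> I" and a: "a \<in> carrier (B i)"
  {
    fix b assume b: "b \<in> carrier (B i)"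
    have "basis_vector K (x(i := a \<oplus>\<^bsub>B i\<^esub> b)) \<ominus>\<^bsub>FT\<^esub>
        (basis_vector K (x(i := a)) \<oplus>\<^bsub>FT\<^esub> basis_vector K (x(i := b))) \<in> relators"
      using x i a b by blast
    then have "\<pi> (basis_vector K (x(i := a \<oplus>\<^bsub>B i\<^esub> b))) =
        \<pi> (basis_vector K (x(i := a)) \<oplus>\<^bsub>FT\<^esub> basis_vector K (x(i := b)))"
      using x i a b
      by (intro \<pi>_eq_iff[THEN iffD2] set_mp[OF relators_in_Rel]) (simp_all add: families_update factor_add)
    then show "p (x(i := a \<oplus>\<^bsub>B i\<^esub> b)) = p (x(i := a)) \<oplus>\<^bsub>T\<^esub> p (x(i := b))"
      using x i a b by (simp add: pure_eq families_update)
  next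
    fix c assume c: "c \<in> carrier K"
    have "basis_vector K (x(i := c \<odot>\<^bsub>B i\<^esub> a)) \<ominus>\<^bsub>FT\<^esub>
        (c \<odot>\<^bsub>FT\<^esub> basis_vector K (x(i := a))) \<in> relators"
      using x i a c by blast
    then have "\<pi> (basis_vector K (x(i := c \<odot>\<^bsub>B i\<^esub> a))) =
        \<pi> (c \<odot>\<^bsub>FT\<^esub> basis_vector K (x(i := a)))"
      using x i a c
      by (intro \<pi>_eq_iff[THEN iffD2] set_mp[OF relators_in_Rel]) (simp_all add: families_update factor_smult)
    then show "p (x(i := c \<odot>\<^bsub>B i\<^esub> a)) = c \<odot>\<^bsub>T\<^esub> p (x(i := a))"
      using x i a c by (simp add: pure_eq families_update)
  }
qed auto

text \<open>The pure tensors span.\<close>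

lemma T_induct [consumes 1, case_names zero step]:
  assumes s: "s \<in> carrier T" and zero: "Q \<zero>\<^bsub>T\<^esub>"
    and step: "\<And>c x s. c \<in> carrier K \<Longrightarrow> x \<in> families \<Longrightarrow> s \<in> carrier T \<Longrightarrow> Q s \<Longrightarrow> Q (c \<odot>\<^bsub>T\<^esub> p x \<oplus>\<^bsub>T\<^esub> s)"
  shows "Q s"
proof -
  have "Q (\<pi> u)" if "u \<in> carrier FT" for u
    using that
  proof (induction u rule: free.P_induct)
    case zero
    show ?case using assms(2) by simp
  next
    case (step c x u)
    then show ?case using assms(3)[of c x "\<pi> u"] by (simp add: pure_eq)
  qed
  then show ?thesis using \<pi>_surj[OF s] by auto
qed

end

subsection \<open>Multilinear maps\<close>

locale tensor_lift = tensor_alg K I B + V: algebra K V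
  for K :: "('k, 'km) ring_scheme" and I :: "'i set" and B :: "'i \<Rightarrow> ('k, 'b, 'bm) module_scheme"
    and V :: "('k, 'v, 'vm) module_scheme" +
  fixes f :: "('i \<Rightarrow> 'b) \<Rightarrow> 'v"
  assumes multilinear: "multilinear K I B V f"
begin

lemma f_closed: "x \<in> families \<Longrightarrow> f x \<in> carrier V"
  and f_add: "x \<in> families \<Longrightarrow> i \<in> I \<Longrightarrow> a \<in> carrier (B i) \<Longrightarrow> b \<in> carrier (B i) \<Longrightarrow>
     f (x(i := a \<oplus>\<^bsub>B i\<^esub> b)) = f (x(i := a)) \<oplus>\<^bsub>V\<^esub> f (x(i := b))"
  and f_smult: "x \<in> families \<Longrightarrow> i \<in> I \<Longrightarrow> a \<in> carrier (B i) \<Longrightarrow> c \<in> carrier K \<Longrightarrow>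
     f (x(i := c \<odot>\<^bsub>B i\<^esub> a)) = c \<odot>\<^bsub>V\<^esub> f (x(i := a))"
  using multilinear unfolding multilinear_def by blast+

sublocale ext: monoid_alg_lin_ext K "product_group I B" V f
  by (intro monoid_alg_lin_ext.intro free.monoid_alg_axioms V.algebra_axioms
      monoid_alg_lin_ext_axioms.intro) (simp add: f_closed)

text \<open>The relations form an ideal, while the kernel of the linear extension of \<open>f\<close> is only a subspace.
  But this subspace contains a largest ideal, and that ideal contains the relators: a basis vector
  times a relator is a relator again.\<close>

lemma ext_Rel: assumes "u \<in> Rel" shows "lin_ext K V f u = \<zero>\<^bsub>V\<^esub>"
proof -
  let ?ext = "lin_ext K V f"
  let ?N = "{u \<in> carrier FT. \<forall>v\<in>carrier FT. ?ext (v \<otimes>\<^bsub>FT\<^esub> u) = \<zero>\<^bsub>V\<^esub>}"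
  have ext_a_inv: "?ext (\<ominus>\<^bsub>FT\<^esub> u) = \<ominus>\<^bsub>V\<^esub> ?ext u" if "u \<in> carrier FT" for u
  proof -
    have "?ext (\<ominus>\<^bsub>FT\<^esub> u) \<oplus>\<^bsub>V\<^esub> ?ext u = \<zero>\<^bsub>V\<^esub>"
      using ext.ext_add[of "\<ominus>\<^bsub>FT\<^esub> u" u] that by (simp add: FT.M.l_neg ext.ext_zero)
    then show ?thesis using that by (intro V.minus_equality[symmetric]) auto
  qed
  have ideal: "ideal ?N FT"
  proof (rule idealI)
    show "ring FT" by (rule FT.ring_axioms)
    show "subgroup ?N (add_monoid FT)"
      by (rule FT.add.subgroupI)
         (auto simp: FT.r_minus FT.r_distr ext.ext_add ext_a_inv simp flip: a_inv_def
           intro!: exI[of _ "\<zero>\<^bsub>FT\<^esub>"] simp: ext.ext_zero)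
    fix u v assume "u \<in> ?N" and v: "v \<in> carrier FT"
    then show "v \<otimes>\<^bsub>FT\<^esub> u \<in> ?N" "u \<otimes>\<^bsub>FT\<^esub> v \<in> ?N"
      by (auto simp: FT.m_comm[of u v] simp flip: FT.m_assoc)
  qed
  have relator: "?ext (basis_vector K y \<otimes>\<^bsub>FT\<^esub> r) = \<zero>\<^bsub>V\<^esub>" if r: "r \<in> relators" and y: "y \<in> families" for r y
  proof -
    have e: "?ext (basis_vector K y \<otimes>\<^bsub>FT\<^esub> basis_vector K (x(i := a))) =
        f ((\<lambda>j\<in>I. y j \<otimes>\<^bsub>B j\<^esub> x j)(i := y i \<otimes>\<^bsub>B i\<^esub> a))"
      if "x \<in> families" "i \<in> I" "a \<in> carrier (B i)" for x i a
    proof -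
      have "(\<lambda>j\<in>I. y j \<otimes>\<^bsub>B j\<^esub> (x(i := a)) j) = (\<lambda>j\<in>I. y j \<otimes>\<^bsub>B j\<^esub> x j)(i := y i \<otimes>\<^bsub>B i\<^esub> a)"
        using that by auto
      then show ?thesis
        using that y free.e_mult[of y "x(i := a)"] families_update[OF that] families_mult[OF y families_update[OF that]]
        by (simp add: ext.ext_e)
    qed
    have yi: "y i \<in> carrier (B i)" if "i \<in> I" for i using y that by auto
    consider (add) x i a b where "x \<in> families" "i \<in> I" "a \<in> carrier (B i)" "b \<in> carrier (B i)"
        "r = basis_vector K (x(i := a \<oplus>\<^bsub>B i\<^esub> b)) \<ominus>\<^bsub>FT\<^esub>
          (basis_vector K (x(i := a)) \<oplus>\<^bsub>FT\<^esub> basis_vector K (x(i := b)))"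
      | (smult) x i a c where "x \<in> families" "i \<in> I" "a \<in> carrier (B i)" "c \<in> carrier K"
        "r = basis_vector K (x(i := c \<odot>\<^bsub>B i\<^esub> a)) \<ominus>\<^bsub>FT\<^esub> (c \<odot>\<^bsub>FT\<^esub> basis_vector K (x(i := a)))"
      using r by blast
    then show ?thesis
    proof cases
      case add
      interpret Bi: algebra K "B i" by (rule factor_algebra[OF add(2)])
      note u = families_update[OF add(1,2)]
      note z = families_mult[OF y add(1)]
      note fa = f_add[OF z add(2) Bi.m_closed[OF yi[OF add(2)] add(3)] Bi.m_closed[OF yi[OF add(2)] add(4)]]
      have fc: "f ((\<lambda>j\<in>I. y j \<otimes>\<^bsub>B j\<^esub> x j)(i := y i \<otimes>\<^bsub>B i\<^esub> d)) \<in> carrier V" if "d \<in> carrier (B i)" for d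
        by (intro f_closed families_update z add(2) Bi.m_closed yi that)
      show ?thesis
        unfolding add(5) a_minus_def
        using add(1-4) y yi[OF add(2)]
        by (simp add: FT.r_distr FT.r_minus ext.ext_add ext_a_inv e u fa fc Bi.r_distr V.M.r_neg)
    next
      case smult
      interpret Bi: algebra K "B i" by (rule factor_algebra[OF smult(2)])
      note u = families_update[OF smult(1,2)]
      note z = families_mult[OF y smult(1)]
      note fs = f_smult[OF z smult(2) Bi.m_closed[OF yi[OF smult(2)] smult(3)] smult(4)]
      have fc: "f ((\<lambda>j\<in>I. y j \<otimes>\<^bsub>B j\<^esub> x j)(i := y i \<otimes>\<^bsub>B i\<^esub> d)) \<in> carrier V" if "d \<in> carrier (B i)" for d
        by (intro f_closed families_update z smult(2) Bi.m_closed yi that)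
      have "y i \<otimes>\<^bsub>B i\<^esub> (c \<odot>\<^bsub>B i\<^esub> a) = c \<odot>\<^bsub>B i\<^esub> (y i \<otimes>\<^bsub>B i\<^esub> a)"
        using smult yi by (simp add: Bi.m_comm[of "y i"] Bi.smult_assoc2)
      moreover have "basis_vector K y \<otimes>\<^bsub>FT\<^esub> (c \<odot>\<^bsub>FT\<^esub> basis_vector K (x(i := a))) =
          c \<odot>\<^bsub>FT\<^esub> (basis_vector K y \<otimes>\<^bsub>FT\<^esub> basis_vector K (x(i := a)))"
        using smult y u by (intro free.P_smult_r) auto
      ultimately show ?thesis
        unfolding smult(5) a_minus_def
        using smult(1-4) y yi[OF smult(2)]
        by (simp add: FT.r_distr FT.r_minus ext.ext_add ext.ext_smult ext_a_inv e u fs fc V.M.r_neg)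
    qed
  qed
  have "?ext (v \<otimes>\<^bsub>FT\<^esub> r) = \<zero>\<^bsub>V\<^esub>" if r: "r \<in> relators" and v: "v \<in> carrier FT" for r v
    using v
  proof (induction v rule: free.P_induct)
    case (step c x v)
    have "r \<in> carrier FT" by (rule set_mp[OF relators_closed r])
    with step relator[OF r, of x] show ?case
      by (simp add: FT.l_distr ext.ext_add ext.ext_smult FT.smult_assoc2)
  qed (use set_mp[OF relators_closed r] in \<open>simp add: ext.ext_zero\<close>)
  then have "relators \<subseteq> ?N" by (intro subsetI CollectI conjI ballI set_mp[OF relators_closed])
  then have "Rel \<subseteq> ?N" unfolding Rel_eq by (rule FT.genideal_minimal[OF ideal])
  then have u: "u \<in> ?N" using assms by (rule set_mp)
  then have "u \<in> carrier FT" "?ext (\<one>\<^bsub>FT\<^esub> \<otimes>\<^bsub>FT\<^esub> u) = \<zero>\<^bsub>V\<^esub>"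
    using FT.one_closed by blast+
  then show ?thesis by simp
qed

text \<open>The value on a coset is computed on an arbitrary representative; \<open>ext_Rel\<close> says that the choice does
  not matter.\<close>

definition lift :: "(('i \<Rightarrow> 'b) \<Rightarrow> 'k) set \<Rightarrow> 'v" where
  "lift s = lin_ext K V f (SOME u. u \<in> carrier FT \<and> s = \<pi> u)"

lemma lift_\<pi>:
  assumes u: "u \<in> carrier FT"
  shows "lift (\<pi> u) = lin_ext K V f u"
proof -
  define v where "v = (SOME v. v \<in> carrier FT \<and> \<pi> u = \<pi> v)"
  have "v \<in> carrier FT \<and> \<pi> u = \<pi> v" unfolding v_def by (rule someI[of _ u]) (use u in auto)
  then have v: "v \<in> carrier FT" "v \<ominus>\<^bsub>FT\<^esub> u \<in> Rel" using \<pi>_eq_iff[of v u] u by auto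
  have "v = (v \<ominus>\<^bsub>FT\<^esub> u) \<oplus>\<^bsub>FT\<^esub> u" using u v by (simp add: a_minus_def FT.a_assoc FT.M.l_neg)
  then have "lin_ext K V f v = lin_ext K V f (v \<ominus>\<^bsub>FT\<^esub> u) \<oplus>\<^bsub>V\<^esub> lin_ext K V f u"
    using u v(1) ext.ext_add[of "v \<ominus>\<^bsub>FT\<^esub> u" u] by auto
  then show ?thesis using u ext_Rel[OF v(2)] by (simp add: lift_def v_def)
qed

lemma lift_closed [simp]: "s \<in> carrier T \<Longrightarrow> lift s \<in> carrier V"
  and lift_add: "s \<in> carrier T \<Longrightarrow> t \<in> carrier T \<Longrightarrow> lift (s \<oplus>\<^bsub>T\<^esub> t) = lift s \<oplus>\<^bsub>V\<^esub> lift t"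
  and lift_smult: "c \<in> carrier K \<Longrightarrow> s \<in> carrier T \<Longrightarrow> lift (c \<odot>\<^bsub>T\<^esub> s) = c \<odot>\<^bsub>V\<^esub> lift s"
proof -
  have *: "lift s \<in> carrier V" if "s \<in> carrier T" for s
  proof -
    obtain u where "u \<in> carrier FT" "s = \<pi> u" using \<pi>_surj[OF \<open>s \<in> carrier T\<close>] by blast
    then show ?thesis by (simp add: lift_\<pi>)
  qed
  then show "s \<in> carrier T \<Longrightarrow> lift s \<in> carrier V" .
  assume s: "s \<in> carrier T"
  obtain u where u: "u \<in> carrier FT" "s = \<pi> u" using \<pi>_surj[OF s] by blast
  show "lift (s \<oplus>\<^bsub>T\<^esub> t) = lift s \<oplus>\<^bsub>V\<^esub> lift t" if t: "t \<in> carrier T"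
  proof -
    obtain v where v: "v \<in> carrier FT" "t = \<pi> v" using \<pi>_surj[OF t] by blast
    have "s \<oplus>\<^bsub>T\<^esub> t = \<pi> (u \<oplus>\<^bsub>FT\<^esub> v)" using u v by simp
    then show ?thesis using u v lift_\<pi>[of "u \<oplus>\<^bsub>FT\<^esub> v"] by (simp only: lift_\<pi> ext.ext_add FT.M.a_closed)
  qed
  show "lift (c \<odot>\<^bsub>T\<^esub> s) = c \<odot>\<^bsub>V\<^esub> lift s" if c: "c \<in> carrier K"
  proof -
    have "c \<odot>\<^bsub>T\<^esub> s = \<pi> (c \<odot>\<^bsub>FT\<^esub> u)" using u c by simp
    then show ?thesis using u c lift_\<pi>[of "c \<odot>\<^bsub>FT\<^esub> u"] by (simp only: lift_\<pi> ext.ext_smult FT.smult_closed)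
  qed
qed

lemma lift_zero: "lift \<zero>\<^bsub>T\<^esub> = \<zero>\<^bsub>V\<^esub>"
  using lift_\<pi>[of "\<zero>\<^bsub>FT\<^esub>"] by (simp add: ext.ext_zero)

lemma lift_pure: "x \<in> families \<Longrightarrow> lift (p x) = f x"
  by (simp add: pure_eq lift_\<pi> ext.ext_e)

text \<open>Compatibility with products is a bilinear condition, so pure tensors suffice.\<close>

lemma lift_alg_hom:
  assumes mult: "\<And>x y. x \<in> families \<Longrightarrow> y \<in> families \<Longrightarrow> f (\<lambda>j\<in>I. x j \<otimes>\<^bsub>B j\<^esub> y j) = f x \<otimes>\<^bsub>V\<^esub> f y"
    and one: "f (\<lambda>j\<in>I. \<one>\<^bsub>B j\<^esub>) = \<one>\<^bsub>V\<^esub>"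
  shows "lift \<in> alg_hom K T V"
proof (rule alg_homI)
  fix s t assume s: "s \<in> carrier T" and t: "t \<in> carrier T"
  have pure: "lift (p x \<otimes>\<^bsub>T\<^esub> t) = lift (p x) \<otimes>\<^bsub>V\<^esub> lift t" if x: "x \<in> families" for x
    using t
  proof (induction t rule: T_induct)
    case (step c y t)
    have "p x \<otimes>\<^bsub>T\<^esub> (c \<odot>\<^bsub>T\<^esub> p y) = c \<odot>\<^bsub>T\<^esub> (p x \<otimes>\<^bsub>T\<^esub> p y)"
      using x step by (simp add: T.m_comm[of "p x"] T.smult_assoc2)
    moreover have "f x \<otimes>\<^bsub>V\<^esub> (c \<odot>\<^bsub>V\<^esub> f y) = c \<odot>\<^bsub>V\<^esub> (f x \<otimes>\<^bsub>V\<^esub> f y)"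
      using x step by (simp add: V.m_comm[of "f x"] V.smult_assoc2 f_closed)
    ultimately show ?case using x step families_mult[OF x step(2)]
      by (simp add: T.r_distr V.r_distr lift_add lift_smult pure_mult families_mult lift_pure mult f_closed)
  qed (use x in \<open>simp add: lift_zero lift_pure f_closed\<close>)
  show "lift (s \<otimes>\<^bsub>T\<^esub> t) = lift s \<otimes>\<^bsub>V\<^esub> lift t"
    using s
  proof (induction s rule: T_induct)
    case (step c x s)
    then show ?case using t
      by (simp add: T.l_distr V.l_distr lift_add lift_smult T.smult_assoc2 V.smult_assoc2 pure)
  qed (use t in \<open>simp add: lift_zero\<close>)
next
  show "lift \<one>\<^bsub>T\<^esub> = \<one>\<^bsub>V\<^esub>"
    using lift_pure[OF families_one] by (simp add: pure_one one)
qed (simp_all add: lift_add lift_smult)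

end

subsection \<open>Maps permuting the factors\<close>

text \<open>All maps between tensor products that do not come from the coproduct property have this shape. For
  a permutation of the factors the maps \<open>h i\<close> are identities, for a diagonal action or for averaging
  over a group the bijection \<open>\<tau>\<close> is the identity, and the action on the big tensor product
  combines both.\<close>

lemma multilinear_reindex:
  assumes "tensor_alg K I B" "tensor_alg K I' B'" and bij: "bij_betw \<tau> I' I"
    and h_closed: "\<And>i a. i \<in> I' \<Longrightarrow> a \<in> carrier (B (\<tau> i)) \<Longrightarrow> h i a \<in> carrier (B' i)"
    and h_add: "\<And>i a b. i \<in> I' \<Longrightarrow> a \<in> carrier (B (\<tau> i)) \<Longrightarrow> b \<in> carrier (B (\<tau> i)) \<Longrightarrow>
      h i (a \<oplus>\<^bsub>B (\<tau> i)\<^esub> b) = h i a \<oplus>\<^bsub>B' i\<^esub> h i b"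
    and h_smult: "\<And>i c a. i \<in> I' \<Longrightarrow> c \<in> carrier K \<Longrightarrow> a \<in> carrier (B (\<tau> i)) \<Longrightarrow>
      h i (c \<odot>\<^bsub>B (\<tau> i)\<^esub> a) = c \<odot>\<^bsub>B' i\<^esub> h i a"
  shows "multilinear K I B (tensor_product K I' B') (\<lambda>x. pure K I' B' (\<lambda>i\<in>I'. h i (x (\<tau> i))))"
proof -
  interpret X: tensor_alg K I B by fact
  interpret Y: tensor_alg K I' B' by fact
  define w where "w x = (\<lambda>i\<in>I'. h i (x (\<tau> i)))" for x
  have \<tau>: "\<tau> i \<in> I" if "i \<in> I'" for i using bij that by (auto simp: bij_betw_def)
  have w: "w x \<in> Y.families" if "x \<in> X.families" for x
    using that h_closed \<tau> by (auto simp: w_def PiE_iff)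
  have upd: "w (x(i := a)) = (w x)(k := h k a)" if "k \<in> I'" "\<tau> k = i" for x i a k
  proof -
    have "\<tau> j = i \<longleftrightarrow> j = k" if "j \<in> I'" for j
      using bij that \<open>k \<in> I'\<close> \<open>\<tau> k = i\<close> by (auto simp: bij_betw_def inj_on_def)
    then show ?thesis using \<open>k \<in> I'\<close> by (auto simp: w_def)
  qed
  note ml = Y.multilinear_pure[unfolded multilinear_def, rule_format]
  have "multilinear K I B (tensor_product K I' B') (\<lambda>x. pure K I' B' (w x))"
    unfolding multilinear_def
  proof (intro ballI conjI)
    fix x i a assume x: "x \<in> X.families" and i: "i \<in> I" and a: "a \<in> carrier (B i)"
    then obtain k where k: "k \<in> I'" "\<tau> k = i" using bij by (auto simp: bij_betw_def)
    note u = upd[OF k]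
    have ha: "h k a \<in> carrier (B' k)" using h_closed k a by auto
    show "pure K I' B' (w (x(i := a \<oplus>\<^bsub>B i\<^esub> b))) =
        pure K I' B' (w (x(i := a))) \<oplus>\<^bsub>tensor_product K I' B'\<^esub> pure K I' B' (w (x(i := b)))"
      if b: "b \<in> carrier (B i)" for b
      using ml[OF w[OF x], THEN conjunct2, rule_format, OF k(1) ha, THEN conjunct1, rule_format, of "h k b"]
        h_add[of k a b] h_closed[of k b] k a b by (simp add: u)
    show "pure K I' B' (w (x(i := c \<odot>\<^bsub>B i\<^esub> a))) =
        c \<odot>\<^bsub>tensor_product K I' B'\<^esub> pure K I' B' (w (x(i := a)))" if c: "c \<in> carrier K" for c
      using ml[OF w[OF x], THEN conjunct2, rule_format, OF k(1) ha, THEN conjunct2, rule_format, OF c]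
        h_smult[of k c a] k a c by (simp add: u)
  qed (use w in auto)
  then show ?thesis unfolding w_def .
qed

context tensor_alg
begin

text \<open>The union of cosets in the definition of \<open>tensor_map\<close> is a union of equal cosets, because the linear
  map induced by \<open>w\<close> respects the relations.\<close>

lemma tensor_map_eq_lift:
  assumes w: "\<And>x. x \<in> families \<Longrightarrow> w x \<in> families" and ml: "multilinear K I B T (\<lambda>x. p (w x))"
    and s: "s \<in> carrier T"
  shows "tensor_map K I B w s = tensor_lift.lift K I B T (\<lambda>x. p (w x)) s"
proof -
  interpret L: tensor_lift K I B T "\<lambda>x. p (w x)"
    by (intro tensor_lift.intro tensor_alg_axioms T.algebra_axioms tensor_lift_axioms.intro ml)
  interpret W: monoid_alg_lin_ext K "product_group I B" FT "\<lambda>x. basis_vector K (w x)"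
    by (intro monoid_alg_lin_ext.intro free.monoid_alg_axioms FT.algebra_axioms
        monoid_alg_lin_ext_axioms.intro) (simp add: w)
  have ext: "\<pi> (lin_ext K FT (\<lambda>x. basis_vector K (w x)) v) = lin_ext K T (\<lambda>x. p (w x)) v"
    if "v \<in> carrier FT" for v
    using that
  proof (induction v rule: free.P_induct)
    case zero
    show ?case by (simp add: W.ext_zero L.ext.ext_zero)
  next
    case (step c x v)
    then show ?case
      by (simp add: W.ext_add W.ext_smult W.ext_e L.ext.ext_add L.ext.ext_smult L.ext.ext_e w pure_eq[symmetric])
  qed
  obtain u where u: "u \<in> carrier FT" "s = \<pi> u" using \<pi>_surj[OF s] by blast
  have "\<pi> (pushforward K w v) = L.lift s" if v: "v \<in> s" for v
  proof -
    obtain n where n: "n \<in> Rel" "v = n \<oplus>\<^bsub>FT\<^esub> u" using v u unfolding a_r_coset_def' by auto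
    have n': "n \<in> carrier FT" using Rel.Icarr[OF n(1)] .
    have v': "v \<in> carrier FT" using n n' u by simp
    have "\<pi> v = s" using n n' u Rel.coset_zero_iff[of n] by simp
    moreover have "pushforward K w v = lin_ext K FT (\<lambda>x. basis_vector K (w x)) v"
      by (rule free.pushforward_eq_lin_ext) (use w v' in auto)
    ultimately show ?thesis using ext[OF v'] L.lift_\<pi>[OF v'] by simp
  qed
  moreover have "s \<noteq> {}" using u Rel.a_rcos_self by blast
  ultimately show ?thesis unfolding tensor_map_def by (intro SUP_eq_const) auto
qed

lemma tensor_map_reindex:
  assumes bij: "bij_betw \<tau> I I" and h: "\<And>i. i \<in> I \<Longrightarrow> h i \<in> alg_hom K (B (\<tau> i)) (B i)"
  defines "w \<equiv> (\<lambda>x. \<lambda>i\<in>I. h i (x (\<tau> i)))"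
  shows "tensor_map K I B w \<in> alg_hom K T T"
    and "\<And>x. x \<in> families \<Longrightarrow> tensor_map K I B w (p x) = p (w x)"
proof -
  have \<tau>: "\<tau> i \<in> I" if "i \<in> I" for i using bij that by (auto simp: bij_betw_def)
  have hom: "algebra_hom K (B (\<tau> i)) (B i) (h i)" if "i \<in> I" for i
    by (intro algebra_homI factor_algebra \<tau> h that)
  have ml: "multilinear K I B T (\<lambda>x. p (w x))"
    unfolding w_def
    by (rule multilinear_reindex[OF tensor_alg_axioms tensor_alg_axioms bij])
       (auto simp: algebra_hom.closed[OF hom] algebra_hom.add[OF hom] algebra_hom.smult[OF hom])
  interpret L: tensor_lift K I B T "\<lambda>x. p (w x)"
    by (intro tensor_lift.intro tensor_alg_axioms T.algebra_axioms tensor_lift_axioms.intro ml)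
  have w: "w x \<in> families" if "x \<in> families" for x
    using that \<tau> by (auto simp: w_def PiE_iff algebra_hom.closed[OF hom])
  have eq: "tensor_map K I B w s = L.lift s" if "s \<in> carrier T" for s
    using w ml that by (rule tensor_map_eq_lift)
  have "L.lift \<in> alg_hom K T T"
  proof (rule L.lift_alg_hom)
    fix x y assume x: "x \<in> families" and y: "y \<in> families"
    have "w (\<lambda>j\<in>I. x j \<otimes>\<^bsub>B j\<^esub> y j) = (\<lambda>j\<in>I. w x j \<otimes>\<^bsub>B j\<^esub> w y j)"
      using x y \<tau> unfolding w_def
      by (intro restrict_ext) (auto simp: algebra_hom.mult[OF hom] PiE_iff)
    then show "p (w (\<lambda>j\<in>I. x j \<otimes>\<^bsub>B j\<^esub> y j)) = p (w x) \<otimes>\<^bsub>T\<^esub> p (w y)"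
      using pure_mult[OF w[OF x] w[OF y]] by simp
  next
    have "w (\<lambda>j\<in>I. \<one>\<^bsub>B j\<^esub>) = (\<lambda>j\<in>I. \<one>\<^bsub>B j\<^esub>)"
      using \<tau> unfolding w_def by (intro restrict_ext) (auto simp: algebra_hom.one[OF hom])
    then show "p (w (\<lambda>j\<in>I. \<one>\<^bsub>B j\<^esub>)) = \<one>\<^bsub>T\<^esub>" by (simp add: pure_one)
  qed
  then interpret L': algebra_hom K T T L.lift
    by (intro algebra_homI T.algebra_axioms)
  show "tensor_map K I B w \<in> alg_hom K T T"
    by (rule alg_homI) (simp_all add: eq)
  show "\<And>x. x \<in> families \<Longrightarrow> tensor_map K I B w (p x) = p (w x)"
    by (simp add: eq L.lift_pure)
qed

subsection \<open>The tensor product as a coproduct\<close>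

lemma incl_closed: "i \<in> I \<Longrightarrow> a \<in> carrier (B i) \<Longrightarrow> \<iota> i a \<in> carrier T"
  unfolding incl_def by (intro pure_closed families_update families_one)

lemma incl_hom:
  assumes i: "i \<in> I"
  shows "\<iota> i \<in> alg_hom K (B i) T"
proof (rule alg_homI)
  interpret Bi: algebra K "B i" by (rule factor_algebra[OF i])
  note ml = multilinear_pure[unfolded multilinear_def, rule_format, OF families_one, THEN conjunct2,
      rule_format, OF i]
  fix a assume a: "a \<in> carrier (B i)"
  show "\<iota> i a \<in> carrier T" using incl_closed[OF i a] .
  show "\<iota> i (c \<odot>\<^bsub>B i\<^esub> a) = c \<odot>\<^bsub>T\<^esub> \<iota> i a" if "c \<in> carrier K" for c
    using ml[OF a] that by (simp add: incl_def)
  fix b assume b: "b \<in> carrier (B i)"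
  show "\<iota> i (a \<oplus>\<^bsub>B i\<^esub> b) = \<iota> i a \<oplus>\<^bsub>T\<^esub> \<iota> i b"
    using ml[OF a] b by (simp add: incl_def)
  have "(\<lambda>j\<in>I. ((\<lambda>j\<in>I. \<one>\<^bsub>B j\<^esub>)(i := a)) j \<otimes>\<^bsub>B j\<^esub> ((\<lambda>j\<in>I. \<one>\<^bsub>B j\<^esub>)(i := b)) j) =
      (\<lambda>j\<in>I. \<one>\<^bsub>B j\<^esub>)(i := a \<otimes>\<^bsub>B i\<^esub> b)"
  proof
    fix j
    show "(\<lambda>j\<in>I. ((\<lambda>j\<in>I. \<one>\<^bsub>B j\<^esub>)(i := a)) j \<otimes>\<^bsub>B j\<^esub> ((\<lambda>j\<in>I. \<one>\<^bsub>B j\<^esub>)(i := b)) j) j =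
      ((\<lambda>j\<in>I. \<one>\<^bsub>B j\<^esub>)(i := a \<otimes>\<^bsub>B i\<^esub> b)) j"
    proof (cases "j \<in> I")
      case True
      then interpret Bj: algebra K "B j" by (rule factor_algebra)
      show ?thesis using True by simp
    qed (use i in auto)
  qed
  then show "\<iota> i (a \<otimes>\<^bsub>B i\<^esub> b) = \<iota> i a \<otimes>\<^bsub>T\<^esub> \<iota> i b"
    using pure_mult[OF families_update[OF families_one i a] families_update[OF families_one i b]]
    by (simp add: incl_def)
next
  have "(\<lambda>j\<in>I. \<one>\<^bsub>B j\<^esub>)(i := \<one>\<^bsub>B i\<^esub>) = (\<lambda>j\<in>I. \<one>\<^bsub>B j\<^esub>)" using i by auto
  then show "\<iota> i \<one>\<^bsub>B i\<^esub> = \<one>\<^bsub>T\<^esub>" using pure_one by (simp add: incl_def)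
qed

lemma incl_algebra_hom: "i \<in> I \<Longrightarrow> algebra_hom K (B i) T (\<iota> i)"
  by (intro algebra_homI T.algebra_axioms factor_algebra incl_hom)

lemma pure_eq_finprod:
  assumes x: "x \<in> families"
  shows "p x = finprod T (\<lambda>i. \<iota> i (x i)) I"
proof -
  have x': "x j \<in> carrier (B j)" if "j \<in> I" for j using x that by auto
  have part: "p (\<lambda>j\<in>I. if j \<in> F then x j else \<one>\<^bsub>B j\<^esub>) = finprod T (\<lambda>i. \<iota> i (x i)) F" if "finite F" "F \<subseteq> I" for F
    using that
  proof (induction F rule: finite_induct)
    case empty
    show ?case using pure_one by (simp add: restrict_def)
  next
    case (insert i F)
    then have i: "i \<in> I" by auto
    let ?y = "\<lambda>j\<in>I. if j \<in> F then x j else \<one>\<^bsub>B j\<^esub>"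
    let ?z = "(\<lambda>j\<in>I. \<one>\<^bsub>B j\<^esub>)(i := x i)"
    have y: "?y \<in> families" using x' factor_one by auto
    have z: "?z \<in> families" by (intro families_update families_one i x')
    have "(\<lambda>j\<in>I. if j \<in> insert i F then x j else \<one>\<^bsub>B j\<^esub>) = (\<lambda>j\<in>I. ?z j \<otimes>\<^bsub>B j\<^esub> ?y j)"
    proof (rule restrict_ext)
      fix j assume j: "j \<in> I"
      then interpret Bj: algebra K "B j" by (rule factor_algebra)
      interpret Bi: algebra K "B i" by (rule factor_algebra[OF i])
      show "(if j \<in> insert i F then x j else \<one>\<^bsub>B j\<^esub>) = ?z j \<otimes>\<^bsub>B j\<^esub> ?y j"
        using j x'[OF j] insert(2) by auto
    qed
    then have "p (\<lambda>j\<in>I. if j \<in> insert i F then x j else \<one>\<^bsub>B j\<^esub>) = \<iota> i (x i) \<otimes>\<^bsub>T\<^esub> p ?y"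
      using pure_mult[OF z y] by (simp add: incl_def)
    moreover have "(\<lambda>i. \<iota> i (x i)) \<in> F \<rightarrow> carrier T" "\<iota> i (x i) \<in> carrier T"
      using insert.prems x' i incl_closed by auto
    ultimately show ?case using insert by (simp add: T.finprod_insert restrict_def)
  qed
  have all: "(\<lambda>j\<in>I. if j \<in> I then x j else \<one>\<^bsub>B j\<^esub>) = x"
    using x by (auto simp: PiE_iff extensional_def)
  show ?thesis using part[OF finite_index order_refl] unfolding all .
qed

lemma incl_generate:
  assumes W: "subalg K T W" and incl: "\<And>i a. i \<in> I \<Longrightarrow> a \<in> carrier (B i) \<Longrightarrow> \<iota> i a \<in> W"
  shows "carrier T \<subseteq> W"
proof
  fix s assume "s \<in> carrier T"
  then show "s \<in> W"
  proof (induction s rule: T_induct)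
    case (step c x s)
    have "p x \<in> W"
      unfolding pure_eq_finprod[OF step(2)] using step(2) by (intro T.subalg_finprod[OF W] incl) auto
    then show ?case using step T.subalg_add[OF W] T.subalg_smult[OF W] by auto
  qed (rule T.subalg_zero[OF W])
qed

lemma hom_ext:
  assumes "algebra_hom K T C u" "algebra_hom K T C v"
    and "\<And>i a. i \<in> I \<Longrightarrow> a \<in> carrier (B i) \<Longrightarrow> u (\<iota> i a) = v (\<iota> i a)" and "s \<in> carrier T"
  shows "u s = v s"
proof -
  have "carrier T \<subseteq> {x \<in> carrier T. u x = v x}"
    by (rule incl_generate[OF subalg_equalizer[OF assms(1,2)]]) (use assms(3) incl_closed in auto)
  then show ?thesis using assms(4) by auto
qed

text \<open>The map \<open>x \<mapsto> \<Prod>\<^sub>i u\<^sub>i(x\<^sub>i)\<close> is multilinear and multiplicative.\<close>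

lemma coproduct:
  assumes "algebra K C" and u: "\<And>i. i \<in> I \<Longrightarrow> u i \<in> alg_hom K (B i) C"
  shows "\<exists>U\<in>alg_hom K T C. \<forall>i\<in>I. \<forall>a\<in>carrier (B i). U (\<iota> i a) = u i a"
proof -
  interpret C: algebra K C by fact
  have hom: "algebra_hom K (B i) C (u i)" if "i \<in> I" for i
    by (intro algebra_homI C.algebra_axioms factor_algebra u that)
  note u_closed = algebra_hom.closed[OF hom]
  define f where "f x = finprod C (\<lambda>i. u i (x i)) I" for x
  have f_upd: "f (x(i := a)) = u i a \<otimes>\<^bsub>C\<^esub> finprod C (\<lambda>j. u j (x j)) (I - {i})"
    if "x \<in> families" "i \<in> I" "a \<in> carrier (B i)" for x i a
  proof -
    have "f (x(i := a)) = finprod C (\<lambda>j. u j ((x(i := a)) j)) (insert i (I - {i}))"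
      using that by (simp add: f_def insert_absorb)
    also have "\<dots> = u i a \<otimes>\<^bsub>C\<^esub> finprod C (\<lambda>j. u j ((x(i := a)) j)) (I - {i})"
      using that finite_index u_closed by (subst C.finprod_insert) (auto simp: PiE_iff)
    also have "finprod C (\<lambda>j. u j ((x(i := a)) j)) (I - {i}) = finprod C (\<lambda>j. u j (x j)) (I - {i})"
      using that u_closed by (intro C.finprod_cong') (auto simp: PiE_iff)
    finally show ?thesis .
  qed
  have rest: "finprod C (\<lambda>j. u j (x j)) (I - {i}) \<in> carrier C" if "x \<in> families" for x i
    using that u_closed by (intro C.finprod_closed) (auto simp: PiE_iff)
  have ml: "multilinear K I B C f"
    unfolding multilinear_def
  proof (intro ballI conjI)
    fix x i a assume x: "x \<in> families" and i: "i \<in> I" and a: "a \<in> carrier (B i)"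
    interpret ui: algebra_hom K "B i" C "u i" by (rule hom[OF i])
    show "f (x(i := a \<oplus>\<^bsub>B i\<^esub> b)) = f (x(i := a)) \<oplus>\<^bsub>C\<^esub> f (x(i := b))" if "b \<in> carrier (B i)" for b
      using that a rest[OF x] by (simp add: f_upd[OF x i] C.l_distr)
    show "f (x(i := c \<odot>\<^bsub>B i\<^esub> a)) = c \<odot>\<^bsub>C\<^esub> f (x(i := a))" if "c \<in> carrier K" for c
      using that a rest[OF x] by (simp add: f_upd[OF x i] C.smult_assoc2)
  qed (use u_closed in \<open>auto simp: f_def PiE_iff\<close>)
  interpret L: tensor_lift K I B C f
    by (intro tensor_lift.intro tensor_alg_axioms C.algebra_axioms tensor_lift_axioms.intro ml)
  have "L.lift \<in> alg_hom K T C"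
  proof (rule L.lift_alg_hom)
    fix x y assume x: "x \<in> families" and y: "y \<in> families"
    have "f (\<lambda>j\<in>I. x j \<otimes>\<^bsub>B j\<^esub> y j) = finprod C (\<lambda>j. u j (x j) \<otimes>\<^bsub>C\<^esub> u j (y j)) I"
      unfolding f_def using x y u_closed
      by (intro C.finprod_cong') (auto simp: PiE_iff algebra_hom.mult[OF hom])
    also have "\<dots> = f x \<otimes>\<^bsub>C\<^esub> f y"
      unfolding f_def using x y u_closed by (intro C.finprod_multf) (auto simp: PiE_iff)
    finally show "f (\<lambda>j\<in>I. x j \<otimes>\<^bsub>B j\<^esub> y j) = f x \<otimes>\<^bsub>C\<^esub> f y" .
  next
    show "f (\<lambda>j\<in>I. \<one>\<^bsub>B j\<^esub>) = \<one>\<^bsub>C\<^esub>"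
      unfolding f_def by (rule C.finprod_one_eqI) (simp add: algebra_hom.one[OF hom])
  qed
  moreover have "L.lift (\<iota> i a) = u i a" if "i \<in> I" "a \<in> carrier (B i)" for i a
  proof -
    have "finprod C (\<lambda>j. u j ((\<lambda>j\<in>I. \<one>\<^bsub>B j\<^esub>) j)) (I - {i}) = \<one>\<^bsub>C\<^esub>"
      by (rule C.finprod_one_eqI) (simp add: algebra_hom.one[OF hom])
    then show ?thesis
      using that u_closed[of i a] families_update[OF families_one that]
      by (simp add: incl_def L.lift_pure f_upd[OF families_one that] del: restrict_apply)
  qed
  ultimately show ?thesis by blast
qed

lemma tensor_map_incl:
  assumes bij: "bij_betw \<tau> I I" and h: "\<And>i. i \<in> I \<Longrightarrow> h i \<in> alg_hom K (B (\<tau> i)) (B i)"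
    and k: "k \<in> I" and a: "a \<in> carrier (B (\<tau> k))"
  shows "tensor_map K I B (\<lambda>x. \<lambda>i\<in>I. h i (x (\<tau> i))) (\<iota> (\<tau> k) a) = \<iota> k (h k a)"
proof -
  have \<tau>: "\<tau> i \<in> I" if "i \<in> I" for i using bij that by (auto simp: bij_betw_def)
  have one: "h i \<one>\<^bsub>B (\<tau> i)\<^esub> = \<one>\<^bsub>B i\<^esub>" if "i \<in> I" for i
    using h[OF that] by (auto simp: alg_hom_def ring_hom_def)
  have "(\<lambda>i\<in>I. h i (((\<lambda>j\<in>I. \<one>\<^bsub>B j\<^esub>)(\<tau> k := a)) (\<tau> i))) = (\<lambda>j\<in>I. \<one>\<^bsub>B j\<^esub>)(k := h k a)"
  proof
    fix i
    have "\<tau> i = \<tau> k \<longleftrightarrow> i = k" if "i \<in> I"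
      using bij that k by (auto simp: bij_betw_def inj_on_def)
    then show "(\<lambda>i\<in>I. h i (((\<lambda>j\<in>I. \<one>\<^bsub>B j\<^esub>)(\<tau> k := a)) (\<tau> i))) i = ((\<lambda>j\<in>I. \<one>\<^bsub>B j\<^esub>)(k := h k a)) i"
      using \<tau> one k by auto
  qed
  then show ?thesis
    using tensor_map_reindex(2)[OF bij h families_update[OF families_one \<tau>[OF k] a]]
    by (simp add: incl_def)
qed

end

section \<open>Symmetric powers in characteristic zero\<close>

definition recip :: "('k, 'km) ring_scheme \<Rightarrow> nat \<Rightarrow> 'k" where
  "recip K m = inv\<^bsub>K\<^esub> ([m] \<cdot>\<^bsub>K\<^esub> \<one>\<^bsub>K\<^esub>)"

locale char0_field = field K for K :: "('k, 'km) ring_scheme" +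
  assumes char0: "char_zero K"
begin

lemma nat_unit: "(m::nat) > 0 \<Longrightarrow> [m] \<cdot>\<^bsub>K\<^esub> \<one>\<^bsub>K\<^esub> \<in> Units K"
  using char0 by (auto simp: field_Units char_zero_def)

lemma recip_closed [simp]: "(m::nat) > 0 \<Longrightarrow> recip K m \<in> carrier K"
  unfolding recip_def using nat_unit by simp

lemma recip_mult: "(m::nat) > 0 \<Longrightarrow> recip K m \<otimes>\<^bsub>K\<^esub> ([m] \<cdot>\<^bsub>K\<^esub> \<one>\<^bsub>K\<^esub>) = \<one>\<^bsub>K\<^esub>"
  unfolding recip_def using nat_unit by (simp add: Units_l_inv)

end

lemma (in algebra) nat_smult:
  assumes "x \<in> carrier M"
  shows "[(m::nat)] \<cdot>\<^bsub>M\<^esub> x = ([m] \<cdot>\<^bsub>R\<^esub> \<one>\<^bsub>R\<^esub>) \<odot>\<^bsub>M\<^esub> x"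
proof (induction m)
  case (Suc m)
  then show ?case using assms by (simp add: M.add.nat_pow_Suc R.add.nat_pow_Suc smult_l_distr)
qed (use assms in simp)

lemma (in algebra) recip_smult:
  assumes "char0_field R" "x \<in> carrier M" "m > 0"
  shows "recip R (m::nat) \<odot>\<^bsub>M\<^esub> ([m] \<cdot>\<^bsub>M\<^esub> x) = x"
proof -
  interpret char0_field R by fact
  show ?thesis using assms(2,3) by (simp add: nat_smult recip_mult flip: smult_assoc1)
qed

locale tensor_power_alg = char0_field K + A: algebra K A
  for K :: "('k, 'km) ring_scheme" and A :: "('k, 'a, 'am) module_scheme" +
  fixes n :: nat
begin

sublocale tensor_alg K "{..<n}" "\<lambda>_. A"
  by unfold_locales auto

abbreviation "perms \<equiv> {\<nu>. \<nu> permutes {..<n}}"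

definition permute :: "(nat \<Rightarrow> nat) \<Rightarrow> ((nat \<Rightarrow> 'a) \<Rightarrow> 'k) set \<Rightarrow> ((nat \<Rightarrow> 'a) \<Rightarrow> 'k) set" where
  "permute \<nu> = tensor_map K {..<n} (\<lambda>_. A) (\<lambda>x. \<lambda>l\<in>{..<n}. x (\<nu> l))"

definition Sym where "Sym = {t \<in> carrier T. \<forall>\<nu>\<in>perms. permute \<nu> t = t}"

lemma sym_power_eq: "sym_power K n A = T\<lparr>carrier := Sym\<rparr>"
  by (simp add: sym_power_def fixed_subalgebra_def Sym_def permute_def)

lemma id_hom: "(\<lambda>a. a) \<in> alg_hom K A A"
  by (rule alg_homI) auto

lemma permute_hom: "\<nu> \<in> perms \<Longrightarrow> algebra_hom K T T (permute \<nu>)"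
  unfolding permute_def
  by (intro algebra_homI T.algebra_axioms
      tensor_map_reindex(1)[where h = "\<lambda>_ a. a"] id_hom)
     (auto simp: permutes_imp_bij)

lemma permute_pure: "\<nu> \<in> perms \<Longrightarrow> x \<in> families \<Longrightarrow> permute \<nu> (p x) = p (\<lambda>l\<in>{..<n}. x (\<nu> l))"
  unfolding permute_def
  by (rule tensor_map_reindex(2)[where h = "\<lambda>_ a. a"]) (auto simp: permutes_imp_bij id_hom)

text \<open>A permutation acts through its inverse on the positions.\<close>

lemma permute_incl:
  "\<nu> \<in> perms \<Longrightarrow> k < n \<Longrightarrow> a \<in> carrier A \<Longrightarrow> permute \<nu> (\<iota> (\<nu> k) a) = \<iota> k a"
  unfolding permute_def
  by (rule tensor_map_incl[where h = "\<lambda>_ a. a"]) (auto simp: permutes_imp_bij id_hom)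

lemma Sym_subalg: "subalg K T Sym"
proof (rule T.subalgI)
  note h = algebra_hom.mult[OF permute_hom] algebra_hom.add[OF permute_hom]
    algebra_hom.smult[OF permute_hom] algebra_hom.one[OF permute_hom]
  show "Sym \<subseteq> carrier T" by (auto simp: Sym_def)
  show "\<one>\<^bsub>T\<^esub> \<in> Sym" by (auto simp: Sym_def h)
  show "x \<oplus>\<^bsub>T\<^esub> y \<in> Sym" if "x \<in> Sym" "y \<in> Sym" for x y using that by (auto simp: Sym_def h)
  show "x \<otimes>\<^bsub>T\<^esub> y \<in> Sym" if "x \<in> Sym" "y \<in> Sym" for x y using that by (auto simp: Sym_def h)
  show "c \<odot>\<^bsub>T\<^esub> x \<in> Sym" if "c \<in> carrier K" "x \<in> Sym" for c x using that by (auto simp: Sym_def h)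
qed

lemma sym_power_algebra: "algebra K (sym_power K n A)"
  unfolding sym_power_eq by (rule T.subalg_algebra[OF Sym_subalg])

lemma Sym_closed: "t \<in> Sym \<Longrightarrow> t \<in> carrier T"
  by (simp add: Sym_def)

lemma permute_comp:
  assumes \<nu>: "\<nu> \<in> perms" and \<rho>: "\<rho> \<in> perms" and t: "t \<in> carrier T"
  shows "permute \<nu> (permute \<rho> t) = permute (\<rho> \<circ> \<nu>) t"
proof -
  interpret s: algebra_hom K T T "permute \<nu>" by (rule permute_hom[OF \<nu>])
  interpret r: algebra_hom K T T "permute \<rho>" by (rule permute_hom[OF \<rho>])
  have c: "\<rho> \<circ> \<nu> \<in> perms" using \<nu> \<rho> permutes_compose by blast
  interpret c: algebra_hom K T T "permute (\<lambda>l. \<rho> (\<nu> l))" by (rule permute_hom[OF c, unfolded o_def])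
  show ?thesis
    using t
  proof (induction t rule: T_induct)
    case (step k x t)
    have \<nu>': "\<nu> l < n" if "l < n" for l using \<nu> that permutes_in_image[of \<nu> "{..<n}" l] by auto
    have \<rho>': "\<rho> l < n" if "l < n" for l using \<rho> that permutes_in_image[of \<rho> "{..<n}" l] by auto
    have "(\<lambda>l\<in>{..<n}. x (\<rho> l)) \<in> families" using step(2) \<rho>' by (auto simp: PiE_iff)
    moreover have "(\<lambda>l\<in>{..<n}. (\<lambda>l\<in>{..<n}. x (\<rho> l)) (\<nu> l)) = (\<lambda>l\<in>{..<n}. x ((\<rho> \<circ> \<nu>) l))"
      using \<nu>' by (intro restrict_ext) auto
    ultimately have "permute \<nu> (permute \<rho> (p x)) = permute (\<rho> \<circ> \<nu>) (p x)"
      using permute_pure[OF \<nu>, of "\<lambda>l\<in>{..<n}. x (\<rho> l)"] permute_pure[OF \<rho> step(2)] permute_pure[OF c step(2)]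
      by simp
    with step show ?case by (simp add: o_def)
  qed simp
qed

definition symmetrize where "symmetrize t = finsum T (\<lambda>\<nu>. permute \<nu> t) perms"

lemma finite_perms: "finite perms"
  by (rule finite_permutations) simp

lemma permute_closed [simp]: "\<nu> \<in> perms \<Longrightarrow> t \<in> carrier T \<Longrightarrow> permute \<nu> t \<in> carrier T"
  by (rule algebra_hom.closed[OF permute_hom])

lemma symmetrize_closed [simp]: "t \<in> carrier T \<Longrightarrow> symmetrize t \<in> carrier T"
  unfolding symmetrize_def by (intro T.M.finsum_closed) auto

lemma symmetrize_add:
  "s \<in> carrier T \<Longrightarrow> t \<in> carrier T \<Longrightarrow> symmetrize (s \<oplus>\<^bsub>T\<^esub> t) = symmetrize s \<oplus>\<^bsub>T\<^esub> symmetrize t"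
  unfolding symmetrize_def
  by (subst T.M.finsum_addf[symmetric]; (intro T.M.finsum_cong')?)
     (simp_all add: algebra_hom.add[OF permute_hom])

lemma symmetrize_zero: "symmetrize \<zero>\<^bsub>T\<^esub> = \<zero>\<^bsub>T\<^esub>"
proof -
  have "symmetrize \<zero>\<^bsub>T\<^esub> \<oplus>\<^bsub>T\<^esub> symmetrize \<zero>\<^bsub>T\<^esub> = symmetrize \<zero>\<^bsub>T\<^esub>"
    using symmetrize_add[of "\<zero>\<^bsub>T\<^esub>" "\<zero>\<^bsub>T\<^esub>"] by simp
  then show ?thesis by simp
qed

lemma symmetrize_finsum:
  assumes "finite F" "\<And>i. i \<in> F \<Longrightarrow> f i \<in> carrier T"
  shows "symmetrize (finsum T f F) = finsum T (\<lambda>i. symmetrize (f i)) F"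
  using assms
proof (induction F rule: finite_induct)
  case (insert i F)
  then have "f \<in> F \<rightarrow> carrier T" "(\<lambda>i. symmetrize (f i)) \<in> F \<rightarrow> carrier T" by auto
  with insert show ?case by (simp add: T.M.finsum_insert symmetrize_add)
qed (simp add: symmetrize_zero)

text \<open>Summation over all permutations is linear over the invariants. This makes the symmetric tensors a
  direct summand of the tensor power, which is used twice: to find generators, and to extend ideals
  from the symmetric tensors to all tensors.\<close>

lemma symmetrize_mult:
  assumes s: "s \<in> Sym" and t: "t \<in> carrier T"
  shows "symmetrize (t \<otimes>\<^bsub>T\<^esub> s) = symmetrize t \<otimes>\<^bsub>T\<^esub> s"
  unfolding symmetrize_def using s t Sym_closed[OF s]
  by (subst T.finsum_ldistr; (intro T.M.finsum_cong')?)
     (simp_all add: algebra_hom.mult[OF permute_hom] Sym_def finite_perms)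

lemma symmetrize_smult:
  assumes c: "c \<in> carrier K" and t: "t \<in> carrier T"
  shows "symmetrize (c \<odot>\<^bsub>T\<^esub> t) = c \<odot>\<^bsub>T\<^esub> symmetrize t"
proof -
  have "c \<odot>\<^bsub>T\<^esub> \<one>\<^bsub>T\<^esub> \<in> Sym" using T.subalg_smult[OF Sym_subalg c T.subalg_one[OF Sym_subalg]] .
  from symmetrize_mult[OF this t] show ?thesis
    using c t by (simp add: T.m_comm[of _ "c \<odot>\<^bsub>T\<^esub> \<one>\<^bsub>T\<^esub>"] T.smult_assoc2)
qed

lemma symmetrize_permute:
  assumes \<rho>: "\<rho> \<in> perms" and t: "t \<in> carrier T"
  shows "symmetrize (permute \<rho> t) = symmetrize t"
proof -
  have "symmetrize (permute \<rho> t) = finsum T (\<lambda>\<nu>. permute (\<rho> \<circ> \<nu>) t) perms"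
    unfolding symmetrize_def using \<rho> t
    by (intro T.M.finsum_cong') (auto simp: permute_comp intro!: permute_closed permutes_compose)
  also have "\<dots> = finsum T (\<lambda>\<nu>. permute \<nu> t) ((\<lambda>\<nu>. \<rho> \<circ> \<nu>) ` perms)"
  proof (rule T.M.finsum_reindex[symmetric])
    show "(\<lambda>\<nu>. permute \<nu> t) \<in> (\<lambda>\<nu>. \<rho> \<circ> \<nu>) ` perms \<rightarrow> carrier T"
      using \<rho> t by (auto intro!: permute_closed permutes_compose)
    show "inj_on (\<lambda>\<nu>. \<rho> \<circ> \<nu>) perms"
      using \<rho> permutes_inj[of \<rho>] by (auto simp: inj_on_def fun_eq_iff)
  qed
  also have "(\<lambda>\<nu>. \<rho> \<circ> \<nu>) ` perms = perms"
    using image_compose_permutations_left[of \<rho> "{..<n}"] \<rho> by (simp add: setcompr_eq_image)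
  finally show ?thesis by (simp add: symmetrize_def)
qed

lemma permute_symmetrize:
  assumes \<rho>: "\<rho> \<in> perms" and t: "t \<in> carrier T"
  shows "permute \<rho> (symmetrize t) = symmetrize t"
proof -
  interpret r: algebra_hom K T T "permute \<rho>" by (rule permute_hom[OF \<rho>])
  have "permute \<rho> (symmetrize t) = finsum T (\<lambda>\<nu>. permute (\<nu> \<circ> \<rho>) t) perms"
    unfolding symmetrize_def using \<rho> t
    by (subst r.sum; (intro T.M.finsum_cong')?) (simp_all add: permute_comp permutes_compose)
  also have "\<dots> = finsum T (\<lambda>\<nu>. permute \<nu> t) ((\<lambda>\<nu>. \<nu> \<circ> \<rho>) ` perms)"
  proof (rule T.M.finsum_reindex[symmetric])
    show "(\<lambda>\<nu>. permute \<nu> t) \<in> (\<lambda>\<nu>. \<nu> \<circ> \<rho>) ` perms \<rightarrow> carrier T"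
      using \<rho> t by (auto intro!: permute_closed permutes_compose)
    show "inj_on (\<lambda>\<nu>. \<nu> \<circ> \<rho>) perms"
      using \<rho> permutes_surj[of \<rho>] by (auto simp: inj_on_def fun_eq_iff) (metis surjD)
  qed
  also have "(\<lambda>\<nu>. \<nu> \<circ> \<rho>) ` perms = perms"
    using image_compose_permutations_right[of \<rho> "{..<n}"] \<rho> by (simp add: setcompr_eq_image)
  finally show ?thesis by (simp add: symmetrize_def)
qed

lemma symmetrize_Sym: "t \<in> carrier T \<Longrightarrow> symmetrize t \<in> Sym"
  by (simp add: Sym_def permute_symmetrize)

lemma symmetrize_of_Sym: "t \<in> Sym \<Longrightarrow> symmetrize t = [(fact n :: nat)] \<cdot>\<^bsub>T\<^esub> t"
proof -
  assume t: "t \<in> Sym"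
  then have "symmetrize t = finsum T (\<lambda>_. t) perms"
    unfolding symmetrize_def by (intro T.M.finsum_cong') (auto simp: Sym_def)
  also have "\<dots> = [card perms] \<cdot>\<^bsub>T\<^esub> t" using t by (simp add: T.M.add.finprod_const Sym_closed)
  also have "card perms = fact n" by (rule card_permutations) auto
  finally show ?thesis .
qed

text \<open>Thinking of the spectrum of the symmetric tensors as the set of multisets of \<open>n\<close> points, this is
  the function that adds up the values of \<open>a\<close> at the points of a multiset.\<close>

definition psum where "psum a = finsum T (\<lambda>l. \<iota> l a) {..<n}"

lemma incl_closed' [simp]: "l < n \<Longrightarrow> a \<in> carrier A \<Longrightarrow> \<iota> l a \<in> carrier T"
  by (rule incl_closed) auto

lemma psum_closed [simp]: "a \<in> carrier A \<Longrightarrow> psum a \<in> carrier T"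
  unfolding psum_def by (intro T.M.finsum_closed) auto

lemma psum_Sym: assumes a: "a \<in> carrier A" shows "psum a \<in> Sym"
proof -
  have "permute \<nu> (psum a) = psum a" if \<nu>: "\<nu> \<in> perms" for \<nu>
  proof -
    interpret s: algebra_hom K T T "permute \<nu>" by (rule permute_hom[OF \<nu>])
    have img: "\<nu> ` {..<n} = {..<n}" using \<nu> by (simp add: permutes_image)
    have "psum a = finsum T (\<lambda>l. \<iota> l a) (\<nu> ` {..<n})" unfolding img psum_def ..
    also have "\<dots> = finsum T (\<lambda>l. \<iota> (\<nu> l) a) {..<n}"
    proof (rule T.M.finsum_reindex)
      show "inj_on \<nu> {..<n}" using \<nu> permutes_inj_on by auto
    qed (unfold img, use a in auto)
    finally have "permute \<nu> (psum a) = permute \<nu> (finsum T (\<lambda>l. \<iota> (\<nu> l) a) {..<n})" by simp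
    also have "\<dots> = finsum T (\<lambda>l. permute \<nu> (\<iota> (\<nu> l) a)) {..<n}"
    proof (rule s.sum)
      fix l assume "l \<in> {..<n}"
      then have "\<nu> l < n" using img by blast
      then show "\<iota> (\<nu> l) a \<in> carrier T" using a by simp
    qed
    also have "\<dots> = psum a"
      unfolding psum_def using \<nu> a by (intro T.M.finsum_cong') (auto simp: permute_incl)
    finally show ?thesis .
  qed
  then show ?thesis using a by (simp add: Sym_def)
qed

lemma pure_mult_incl:
  assumes x: "x \<in> families" and l: "l < n" and a: "a \<in> carrier A"
  shows "p x \<otimes>\<^bsub>T\<^esub> \<iota> l a = p (x(l := x l \<otimes>\<^bsub>A\<^esub> a))"
proof -
  have x': "x j \<in> carrier A" if "j < n" for j using x that by auto
  have "(\<lambda>j\<in>{..<n}. x j \<otimes>\<^bsub>A\<^esub> ((\<lambda>j\<in>{..<n}. \<one>\<^bsub>A\<^esub>)(l := a)) j) = x(l := x l \<otimes>\<^bsub>A\<^esub> a)"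
    using x l x' by (auto simp: PiE_iff extensional_def)
  then show ?thesis
    using pure_mult[OF x families_update[OF families_one, of l a]] l a by (simp add: incl_def)
qed

text \<open>In characteristic zero the symmetrizations of pure tensors span the symmetric tensors. They are
  polynomials in power sums by induction on the number \<open>q\<close> of leading entries that may differ from
  \<open>1\<close>. To produce one more entry \<open>a\<close>, multiply by the power sum of \<open>a\<close>: the \<open>n - q\<close> terms in which \<open>a\<close>
  falls on an entry \<open>1\<close> all have the symmetrization in question, and the remaining \<open>q\<close> terms, in which
  \<open>a\<close> is multiplied into an earlier entry, are covered by the induction hypothesis.\<close>

lemma power_sums_generate:
  assumes W: "subalg K T W" and psum: "\<And>a. a \<in> carrier A \<Longrightarrow> psum a \<in> W"
  shows "Sym \<subseteq> W"
proof -
  have pure: "q \<le> n \<Longrightarrow> x \<in> families \<Longrightarrow> (\<And>l. q \<le> l \<Longrightarrow> l < n \<Longrightarrow> x l = \<one>\<^bsub>A\<^esub>) \<Longrightarrow> symmetrize (p x) \<in> W" for q x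
  proof (induction q arbitrary: x)
    case 0
    then have "x = (\<lambda>l\<in>{..<n}. \<one>\<^bsub>A\<^esub>)" by (auto simp: PiE_iff extensional_def)
    then have "symmetrize (p x) = [(fact n :: nat)] \<cdot>\<^bsub>T\<^esub> \<one>\<^bsub>T\<^esub>"
      using symmetrize_of_Sym[OF T.subalg_one[OF Sym_subalg]] pure_one by simp
    then show ?case by (simp add: T.nat_smult T.subalg_smult[OF W] T.subalg_one[OF W])
  next
    case (Suc q)
    then have q: "q < n" by simp
    define a where "a = x q"
    define y where "y = x(q := \<one>\<^bsub>A\<^esub>)"
    have a: "a \<in> carrier A" using Suc q by (auto simp: a_def)
    have y: "y \<in> families" unfolding y_def using Suc(3) q by (intro families_update) auto
    have y': "y l \<in> carrier A" if "l < n" for l using y that by auto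
    define z where "z l = y(l := y l \<otimes>\<^bsub>A\<^esub> a)" for l
    have z: "z l \<in> families" if "l < n" for l
      unfolding z_def using that y a y' by (intro families_update) auto
    have zq: "z q = x" using a by (auto simp: z_def y_def a_def)
    have y1: "y l = \<one>\<^bsub>A\<^esub>" if "q \<le> l" "l < n" for l
      using Suc(4)[of l] that by (auto simp: y_def)
    have yW: "symmetrize (p y) \<in> W" using q y y1 by (intro Suc.IH) auto
    have small: "symmetrize (p (z l)) \<in> W" if "l < q" for l
      using q that y1 by (intro Suc.IH z) (auto simp: z_def)
    \<comment> \<open>Move the new entry from place \<open>l\<close> to place \<open>q\<close>.\<close>
    have large: "symmetrize (p (z l)) = symmetrize (p x)" if l: "q \<le> l" "l < n" for l
    proof -
      define \<nu> where "\<nu> = transpose q l"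
      have \<nu>: "\<nu> \<in> perms" unfolding \<nu>_def using q l by (auto intro: permutes_swap_id)
      have "(\<lambda>k\<in>{..<n}. z l (\<nu> k)) = x"
      proof
        fix k
        show "(\<lambda>k\<in>{..<n}. z l (\<nu> k)) k = x k"
        proof (cases "k < n")
          case True
          then show ?thesis
            using l q y1[of q] y1[of l] y1[of k] a Suc(4)[of l]
            by (auto simp: \<nu>_def z_def transpose_def y_def a_def)
        qed (use Suc(3) in \<open>auto simp: PiE_iff extensional_def\<close>)
      qed
      then have "permute \<nu> (p (z l)) = p x" using permute_pure[OF \<nu> z[OF l(2)]] by simp
      then show ?thesis using symmetrize_permute[OF \<nu> pure_closed[OF z[OF l(2)]]] by simp
    qed
    have "symmetrize (p y) \<otimes>\<^bsub>T\<^esub> psum a = symmetrize (p y \<otimes>\<^bsub>T\<^esub> psum a)"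
      using symmetrize_mult[OF psum_Sym[OF a] pure_closed[OF y]] ..
    also have "p y \<otimes>\<^bsub>T\<^esub> psum a = finsum T (\<lambda>l. p (z l)) {..<n}"
      unfolding psum_def using y a z
      by (subst T.finsum_rdistr; (intro T.M.finsum_cong')?) (simp_all add: pure_mult_incl z_def)
    also have "symmetrize \<dots> = finsum T (\<lambda>l. symmetrize (p (z l))) ({..<q} \<union> {q..<n})"
    proof -
      have split: "{..<q} \<union> {q..<n} = {..<n}" using q by auto
      show ?thesis unfolding split by (rule symmetrize_finsum) (use z in simp_all)
    qed
    also have "\<dots> = finsum T (\<lambda>l. symmetrize (p (z l))) {..<q} \<oplus>\<^bsub>T\<^esub> finsum T (\<lambda>l. symmetrize (p (z l))) {q..<n}"
      using z q by (intro T.M.finsum_Un_disjoint) auto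
    also have "finsum T (\<lambda>l. symmetrize (p (z l))) {q..<n} = finsum T (\<lambda>_. symmetrize (p x)) {q..<n}"
      using Suc(3) large by (intro T.M.finsum_cong') auto
    also have "\<dots> = add_pow T (n - q) (symmetrize (p x))"
      using Suc(3) by (simp add: T.M.add.finprod_const)
    finally have eq: "symmetrize (p y) \<otimes>\<^bsub>T\<^esub> psum a =
      finsum T (\<lambda>l. symmetrize (p (z l))) {..<q} \<oplus>\<^bsub>T\<^esub> (add_pow T (n - q) (symmetrize (p x)))" .
    have f: "finsum T (\<lambda>l. symmetrize (p (z l))) {..<q} \<in> W"
      using small by (intro T.subalg_finsum[OF W]) auto
    have "add_pow T (n - q) (symmetrize (p x)) =
      symmetrize (p y) \<otimes>\<^bsub>T\<^esub> psum a \<ominus>\<^bsub>T\<^esub> finsum T (\<lambda>l. symmetrize (p (z l))) {..<q}"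
      unfolding eq using T.subalg_carrier[OF W f] Suc(3)
      by (subst T.M.a_comm) (simp_all add: a_minus_def T.M.a_assoc T.M.r_neg)
    then have "add_pow T (n - q) (symmetrize (p x)) \<in> W"
      using T.subalg_minus[OF W T.subalg_mult[OF W yW psum[OF a]] f] by simp
    then have "recip K (n - q) \<odot>\<^bsub>T\<^esub> (add_pow T (n - q) (symmetrize (p x))) \<in> W"
      using q by (intro T.subalg_smult[OF W]) auto
    then show ?case using q Suc(3) char0_field_axioms by (simp add: T.recip_smult)
  qed
  have all: "symmetrize t \<in> W" if "t \<in> carrier T" for t
    using that
  proof (induction t rule: T_induct)
    case zero
    show ?case by (simp add: symmetrize_zero T.subalg_zero[OF W])
  next
    case (step c x t)
    then show ?case
      using pure[of n x] by (simp add: symmetrize_add symmetrize_smult T.subalg_add[OF W] T.subalg_smult[OF W])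
  qed
  show ?thesis
  proof
    fix t assume t: "t \<in> Sym"
    have "recip K (fact n) \<odot>\<^bsub>T\<^esub> symmetrize t \<in> W"
      using all[OF Sym_closed[OF t]] by (intro T.subalg_smult[OF W]) auto
    then show "t \<in> W"
      using t Sym_closed[OF t] char0_field_axioms by (simp add: symmetrize_of_Sym T.recip_smult)
  qed
qed

lemma Sym_hom_ext:
  assumes "algebra_hom K (sym_power K n A) C u" "algebra_hom K (sym_power K n A) C v"
    and "\<And>a. a \<in> carrier A \<Longrightarrow> u (psum a) = v (psum a)" and "t \<in> Sym"
  shows "u t = v t"
proof -
  let ?E = "{x \<in> Sym. u x = v x}"
  have "subalg K (sym_power K n A) ?E"
    using subalg_equalizer[OF assms(1,2)] by (simp add: sym_power_eq)
  then have "subalg K T ?E" using Sym_subalg by (auto simp: subalg_def sym_power_eq)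
  then have "Sym \<subseteq> ?E" by (rule power_sums_generate) (use assms(3) psum_Sym in auto)
  then show ?thesis using assms(4) by auto
qed

lemma Sym_incl_hom: "algebra_hom K (sym_power K n A) T (\<lambda>t. t)"
  by (intro algebra_homI T.algebra_axioms sym_power_algebra alg_homI)
     (auto simp: sym_power_eq Sym_closed)

subsection \<open>The diagonal action\<close>

lemma diagonal:
  assumes g: "\<phi> g \<in> alg_hom K A A"
  shows "diagonal_action K n A \<phi> g \<in> alg_hom K T T"
    and "\<And>l a. l < n \<Longrightarrow> a \<in> carrier A \<Longrightarrow> diagonal_action K n A \<phi> g (\<iota> l a) = \<iota> l (\<phi> g a)"
  unfolding diagonal_action_def
  using tensor_map_reindex(1)[of "\<lambda>l. l" "\<lambda>_. \<phi> g"] tensor_map_incl[of "\<lambda>l. l" "\<lambda>_. \<phi> g"] g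
  by (auto simp: bij_betw_def)

lemma diagonal_algebra_hom:
  "\<phi> g \<in> alg_hom K A A \<Longrightarrow> algebra_hom K T T (diagonal_action K n A \<phi> g)"
  by (intro algebra_homI T.algebra_axioms diagonal)

lemma diagonal_psum:
  assumes g: "\<phi> g \<in> alg_hom K A A" and a: "a \<in> carrier A"
  shows "diagonal_action K n A \<phi> g (psum a) = psum (\<phi> g a)"
proof -
  interpret d: algebra_hom K T T "diagonal_action K n A \<phi> g" by (rule diagonal_algebra_hom[of \<phi> g, OF g])
  have ga: "\<phi> g a \<in> carrier A" using g a by (auto simp: alg_hom_def ring_hom_def)
  show ?thesis
    unfolding psum_def using a ga
    by (subst d.sum; (intro T.M.finsum_cong')?) (simp_all add: diagonal(2)[of \<phi> g, OF g])
qed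

lemma diagonal_Sym:
  assumes g: "\<phi> g \<in> alg_hom K A A" and t: "t \<in> Sym"
  shows "diagonal_action K n A \<phi> g t \<in> Sym"
proof -
  interpret d: algebra_hom K T T "diagonal_action K n A \<phi> g" by (rule diagonal_algebra_hom[of \<phi> g, OF g])
  have "Sym \<subseteq> {t \<in> carrier T. diagonal_action K n A \<phi> g t \<in> Sym}"
  proof (rule power_sums_generate[OF d.subalg_vimage[OF Sym_subalg]])
    fix a assume a: "a \<in> carrier A"
    have "\<phi> g a \<in> carrier A" using g a by (auto simp: alg_hom_def ring_hom_def)
    then show "psum a \<in> {t \<in> carrier T. diagonal_action K n A \<phi> g t \<in> Sym}"
      using a psum_Sym by (auto simp: diagonal_psum[of \<phi> g, OF g])
  qed
  then show ?thesis using t by auto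
qed

lemma diagonal_Sym_hom:
  assumes g: "\<phi> g \<in> alg_hom K A A"
  shows "diagonal_action K n A \<phi> g \<in> alg_hom K (sym_power K n A) (sym_power K n A)"
proof -
  interpret d: algebra_hom K T T "diagonal_action K n A \<phi> g" by (rule diagonal_algebra_hom[of \<phi> g, OF g])
  show ?thesis
    by (rule alg_homI) (use diagonal_Sym[of \<phi> g, OF g] Sym_closed in \<open>auto simp: sym_power_eq\<close>)
qed

end

section \<open>Prime ideals and homomorphisms into domains\<close>

lemma (in cring) exists_ideal_maximal_avoiding_powers:
  assumes N: "ideal N R" and x: "\<And>k::nat. x [^] k \<notin> N"
  shows "\<exists>Q. ideal Q R \<and> N \<subseteq> Q \<and> (\<forall>k::nat. x [^] k \<notin> Q) \<and>
    (\<forall>J. ideal J R \<longrightarrow> Q \<subseteq> J \<longrightarrow> (\<forall>k::nat. x [^] k \<notin> J) \<longrightarrow> J = Q)"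
proof -
  define S where "S = {J. ideal J R \<and> N \<subseteq> J \<and> (\<forall>k::nat. x [^] k \<notin> J)}"
  have "\<exists>M\<in>S. \<forall>Z\<in>S. M \<subseteq> Z \<longrightarrow> Z = M"
  proof (rule subset_Zorn)
    fix C assume C: "subset.chain S C"
    show "\<exists>U\<in>S. \<forall>Z\<in>C. Z \<subseteq> U"
    proof (cases "C = {}")
      case True
      have "N \<in> S" using N x by (auto simp: S_def)
      then show ?thesis using True by auto
    next
      case False
      have sub: "C \<subseteq> S" using C by (simp add: pred_on.chain_def)
      have "subset.chain {J. ideal J R} C"
        using C by (auto simp: pred_on.chain_def S_def)
      then have "ideal (if C = {} then {\<zero>} else \<Union>C) R" by (rule chain_Union_is_ideal)
      then have "\<Union>C \<in> S" using False sub by (auto simp: S_def)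
      then show ?thesis by auto
    qed
  qed
  then obtain Q where Q: "Q \<in> S" and max: "\<And>Z. Z \<in> S \<Longrightarrow> Q \<subseteq> Z \<Longrightarrow> Z = Q" by metis
  have "J = Q" if "ideal J R" "Q \<subseteq> J" "\<forall>k::nat. x [^] k \<notin> J" for J
    using that Q by (intro max) (auto simp: S_def)
  then show ?thesis using Q by (intro exI[of _ Q]) (simp add: S_def)
qed

text \<open>An ideal that is maximal among those containing no power of \<open>x\<close> is prime: two elements outside it
  generate, together with it, ideals containing powers of \<open>x\<close>, and the product of these powers shows
  that the product of the two elements is outside as well.\<close>

lemma (in cring) exists_prime_avoiding_powers:
  assumes N: "ideal N R" and x: "x \<in> carrier R" "\<And>k::nat. x [^] k \<notin> N"
  shows "\<exists>Q. primeideal Q R \<and> N \<subseteq> Q \<and> x \<notin> Q"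
proof -
  obtain Q where Q: "ideal Q R" "N \<subseteq> Q" "\<And>k::nat. x [^] k \<notin> Q"
    and max: "\<And>J. ideal J R \<Longrightarrow> Q \<subseteq> J \<Longrightarrow> (\<And>k::nat. x [^] k \<notin> J) \<Longrightarrow> J = Q"
    using exists_ideal_maximal_avoiding_powers[OF N x(2)] by metis
  interpret Q: ideal Q R by fact
  have power: "\<exists>k::nat. \<exists>r\<in>carrier R. \<exists>q\<in>Q. x [^] k = r \<otimes> a \<oplus> q" if a: "a \<in> carrier R" "a \<notin> Q" for a
  proof -
    let ?J = "(PIdl a) <+>\<^bsub>R\<^esub> Q"
    have J: "ideal ?J R" by (rule add_ideals[OF cgenideal_ideal[OF a(1)] Q(1)])
    have mem: "y \<in> ?J \<longleftrightarrow> (\<exists>r\<in>carrier R. \<exists>q\<in>Q. y = r \<otimes> a \<oplus> q)" for y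
      by (auto simp: set_add_defs cgenideal_def)
    have "Q \<subseteq> ?J"
    proof
      fix q assume "q \<in> Q"
      then have "q = \<zero> \<otimes> a \<oplus> q" using a Q.Icarr by simp
      then show "q \<in> ?J" using \<open>q \<in> Q\<close> mem by blast
    qed
    moreover have "a \<in> ?J"
    proof -
      have "a = \<one> \<otimes> a \<oplus> \<zero>" using a by simp
      then show ?thesis using mem Q.zero_closed by blast
    qed
    ultimately have "\<exists>k::nat. x [^] k \<in> ?J" using max[OF J] a by blast
    then show ?thesis using mem by blast
  qed
  have "primeideal Q R"
  proof (rule primeidealI[OF Q(1) is_cring])
    show "carrier R \<noteq> Q" using Q(3)[of 0] by auto
    fix a b assume a: "a \<in> carrier R" and b: "b \<in> carrier R" and ab: "a \<otimes> b \<in> Q"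
    show "a \<in> Q \<or> b \<in> Q"
    proof (rule ccontr)
      assume "\<not> (a \<in> Q \<or> b \<in> Q)"
      then obtain k l :: nat and r s q t where kl: "r \<in> carrier R" "q \<in> Q" "x [^] k = r \<otimes> a \<oplus> q"
        "s \<in> carrier R" "t \<in> Q" "x [^] l = s \<otimes> b \<oplus> t"
        using power a b by meson
      note c = kl(1,4) a b Q.Icarr[OF kl(2)] Q.Icarr[OF kl(5)]
      have "x [^] (k + l) = (r \<otimes> a \<oplus> q) \<otimes> (s \<otimes> b \<oplus> t)" using kl x by (simp flip: nat_pow_mult)
      also have "\<dots> = (r \<otimes> s) \<otimes> (a \<otimes> b) \<oplus> ((r \<otimes> a) \<otimes> t \<oplus> (s \<otimes> b \<oplus> t) \<otimes> q)"
        using c by algebra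
      also have "\<dots> \<in> Q"
        using Q.I_l_closed[OF ab, of "r \<otimes> s"] Q.I_l_closed[OF kl(5), of "r \<otimes> a"]
          Q.I_l_closed[OF kl(2), of "s \<otimes> b \<oplus> t"] c by simp
      finally show False using Q(3) by blast
    qed
  qed
  moreover have "x \<notin> Q" using Q(3)[of 1] x by simp
  ultimately show ?thesis using Q(2) by blast
qed

lemma (in cring) exists_maximal_ideal:
  assumes N: "ideal N R" and "\<one> \<notin> N"
  shows "\<exists>M. maximalideal M R \<and> N \<subseteq> M"
proof -
  obtain Q where Q: "ideal Q R" "N \<subseteq> Q" "\<one> \<notin> Q"
    and max: "\<And>J. ideal J R \<Longrightarrow> Q \<subseteq> J \<Longrightarrow> \<one> \<notin> J \<Longrightarrow> J = Q"
    using exists_ideal_maximal_avoiding_powers[OF N, of \<one>] assms(2) by auto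
  have "maximalideal Q R"
  proof (rule maximalidealI[OF Q(1)])
    show "carrier R \<noteq> Q" using Q(3) by auto
    show "J = Q \<or> J = carrier R" if "ideal J R" "Q \<subseteq> J" "J \<subseteq> carrier R" for J
      using max[OF that(1,2)] ideal.one_imp_carrier[OF that(1)] by blast
  qed
  then show ?thesis using Q(2) by blast
qed

text \<open>Dedekind's independence of characters, in a form that allows repetitions: in a linear relation
  among homomorphisms into a domain, the coefficients belonging to one and the same homomorphism add
  up to zero. A member \<open>\<chi> m\<close> other than \<open>h\<close> is removed by subtracting \<open>\<chi> m b\<close> times the relation at
  \<open>a\<close> from the relation at \<open>b a\<close>, where \<open>h b \<noteq> \<chi> m b\<close>; this multiplies the coefficients that belong to
  \<open>h\<close> by the nonzero factor \<open>h b - \<chi> m b\<close>.\<close>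

lemma independence_of_characters:
  assumes "domain D" and L: "finite L"
    and hom: "\<And>l. l \<in> L \<Longrightarrow> algebra_hom K A D (\<chi> l)" and h: "algebra_hom K A D h"
    and c: "\<And>l. l \<in> L \<Longrightarrow> c l \<in> carrier D"
    and rel: "\<And>a. a \<in> carrier A \<Longrightarrow> (\<Oplus>\<^bsub>D\<^esub>l\<in>L. c l \<otimes>\<^bsub>D\<^esub> \<chi> l a) = \<zero>\<^bsub>D\<^esub>"
  shows "(\<Oplus>\<^bsub>D\<^esub>l\<in>{l\<in>L. \<forall>a\<in>carrier A. \<chi> l a = h a}. c l) = \<zero>\<^bsub>D\<^esub>"
proof -
  interpret D: domain D by fact
  interpret h: algebra_hom K A D h by fact
  show ?thesis
    using L hom c rel
  proof (induction "card {l\<in>L. \<exists>a\<in>carrier A. \<chi> l a \<noteq> h a}" arbitrary: L c)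
    case 0
    have "\<not> (\<exists>a\<in>carrier A. \<chi> l a \<noteq> h a)" if "l \<in> L" for l
      using 0(1,2) that by auto
    then have eq: "{l\<in>L. \<forall>a\<in>carrier A. \<chi> l a = h a} = L" by auto
    have "(\<Oplus>\<^bsub>D\<^esub>l\<in>L. c l) = (\<Oplus>\<^bsub>D\<^esub>l\<in>L. c l \<otimes>\<^bsub>D\<^esub> \<chi> l \<one>\<^bsub>A\<^esub>)"
      using 0(3,4) by (intro D.finsum_cong') (auto simp: algebra_hom.one[OF 0(3)])
    then show ?case using 0(5)[of "\<one>\<^bsub>A\<^esub>"] unfolding eq by simp
  next
    case (Suc k)
    note fin = Suc.prems(1) and hom = Suc.prems(2) and c = Suc.prems(3) and rel = Suc.prems(4)
    have "{l\<in>L. \<exists>a\<in>carrier A. \<chi> l a \<noteq> h a} \<noteq> {}" using Suc(2) by force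
    then obtain m b where m: "m \<in> L" "b \<in> carrier A" "\<chi> m b \<noteq> h b" by blast
    note \<chi> = algebra_hom.closed[OF hom]
    define d where "d l = c l \<otimes>\<^bsub>D\<^esub> (\<chi> l b \<ominus>\<^bsub>D\<^esub> \<chi> m b)" for l
    have d: "d l \<in> carrier D" if "l \<in> L" for l using that m c \<chi> by (simp add: d_def)
    have dm: "d m = \<zero>\<^bsub>D\<^esub>" using m c \<chi> by (simp add: d_def a_minus_def D.r_neg)
    let ?L = "L - {m}"
    have "{l\<in>L. \<exists>a\<in>carrier A. \<chi> l a \<noteq> h a} = insert m {l\<in>?L. \<exists>a\<in>carrier A. \<chi> l a \<noteq> h a}"
      using m by auto
    then have card: "k = card {l\<in>?L. \<exists>a\<in>carrier A. \<chi> l a \<noteq> h a}"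
      using Suc(2) fin by simp
    have "(\<Oplus>\<^bsub>D\<^esub>l\<in>?L. d l \<otimes>\<^bsub>D\<^esub> \<chi> l a) = \<zero>\<^bsub>D\<^esub>" if a: "a \<in> carrier A" for a
    proof -
      have ba: "b \<otimes>\<^bsub>A\<^esub> a \<in> carrier A" using m a by simp
      have "(\<Oplus>\<^bsub>D\<^esub>l\<in>?L. d l \<otimes>\<^bsub>D\<^esub> \<chi> l a) = (\<Oplus>\<^bsub>D\<^esub>l\<in>L. d l \<otimes>\<^bsub>D\<^esub> \<chi> l a)"
        using fin d \<chi> a m dm by (intro D.add.finprod_mono_neutral_cong_left) auto
      also have "\<dots> = (\<Oplus>\<^bsub>D\<^esub>l\<in>L. c l \<otimes>\<^bsub>D\<^esub> \<chi> l (b \<otimes>\<^bsub>A\<^esub> a) \<oplus>\<^bsub>D\<^esub> (\<ominus>\<^bsub>D\<^esub> \<chi> m b) \<otimes>\<^bsub>D\<^esub> (c l \<otimes>\<^bsub>D\<^esub> \<chi> l a))"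
      proof (intro D.finsum_cong' refl)
        fix l assume l: "l \<in> L"
        have "\<chi> l (b \<otimes>\<^bsub>A\<^esub> a) = \<chi> l b \<otimes>\<^bsub>D\<^esub> \<chi> l a" using algebra_hom.mult[OF hom[OF l] m(2) a] .
        then show "d l \<otimes>\<^bsub>D\<^esub> \<chi> l a =
            c l \<otimes>\<^bsub>D\<^esub> \<chi> l (b \<otimes>\<^bsub>A\<^esub> a) \<oplus>\<^bsub>D\<^esub> (\<ominus>\<^bsub>D\<^esub> \<chi> m b) \<otimes>\<^bsub>D\<^esub> (c l \<otimes>\<^bsub>D\<^esub> \<chi> l a)"
          using c[OF l] \<chi>[OF l m(2)] \<chi>[OF l a] \<chi>[OF m(1,2)] unfolding d_def by algebra
      qed (use \<chi> c a ba m in auto)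
      also have "\<dots> = (\<Oplus>\<^bsub>D\<^esub>l\<in>L. c l \<otimes>\<^bsub>D\<^esub> \<chi> l (b \<otimes>\<^bsub>A\<^esub> a)) \<oplus>\<^bsub>D\<^esub>
          (\<Oplus>\<^bsub>D\<^esub>l\<in>L. (\<ominus>\<^bsub>D\<^esub> \<chi> m b) \<otimes>\<^bsub>D\<^esub> (c l \<otimes>\<^bsub>D\<^esub> \<chi> l a))"
        using \<chi> c a ba m by (intro D.finsum_addf) auto
      also have "(\<Oplus>\<^bsub>D\<^esub>l\<in>L. (\<ominus>\<^bsub>D\<^esub> \<chi> m b) \<otimes>\<^bsub>D\<^esub> (c l \<otimes>\<^bsub>D\<^esub> \<chi> l a)) =
          (\<ominus>\<^bsub>D\<^esub> \<chi> m b) \<otimes>\<^bsub>D\<^esub> (\<Oplus>\<^bsub>D\<^esub>l\<in>L. c l \<otimes>\<^bsub>D\<^esub> \<chi> l a)"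
        using fin \<chi> c a m by (intro D.finsum_rdistr[symmetric]) auto
      also have "(\<Oplus>\<^bsub>D\<^esub>l\<in>L. c l \<otimes>\<^bsub>D\<^esub> \<chi> l a) = \<zero>\<^bsub>D\<^esub>" using rel[OF a] .
      also have "(\<Oplus>\<^bsub>D\<^esub>l\<in>L. c l \<otimes>\<^bsub>D\<^esub> \<chi> l (b \<otimes>\<^bsub>A\<^esub> a)) = \<zero>\<^bsub>D\<^esub>" using rel[OF ba] .
      finally show ?thesis using \<chi>[OF m(1,2)] by simp
    qed
    then have IH: "(\<Oplus>\<^bsub>D\<^esub>l\<in>{l\<in>?L. \<forall>a\<in>carrier A. \<chi> l a = h a}. d l) = \<zero>\<^bsub>D\<^esub>"
      using fin hom d by (intro Suc(1)[OF card]) auto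
    let ?E = "{l\<in>L. \<forall>a\<in>carrier A. \<chi> l a = h a}"
    have E: "{l\<in>?L. \<forall>a\<in>carrier A. \<chi> l a = h a} = ?E" using m by auto
    let ?u = "h b \<ominus>\<^bsub>D\<^esub> \<chi> m b"
    have u: "?u \<in> carrier D" "?u \<noteq> \<zero>\<^bsub>D\<^esub>" using m \<chi>[OF m(1,2)] by auto
    have "(\<Oplus>\<^bsub>D\<^esub>l\<in>?E. d l) = (\<Oplus>\<^bsub>D\<^esub>l\<in>?E. c l \<otimes>\<^bsub>D\<^esub> ?u)"
      using c u m by (intro D.finsum_cong') (auto simp: d_def)
    also have "\<dots> = (\<Oplus>\<^bsub>D\<^esub>l\<in>?E. c l) \<otimes>\<^bsub>D\<^esub> ?u"
      using fin c u by (intro D.finsum_ldistr[symmetric]) auto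
    finally have "(\<Oplus>\<^bsub>D\<^esub>l\<in>?E. c l) \<otimes>\<^bsub>D\<^esub> ?u = \<zero>\<^bsub>D\<^esub>" using IH unfolding E by simp
    moreover have "(\<Oplus>\<^bsub>D\<^esub>l\<in>?E. c l) \<in> carrier D" using c by (intro D.finsum_closed) auto
    ultimately show ?case using u D.integral by blast
  qed
qed

text \<open>A homomorphism on the right that is missing on the left would have minus its multiplicity as its
  coefficient in the difference of the two sides, and this is not zero in characteristic zero.\<close>

lemma sum_of_characters_unique:
  fixes \<chi> :: "'i \<Rightarrow> 'a \<Rightarrow> 'd" and \<psi> :: "'j \<Rightarrow> 'a \<Rightarrow> 'd"
  assumes K: "char0_field K" and D: "domain D" and L: "finite L" and L': "finite L'"
    and hom: "\<And>l. l \<in> L \<Longrightarrow> algebra_hom K A D (\<chi> l)" and hom': "\<And>l. l \<in> L' \<Longrightarrow> algebra_hom K A D (\<psi> l)"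
    and eq: "\<And>a. a \<in> carrier A \<Longrightarrow> (\<Oplus>\<^bsub>D\<^esub>l\<in>L. \<chi> l a) = (\<Oplus>\<^bsub>D\<^esub>l\<in>L'. \<psi> l a)"
    and m: "m \<in> L'"
  shows "\<exists>l\<in>L. \<forall>a\<in>carrier A. \<chi> l a = \<psi> m a"
proof (rule ccontr)
  assume none: "\<not> (\<exists>l\<in>L. \<forall>a\<in>carrier A. \<chi> l a = \<psi> m a)"
  interpret D: domain D by fact
  interpret h: algebra_hom K A D "\<psi> m" by (rule hom'[OF m])
  define M where "M = Inl ` L \<union> Inr ` L'"
  define f where "f = case_sum \<chi> \<psi>"
  define c :: "'i + 'j \<Rightarrow> 'd" where "c = case_sum (\<lambda>l. \<one>\<^bsub>D\<^esub>) (\<lambda>l. \<ominus>\<^bsub>D\<^esub> \<one>\<^bsub>D\<^esub>)"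
  have M: "finite M" using L L' by (simp add: M_def)
  note \<chi> = algebra_hom.closed[OF hom] and \<psi> = algebra_hom.closed[OF hom']
  have "(\<Oplus>\<^bsub>D\<^esub>l\<in>M. c l \<otimes>\<^bsub>D\<^esub> f l a) = \<zero>\<^bsub>D\<^esub>" if a: "a \<in> carrier A" for a
  proof -
    have "(\<Oplus>\<^bsub>D\<^esub>l\<in>M. c l \<otimes>\<^bsub>D\<^esub> f l a) =
        (\<Oplus>\<^bsub>D\<^esub>l\<in>Inl ` L. c l \<otimes>\<^bsub>D\<^esub> f l a) \<oplus>\<^bsub>D\<^esub> (\<Oplus>\<^bsub>D\<^esub>l\<in>Inr ` L'. c l \<otimes>\<^bsub>D\<^esub> f l a)"
      unfolding M_def using L L' a \<chi> \<psi> by (intro D.finsum_Un_disjoint) (auto simp: c_def f_def)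
    also have "(\<Oplus>\<^bsub>D\<^esub>l\<in>Inl ` L. c l \<otimes>\<^bsub>D\<^esub> f l a) = (\<Oplus>\<^bsub>D\<^esub>l\<in>L. c (Inl l) \<otimes>\<^bsub>D\<^esub> f (Inl l) a)"
      using a \<chi> by (intro D.finsum_reindex) (auto simp: c_def f_def)
    also have "\<dots> = (\<Oplus>\<^bsub>D\<^esub>l\<in>L. \<chi> l a)"
      using a \<chi> by (intro D.finsum_cong') (auto simp: c_def f_def)
    also have "(\<Oplus>\<^bsub>D\<^esub>l\<in>Inr ` L'. c l \<otimes>\<^bsub>D\<^esub> f l a) = (\<Oplus>\<^bsub>D\<^esub>l\<in>L'. c (Inr l) \<otimes>\<^bsub>D\<^esub> f (Inr l) a)"
      using a \<psi> by (intro D.finsum_reindex) (auto simp: c_def f_def)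
    also have "\<dots> = (\<Oplus>\<^bsub>D\<^esub>l\<in>L'. (\<ominus>\<^bsub>D\<^esub> \<one>\<^bsub>D\<^esub>) \<otimes>\<^bsub>D\<^esub> \<psi> l a)"
      using a \<psi> by (intro D.finsum_cong') (auto simp: c_def f_def)
    also have "\<dots> = (\<ominus>\<^bsub>D\<^esub> \<one>\<^bsub>D\<^esub>) \<otimes>\<^bsub>D\<^esub> (\<Oplus>\<^bsub>D\<^esub>l\<in>L'. \<psi> l a)"
      using a \<psi> L' by (intro D.finsum_rdistr[symmetric]) auto
    finally show ?thesis
      using eq[OF a] a \<psi> by (simp add: D.l_minus D.r_neg)
  qed
  then have "(\<Oplus>\<^bsub>D\<^esub>l\<in>{l\<in>M. \<forall>a\<in>carrier A. f l a = \<psi> m a}. c l) = \<zero>\<^bsub>D\<^esub>"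
    by (intro independence_of_characters[OF D M _ h.algebra_hom_axioms])
       (auto simp: M_def f_def c_def hom hom')
  also have "{l\<in>M. \<forall>a\<in>carrier A. f l a = \<psi> m a} = Inr ` {l\<in>L'. \<forall>a\<in>carrier A. \<psi> l a = \<psi> m a}"
    (is "_ = Inr ` ?E")
    using none by (auto simp: M_def f_def)
  also have "(\<Oplus>\<^bsub>D\<^esub>l\<in>Inr ` ?E. c l) = (\<Oplus>\<^bsub>D\<^esub>l\<in>?E. \<ominus>\<^bsub>D\<^esub> \<one>\<^bsub>D\<^esub>)"
    by (subst D.finsum_reindex) (auto simp: c_def)
  also have "\<dots> = [card ?E] \<cdot>\<^bsub>D\<^esub> (\<ominus>\<^bsub>D\<^esub> \<one>\<^bsub>D\<^esub>)"
    by (simp add: D.add.finprod_const)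
  finally have z: "[card ?E] \<cdot>\<^bsub>D\<^esub> (\<ominus>\<^bsub>D\<^esub> \<one>\<^bsub>D\<^esub>) = \<zero>\<^bsub>D\<^esub>" .
  have pos: "card ?E > 0" using m L' by (auto simp: card_gt_0_iff)
  have "recip K (card ?E) \<odot>\<^bsub>D\<^esub> \<zero>\<^bsub>D\<^esub> = \<ominus>\<^bsub>D\<^esub> \<one>\<^bsub>D\<^esub>"
    using h.B.recip_smult[OF K _ pos, of "\<ominus>\<^bsub>D\<^esub> \<one>\<^bsub>D\<^esub>"] z by simp
  then have "\<ominus>\<^bsub>D\<^esub> \<one>\<^bsub>D\<^esub> = \<zero>\<^bsub>D\<^esub>"
    using h.B.smult_r_null[OF char0_field.recip_closed[OF K pos]] by simp
  then have "\<one>\<^bsub>D\<^esub> = \<zero>\<^bsub>D\<^esub>" using D.add.inv_eq_1_iff[of "\<one>\<^bsub>D\<^esub>"] by simp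
  then show False using D.one_not_zero by simp
qed

section \<open>Free actions\<close>

locale free_action = char0_field K + A: algebra K A + G: group G
  for K :: "('k, 'km) ring_scheme" and A :: "('k, 'a, 'am) module_scheme"
    and G :: "('g, 'gm) monoid_scheme" +
  fixes \<phi> :: "'g \<Rightarrow> 'a \<Rightarrow> 'a" and U :: "'g set"
  assumes action: "algebra_action K A G \<phi>" and free: "free_on_max_spec A G \<phi>"
    and U: "subgroup U G" "finite U"
begin

lemma U_G: "g \<in> U \<Longrightarrow> g \<in> carrier G"
  using U subgroup.subset by blast

lemma \<phi>_hom: "g \<in> carrier G \<Longrightarrow> \<phi> g \<in> alg_hom K A A"
  using action by (simp add: algebra_action_def)

lemma \<phi>_algebra_hom: "g \<in> carrier G \<Longrightarrow> algebra_hom K A A (\<phi> g)"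
  by (intro algebra_homI A.algebra_axioms \<phi>_hom)

lemma \<phi>_closed [simp]: "g \<in> carrier G \<Longrightarrow> a \<in> carrier A \<Longrightarrow> \<phi> g a \<in> carrier A"
  by (rule algebra_hom.closed[OF \<phi>_algebra_hom])

lemma group_action: "group_action G (carrier A) \<phi>"
  using action by (simp add: algebra_action_def)

lemma \<phi>_mult: "g \<in> carrier G \<Longrightarrow> h \<in> carrier G \<Longrightarrow> a \<in> carrier A \<Longrightarrow> \<phi> (g \<otimes>\<^bsub>G\<^esub> h) a = \<phi> g (\<phi> h a)"
  by (rule group_action.composition_rule[OF group_action])

lemma \<phi>_one: "a \<in> carrier A \<Longrightarrow> \<phi> \<one>\<^bsub>G\<^esub> a = a"
  using group_action.id_eq_one[OF group_action] by (metis restrict_apply')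

text \<open>Freeness on the maximal spectrum becomes an algebraic condition: the differences \<open>a - g a\<close> generate
  the unit ideal, because a maximal ideal containing all of them would be stable under \<open>g\<close>.
  Consequently \<open>G\<close> acts freely on the homomorphisms from \<open>A\<close> to any domain.\<close>

lemma one_in_difference_ideal:
  assumes g: "g \<in> carrier G" "g \<noteq> \<one>\<^bsub>G\<^esub>" and J: "ideal J A"
    and diff: "\<And>a. a \<in> carrier A \<Longrightarrow> a \<ominus>\<^bsub>A\<^esub> \<phi> g a \<in> J"
  shows "\<one>\<^bsub>A\<^esub> \<in> J"
proof (rule ccontr)
  assume "\<one>\<^bsub>A\<^esub> \<notin> J"
  then obtain M where M: "maximalideal M A" "J \<subseteq> M" using A.exists_maximal_ideal[OF J] by blast
  interpret M: maximalideal M A by fact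
  have mem: "\<phi> g a \<in> M \<longleftrightarrow> a \<in> M" if a: "a \<in> carrier A" for a
  proof -
    have d: "a \<ominus>\<^bsub>A\<^esub> \<phi> g a \<in> M" using diff[OF a] M by blast
    note c = a \<phi>_closed[OF g(1) a]
    have "a = (a \<ominus>\<^bsub>A\<^esub> \<phi> g a) \<oplus>\<^bsub>A\<^esub> \<phi> g a" "\<phi> g a = a \<oplus>\<^bsub>A\<^esub> (\<ominus>\<^bsub>A\<^esub> (a \<ominus>\<^bsub>A\<^esub> \<phi> g a))"
      using c by algebra+
    then show ?thesis using d M.a_closed M.a_inv_closed by metis
  qed
  have "\<phi> g ` M = M"
  proof
    show "\<phi> g ` M \<subseteq> M" using mem M.Icarr by blast
    show "M \<subseteq> \<phi> g ` M"
    proof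
      fix a assume a: "a \<in> M"
      let ?b = "\<phi> (inv\<^bsub>G\<^esub> g) a"
      have b: "?b \<in> carrier A" using g M.Icarr[OF a] by simp
      have "\<phi> g ?b = a" using g M.Icarr[OF a] by (simp add: \<phi>_one flip: \<phi>_mult)
      then show "a \<in> \<phi> g ` M" using mem[OF b] a by force
    qed
  qed
  then have "g \<in> stabilizer G (\<lambda>g N. \<phi> g ` N) M" using g by (simp add: stabilizer_def)
  moreover have "stabilizer G (\<lambda>g N. \<phi> g ` N) M = {\<one>\<^bsub>G\<^esub>}"
    using free M(1) by (auto simp: free_on_max_spec_def max_spec_def)
  ultimately show False using g by auto
qed

definition tr where "tr a = (\<Oplus>\<^bsub>A\<^esub>g\<in>U. \<phi> g a)"

lemma tr_closed [simp]: "a \<in> carrier A \<Longrightarrow> tr a \<in> carrier A"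
  unfolding tr_def by (intro A.M.finsum_closed) (auto simp: U_G)

lemma tr_shift:
  assumes h: "h \<in> U" and a: "a \<in> carrier A"
  shows "tr (\<phi> h a) = tr a"
proof -
  have "tr (\<phi> h a) = (\<Oplus>\<^bsub>A\<^esub>g\<in>U. \<phi> (g \<otimes>\<^bsub>G\<^esub> h) a)"
    unfolding tr_def using h a subgroup.m_closed[OF U(1)]
    by (intro A.M.finsum_cong') (auto simp: \<phi>_mult U_G)
  also have "\<dots> = (\<Oplus>\<^bsub>A\<^esub>g\<in>(\<lambda>g. g \<otimes>\<^bsub>G\<^esub> h) ` U. \<phi> g a)"
    using h a subgroup.m_closed[OF U(1)]
    by (intro A.M.finsum_reindex[symmetric]) (auto simp: U_G inj_on_def)
  also have "(\<lambda>g. g \<otimes>\<^bsub>G\<^esub> h) ` U = U"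
    using h subgroup.m_closed[OF U(1)] by (intro endo_inj_surj U(2)) (auto simp: U_G inj_on_def)
  finally show ?thesis by (simp add: tr_def)
qed

lemma shift_tr:
  assumes h: "h \<in> U" and a: "a \<in> carrier A"
  shows "\<phi> h (tr a) = tr a"
proof -
  interpret h: algebra_hom K A A "\<phi> h" by (rule \<phi>_algebra_hom[OF U_G[OF h]])
  have "\<phi> h (tr a) = (\<Oplus>\<^bsub>A\<^esub>g\<in>U. \<phi> (h \<otimes>\<^bsub>G\<^esub> g) a)"
    unfolding tr_def using h a subgroup.m_closed[OF U(1)]
    by (subst h.sum; (intro A.M.finsum_cong')?) (auto simp: \<phi>_mult U_G)
  also have "\<dots> = (\<Oplus>\<^bsub>A\<^esub>g\<in>(\<lambda>g. h \<otimes>\<^bsub>G\<^esub> g) ` U. \<phi> g a)"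
    using h a subgroup.m_closed[OF U(1)]
    by (intro A.M.finsum_reindex[symmetric]) (auto simp: U_G inj_on_def)
  also have "(\<lambda>g. h \<otimes>\<^bsub>G\<^esub> g) ` U = U"
    using h subgroup.m_closed[OF U(1)] by (intro endo_inj_surj U(2)) (auto simp: U_G inj_on_def)
  finally show ?thesis by (simp add: tr_def)
qed

text \<open>An invariant multiset of points is a union of orbits. The points are homomorphisms \<open>\<chi> l\<close> into a domain
  and invariance is expressed by their sum. Independence of characters finds all translates of a
  given \<open>\<chi> m\<close> in the family, freeness makes them pairwise distinct, and their sum is \<open>\<chi> m\<close> composed with
  the trace. Removing this orbit leaves a smaller family of the same kind.\<close>

lemma invariant_family_decomposition:
  fixes D :: "('k, 'd, 'dm) module_scheme" and \<chi> :: "'l \<Rightarrow> 'a \<Rightarrow> 'd"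
  assumes D: "domain D" and algD: "algebra K D" and L: "finite L"
    and hom: "\<And>l. l \<in> L \<Longrightarrow> \<chi> l \<in> alg_hom K A D"
    and inv: "\<And>g a. g \<in> U \<Longrightarrow> a \<in> carrier A \<Longrightarrow> (\<Oplus>\<^bsub>D\<^esub>l\<in>L. \<chi> l (\<phi> g a)) = (\<Oplus>\<^bsub>D\<^esub>l\<in>L. \<chi> l a)"
  shows "\<exists>r (\<psi> :: nat \<Rightarrow> 'a \<Rightarrow> 'd). card L = r * card U \<and> (\<forall>k<r. \<psi> k \<in> alg_hom K A D) \<and>
    (\<forall>a\<in>carrier A. (\<Oplus>\<^bsub>D\<^esub>l\<in>L. \<chi> l a) = (\<Oplus>\<^bsub>D\<^esub>k\<in>{..<r}. \<psi> k (tr a)))"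
proof -
  interpret D: domain D by fact
  interpret algD: algebra K D by fact
  have ah: "algebra_hom K A D u" if "u \<in> alg_hom K A D" for u
    by (intro algebra_homI A.algebra_axioms algD that)
  note closed = algebra_hom.closed[OF ah]
  show ?thesis
    using L hom inv
  proof (induction "card L" arbitrary: L rule: less_induct)
    case less
    note fin = less.prems(1) and hom = less.prems(2) and inv = less.prems(3)
    show ?case
    proof (cases "L = {}")
      case True
      then show ?thesis by (intro exI[of _ 0]) simp
    next
      case False
      then obtain m where m: "m \<in> L" by blast
      interpret m: algebra_hom K A D "\<chi> m" by (rule ah[OF hom[OF m]])
      have comp: "(\<lambda>a. \<chi> l (\<phi> g a)) \<in> alg_hom K A D" if "l \<in> L" "g \<in> U" for l g
        using alg_hom_comp[OF \<phi>_hom[OF U_G[OF that(2)]] hom[OF that(1)]] .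
      have "\<exists>l\<in>L. \<forall>a\<in>carrier A. \<chi> l a = \<chi> m (\<phi> g a)" if g: "g \<in> U" for g
        using fin hom inv[OF g] comp g m
        by (intro sum_of_characters_unique[OF char0_field_axioms D, of L L A \<chi> "\<lambda>l a. \<chi> l (\<phi> g a)" m])
           (auto simp: ah)
      then obtain s where s: "\<And>g. g \<in> U \<Longrightarrow> s g \<in> L" "\<And>g a. g \<in> U \<Longrightarrow> a \<in> carrier A \<Longrightarrow> \<chi> (s g) a = \<chi> m (\<phi> g a)"
        by metis
      have inj: "inj_on s U"
      proof (rule inj_onI, rule ccontr)
        fix g h assume g: "g \<in> U" and h: "h \<in> U" and eq: "s g = s h" and ne: "g \<noteq> h"
        let ?k = "g \<otimes>\<^bsub>G\<^esub> inv\<^bsub>G\<^esub> h"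
        have k: "?k \<in> carrier G" using g h by (simp add: U_G)
        have "?k \<noteq> \<one>\<^bsub>G\<^esub>" using g h ne G.inv_equality[of g "inv\<^bsub>G\<^esub> h"] by (auto simp: U_G)
        moreover have "ideal (a_kernel A D (\<chi> m)) A" by (rule m.ring.kernel_is_ideal)
        moreover have "b \<ominus>\<^bsub>A\<^esub> \<phi> ?k b \<in> a_kernel A D (\<chi> m)" if b: "b \<in> carrier A" for b
        proof -
          have hb: "\<phi> (inv\<^bsub>G\<^esub> h) b \<in> carrier A" using h b by (simp add: U_G)
          have "\<chi> m (\<phi> ?k b) = \<chi> m (\<phi> g (\<phi> (inv\<^bsub>G\<^esub> h) b))" using g h b by (simp add: \<phi>_mult U_G)
          also have "\<dots> = \<chi> m (\<phi> h (\<phi> (inv\<^bsub>G\<^esub> h) b))" using s(2)[OF g hb] s(2)[OF h hb] eq by simp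
          also have "\<dots> = \<chi> m b" using h b by (simp add: \<phi>_one U_G flip: \<phi>_mult)
          finally have "\<chi> m (b \<ominus>\<^bsub>A\<^esub> \<phi> ?k b) = \<zero>\<^bsub>D\<^esub>"
            using m.a_minus[OF b \<phi>_closed[OF k b]] m.closed[OF b] by (simp only: D.r_right_minus_eq)
          then show ?thesis
            using A.minus_closed[OF b \<phi>_closed[OF k b]] unfolding a_kernel_def' by blast
        qed
        ultimately have "\<one>\<^bsub>A\<^esub> \<in> a_kernel A D (\<chi> m)" using one_in_difference_ideal[OF k] by blast
        then show False unfolding a_kernel_def' using m.one D.one_not_zero by simp
      qed
      let ?L = "L - s ` U"
      have sub: "s ` U \<subseteq> L" using s by auto
      have orbit: "(\<Oplus>\<^bsub>D\<^esub>l\<in>s ` U. \<chi> l a) = \<chi> m (tr a)" if a: "a \<in> carrier A" for a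
      proof -
        have "(\<Oplus>\<^bsub>D\<^esub>l\<in>s ` U. \<chi> l a) = (\<Oplus>\<^bsub>D\<^esub>g\<in>U. \<chi> (s g) a)"
          using a s(1) closed[OF hom] by (intro D.finsum_reindex inj) auto
        also have "\<dots> = (\<Oplus>\<^bsub>D\<^esub>g\<in>U. \<chi> m (\<phi> g a))"
          using a s by (intro D.finsum_cong') (auto simp: U_G)
        also have "\<dots> = \<chi> m (tr a)" unfolding tr_def using a by (intro m.sum[symmetric]) (simp add: U_G)
        finally show ?thesis .
      qed
      have split: "(\<Oplus>\<^bsub>D\<^esub>l\<in>L. \<chi> l a) = (\<Oplus>\<^bsub>D\<^esub>l\<in>?L. \<chi> l a) \<oplus>\<^bsub>D\<^esub> \<chi> m (tr a)" if a: "a \<in> carrier A" for a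
      proof -
        have "L = ?L \<union> s ` U" using sub by auto
        then have "(\<Oplus>\<^bsub>D\<^esub>l\<in>L. \<chi> l a) = (\<Oplus>\<^bsub>D\<^esub>l\<in>?L \<union> s ` U. \<chi> l a)" by simp
        also have "\<dots> = (\<Oplus>\<^bsub>D\<^esub>l\<in>?L. \<chi> l a) \<oplus>\<^bsub>D\<^esub> (\<Oplus>\<^bsub>D\<^esub>l\<in>s ` U. \<chi> l a)"
          using fin U(2) a closed[OF hom] sub by (intro D.finsum_Un_disjoint) auto
        finally show ?thesis using orbit[OF a] by simp
      qed
      have cl: "(\<Oplus>\<^bsub>D\<^esub>l\<in>?L. \<chi> l a) \<in> carrier D" if "a \<in> carrier A" for a
        using that closed[OF hom] by (intro D.finsum_closed) auto
      have inv': "(\<Oplus>\<^bsub>D\<^esub>l\<in>?L. \<chi> l (\<phi> g a)) = (\<Oplus>\<^bsub>D\<^esub>l\<in>?L. \<chi> l a)" if g: "g \<in> U" and a: "a \<in> carrier A" for g a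
      proof -
        have ga: "\<phi> g a \<in> carrier A" using g a by (simp add: U_G)
        have "(\<Oplus>\<^bsub>D\<^esub>l\<in>?L. \<chi> l (\<phi> g a)) \<oplus>\<^bsub>D\<^esub> \<chi> m (tr a) = (\<Oplus>\<^bsub>D\<^esub>l\<in>?L. \<chi> l a) \<oplus>\<^bsub>D\<^esub> \<chi> m (tr a)"
          using split[OF ga] split[OF a] inv[OF g a] tr_shift[OF g a] by simp
        then show ?thesis using cl[OF a] cl[OF ga] a by simp
      qed
      have Une: "U \<noteq> {}" using subgroup.one_closed[OF U(1)] by blast
      have card: "card L = card ?L + card U"
        using card_Diff_subset[of "s ` U" L] card_mono[OF fin sub] sub U(2) inj by (simp add: card_image)
      have "card ?L < card L" using card Une U(2) by (simp add: card_gt_0_iff)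
      moreover have "finite ?L" "\<And>l. l \<in> ?L \<Longrightarrow> \<chi> l \<in> alg_hom K A D" using fin hom by auto
      ultimately obtain r and \<psi> :: "nat \<Rightarrow> 'a \<Rightarrow> 'd" where r': "card ?L = r * card U \<and> (\<forall>k<r. \<psi> k \<in> alg_hom K A D) \<and>
          (\<forall>a\<in>carrier A. (\<Oplus>\<^bsub>D\<^esub>l\<in>?L. \<chi> l a) = (\<Oplus>\<^bsub>D\<^esub>k\<in>{..<r}. \<psi> k (tr a)))"
        using less.hyps[of ?L] inv' by blast
      then have r: "card ?L = r * card U"
        "\<And>k. k < r \<Longrightarrow> \<psi> k \<in> alg_hom K A D"
        "\<And>a. a \<in> carrier A \<Longrightarrow> (\<Oplus>\<^bsub>D\<^esub>l\<in>?L. \<chi> l a) = (\<Oplus>\<^bsub>D\<^esub>k\<in>{..<r}. \<psi> k (tr a))"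
        by blast+
      define \<psi>' where "\<psi>' = \<psi>(r := \<chi> m)"
      have "(\<Oplus>\<^bsub>D\<^esub>l\<in>L. \<chi> l a) = (\<Oplus>\<^bsub>D\<^esub>k\<in>{..<Suc r}. \<psi>' k (tr a))" if a: "a \<in> carrier A" for a
      proof -
        have "(\<Oplus>\<^bsub>D\<^esub>k\<in>{..<Suc r}. \<psi>' k (tr a)) = \<psi>' r (tr a) \<oplus>\<^bsub>D\<^esub> (\<Oplus>\<^bsub>D\<^esub>k\<in>{..<r}. \<psi>' k (tr a))"
          unfolding lessThan_Suc using a r(2) closed
          by (intro D.finsum_insert) (auto simp: \<psi>'_def)
        also have "(\<Oplus>\<^bsub>D\<^esub>k\<in>{..<r}. \<psi>' k (tr a)) = (\<Oplus>\<^bsub>D\<^esub>k\<in>{..<r}. \<psi> k (tr a))"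
          using a r(2) closed by (intro D.finsum_cong') (auto simp: \<psi>'_def)
        finally show ?thesis
          using split[OF a] r(3)[OF a] cl[OF a] a by (simp add: \<psi>'_def D.a_comm)
      qed
      moreover have "card L = Suc r * card U" using card r(1) by simp
      moreover have "\<psi>' k \<in> alg_hom K A D" if "k < Suc r" for k
        using that r(2) hom[OF m] by (auto simp: \<psi>'_def less_Suc_eq)
      ultimately show ?thesis by blast
    qed
  qed
qed

end

section \<open>Coinvariants of a symmetric power\<close>

lemma (in abelian_monoid) finsum_blocks:
  fixes r m :: nat
  assumes "\<And>l. l < r * m \<Longrightarrow> f l \<in> carrier G"
  shows "finsum G f {..<r * m} = (\<Oplus>k\<in>{..<r}. \<Oplus>j\<in>{..<m}. f (k * m + j))"
  using assms
proof (induction r)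
  case (Suc r)
  have split: "{..<Suc r * m} = {..<r * m} \<union> (\<lambda>j. r * m + j) ` {..<m}"
  proof (intro equalityI subsetI)
    fix l assume l: "l \<in> {..<Suc r * m}"
    show "l \<in> {..<r * m} \<union> (\<lambda>j. r * m + j) ` {..<m}"
    proof (cases "l < r * m")
      case False
      then have "l = r * m + (l - r * m)" "l - r * m < m" using l by auto
      then show ?thesis by blast
    qed simp
  qed auto
  have f: "f (k * m + j) \<in> carrier G" if "k < Suc r" "j < m" for k j
  proof (rule Suc.prems)
    have "k * m + j < k * m + m" using that by simp
    also have "\<dots> = Suc k * m" by simp
    also have "\<dots> \<le> Suc r * m" using that by (intro mult_le_mono1) simp
    finally show "k * m + j < Suc r * m" .
  qed
  have blk: "(\<lambda>k. \<Oplus>j\<in>{..<m}. f (k * m + j)) \<in> {..<r} \<rightarrow> carrier G"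
    using f by (auto intro!: finsum_closed)
  have "finsum G f {..<Suc r * m} = finsum G f {..<r * m} \<oplus> finsum G f ((\<lambda>j. r * m + j) ` {..<m})"
    unfolding split using Suc.prems by (intro finsum_Un_disjoint) auto
  also have "finsum G f ((\<lambda>j. r * m + j) ` {..<m}) = (\<Oplus>j\<in>{..<m}. f (r * m + j))"
    using f by (intro finsum_reindex) auto
  also have "finsum G f {..<r * m} = (\<Oplus>k\<in>{..<r}. \<Oplus>j\<in>{..<m}. f (k * m + j))"
    using Suc by simp
  also have "(\<Oplus>k\<in>{..<r}. \<Oplus>j\<in>{..<m}. f (k * m + j)) \<oplus> (\<Oplus>j\<in>{..<m}. f (r * m + j)) =
      (\<Oplus>k\<in>{..<Suc r}. \<Oplus>j\<in>{..<m}. f (k * m + j))"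
  proof -
    have top: "(\<Oplus>j\<in>{..<m}. f (r * m + j)) \<in> carrier G"
      using f by (intro finsum_closed) auto
    then show ?thesis
      unfolding lessThan_Suc
      using finsum_insert[of "{..<r}" r "\<lambda>k. \<Oplus>j\<in>{..<m}. f (k * m + j)"] blk
        a_comm[OF finsum_closed[OF blk] top] by simp
  qed
  finally show ?case .
qed simp

locale sym_fold = free_action K A G \<phi> U
  for K :: "('k, 'km) ring_scheme" and A :: "('k, 'a, 'am) module_scheme"
    and G :: "('g, 'gm) monoid_scheme" and \<phi> U +
  fixes r :: nat
begin

abbreviation "m \<equiv> card U"
abbreviation "AU \<equiv> fixed_subalgebra A U \<phi>"

lemma m_pos: "m > 0"
  using U subgroup.one_closed[OF U(1)] by (auto simp: card_gt_0_iff)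

lemma AU_carrier: "a \<in> carrier AU \<longleftrightarrow> a \<in> carrier A \<and> (\<forall>g\<in>U. \<phi> g a = a)"
  by (simp add: fixed_subalgebra_def)

lemma AU_simps [simp]: "x \<otimes>\<^bsub>AU\<^esub> y = x \<otimes>\<^bsub>A\<^esub> y" "x \<oplus>\<^bsub>AU\<^esub> y = x \<oplus>\<^bsub>A\<^esub> y" "c \<odot>\<^bsub>AU\<^esub> x = c \<odot>\<^bsub>A\<^esub> x"
  "\<one>\<^bsub>AU\<^esub> = \<one>\<^bsub>A\<^esub>" "\<zero>\<^bsub>AU\<^esub> = \<zero>\<^bsub>A\<^esub>"
  by (simp_all add: fixed_subalgebra_def)

lemma AU_algebra: "algebra K AU"
proof -
  have "subalg K A {a \<in> carrier A. \<forall>g\<in>U. \<phi> g a = a}"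
    by (rule A.subalgI)
       (auto simp: U_G algebra_hom.mult[OF \<phi>_algebra_hom] algebra_hom.add[OF \<phi>_algebra_hom]
         algebra_hom.smult[OF \<phi>_algebra_hom] algebra_hom.one[OF \<phi>_algebra_hom])
  then show ?thesis unfolding fixed_subalgebra_def by (rule A.subalg_algebra)
qed

sublocale Tn: tensor_power_alg K A "r * m"
  by unfold_locales

sublocale Tr: tensor_power_alg K A r
  by unfold_locales

sublocale TU: tensor_power_alg K AU r
  by (intro tensor_power_alg.intro char0_field_axioms AU_algebra)

lemma tr_AU: "a \<in> carrier A \<Longrightarrow> tr a \<in> carrier AU"
  by (simp add: AU_carrier shift_tr)

lemma tr_of_AU: "b \<in> carrier AU \<Longrightarrow> tr b = [m] \<cdot>\<^bsub>A\<^esub> b"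
proof -
  assume b: "b \<in> carrier AU"
  then have "tr b = (\<Oplus>\<^bsub>A\<^esub>g\<in>U. b)"
    unfolding tr_def by (intro A.M.finsum_cong') (auto simp: AU_carrier)
  then show ?thesis using b by (simp add: A.M.add.finprod_const AU_carrier)
qed

lemma tr_smult: "c \<in> carrier K \<Longrightarrow> a \<in> carrier A \<Longrightarrow> tr (c \<odot>\<^bsub>A\<^esub> a) = c \<odot>\<^bsub>A\<^esub> tr a"
  unfolding tr_def
  by (subst A.finsum_smult_ldistr; (intro A.M.finsum_cong')?)
     (auto simp: U_G U(2) algebra_hom.smult[OF \<phi>_algebra_hom])

lemma tr_add: "a \<in> carrier A \<Longrightarrow> b \<in> carrier A \<Longrightarrow> tr (a \<oplus>\<^bsub>A\<^esub> b) = tr a \<oplus>\<^bsub>A\<^esub> tr b"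
  unfolding tr_def
  by (subst A.M.finsum_addf[symmetric]; (intro A.M.finsum_cong')?)
     (auto simp: U_G algebra_hom.add[OF \<phi>_algebra_hom])

lemma mean_of_AU: "b \<in> carrier AU \<Longrightarrow> recip K m \<odot>\<^bsub>A\<^esub> tr b = b"
  using m_pos char0_field_axioms by (simp add: tr_of_AU A.recip_smult AU_carrier)

text \<open>The positions are cut into \<open>r\<close> blocks of length \<open>m\<close>, and the entries of a block, each translated by a
  different element of \<open>U\<close>, are multiplied together. On points this sends a family of \<open>r\<close> points to the
  union of their orbits.\<close>

lemma fold_exists:
  "\<exists>\<theta>\<in>alg_hom K Tn.T Tr.T. \<forall>a\<in>carrier A. \<theta> (Tn.psum a) = Tr.psum (tr a)"
proof -
  obtain \<gamma> where \<gamma>: "bij_betw \<gamma> {..<m} U"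
    using ex_bij_betw_nat_finite[OF U(2)] by (auto simp: atLeast0LessThan)
  have \<gamma>G: "\<gamma> j \<in> carrier G" if "j < m" for j
    using \<gamma> that U_G by (auto simp: bij_betw_def)
  \<comment> \<open>Position \<open>l\<close> lies in the block \<open>l div m\<close>, at the place of the group element \<open>\<gamma> (l mod m)\<close>.\<close>
  define u where "u l a = Tr.\<iota> (l div m) (\<phi> (\<gamma> (l mod m)) a)" for l a
  have div: "l div m < r" if "l < r * m" for l
    using that m_pos by (simp add: less_mult_imp_div_less)
  have mod: "l mod m < m" for l using m_pos by simp
  have hom: "u l \<in> alg_hom K A Tr.T" if "l \<in> {..<r * m}" for l
    unfolding u_def using that div
    by (intro alg_hom_comp[OF \<phi>_hom[OF \<gamma>G[OF mod]] Tr.incl_hom]) auto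
  obtain \<theta> where "\<theta> \<in> alg_hom K Tn.T Tr.T"
    "\<forall>l\<in>{..<r * m}. \<forall>a\<in>carrier A. \<theta> (Tn.\<iota> l a) = u l a"
    using Tn.coproduct[where u = u, OF Tr.T.algebra_axioms hom] by blast
  then have \<theta>: "\<theta> \<in> alg_hom K Tn.T Tr.T"
    "\<And>l a. l < r * m \<Longrightarrow> a \<in> carrier A \<Longrightarrow> \<theta> (Tn.\<iota> l a) = u l a"
    by simp_all
  interpret \<theta>: algebra_hom K Tn.T Tr.T \<theta>
    by (intro algebra_homI Tn.T.algebra_axioms Tr.T.algebra_axioms \<theta>)
  have "\<theta> (Tn.psum a) = Tr.psum (tr a)" if a: "a \<in> carrier A" for a
  proof -
    have uc: "u l a \<in> carrier Tr.T" if "l < r * m" for l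
      using hom[of l] that a by (auto simp: alg_hom_def ring_hom_def)
    have "\<theta> (Tn.psum a) = finsum Tr.T (\<lambda>l. \<theta> (Tn.\<iota> l a)) {..<r * m}"
      unfolding Tn.psum_def using a by (intro \<theta>.sum) simp
    also have "\<dots> = finsum Tr.T (\<lambda>l. u l a) {..<r * m}"
      using a uc \<theta>(2) by (intro Tr.T.M.finsum_cong') simp_all
    also have "\<dots> = (\<Oplus>\<^bsub>Tr.T\<^esub>k\<in>{..<r}. \<Oplus>\<^bsub>Tr.T\<^esub>j\<in>{..<m}. u (k * m + j) a)"
      using uc by (rule Tr.T.M.finsum_blocks)
    also have "\<dots> = (\<Oplus>\<^bsub>Tr.T\<^esub>k\<in>{..<r}. Tr.\<iota> k (tr a))"
    proof (intro Tr.T.M.finsum_cong' refl)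
      fix k assume k: "k \<in> {..<r}"
      interpret k: algebra_hom K A Tr.T "Tr.\<iota> k" by (rule Tr.incl_algebra_hom[OF k])
      have "(\<Oplus>\<^bsub>Tr.T\<^esub>j\<in>{..<m}. u (k * m + j) a) = (\<Oplus>\<^bsub>Tr.T\<^esub>j\<in>{..<m}. Tr.\<iota> k (\<phi> (\<gamma> j) a))"
        using k a \<gamma>G by (intro Tr.T.M.finsum_cong') (simp_all add: u_def)
      also have "\<dots> = Tr.\<iota> k (\<Oplus>\<^bsub>A\<^esub>j\<in>{..<m}. \<phi> (\<gamma> j) a)"
        using a \<gamma>G by (intro k.sum[symmetric]) simp
      also have "(\<Oplus>\<^bsub>A\<^esub>j\<in>{..<m}. \<phi> (\<gamma> j) a) = (\<Oplus>\<^bsub>A\<^esub>g\<in>\<gamma> ` {..<m}. \<phi> g a)"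
        using a U_G \<gamma> by (intro A.M.finsum_reindex[symmetric]) (auto simp: bij_betw_def)
      also have "\<gamma> ` {..<m} = U" using \<gamma> by (simp add: bij_betw_def)
      finally show "(\<Oplus>\<^bsub>Tr.T\<^esub>j\<in>{..<m}. u (k * m + j) a) = Tr.\<iota> k (tr a)" by (simp add: tr_def)
    qed (use a in simp)
    finally show ?thesis by (simp add: Tr.psum_def)
  qed
  then show ?thesis using \<theta>(1) by blast
qed

text \<open>Averaging over \<open>U\<close> is a linear retraction of \<open>A\<close> onto its invariants, and the tensor power of this
  retraction is a left inverse of \<open>j\<close>.\<close>

lemma extend_scalars_injective:
  "\<exists>j\<in>alg_hom K TU.T Tr.T. (\<forall>b\<in>carrier AU. j (TU.psum b) = Tr.psum b) \<and> inj_on j (carrier TU.T)"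
proof -
  have hom: "Tr.\<iota> k \<in> alg_hom K AU Tr.T" if "k \<in> {..<r}" for k
  proof -
    interpret k: algebra_hom K A Tr.T "Tr.\<iota> k" by (rule Tr.incl_algebra_hom[OF that])
    show ?thesis by (rule alg_homI) (auto simp: AU_carrier)
  qed
  obtain j where "j \<in> alg_hom K TU.T Tr.T"
    "\<forall>k\<in>{..<r}. \<forall>b\<in>carrier AU. j (TU.\<iota> k b) = Tr.\<iota> k b"
    using TU.coproduct[where u = Tr.\<iota>, OF Tr.T.algebra_axioms hom] by blast
  then have j: "j \<in> alg_hom K TU.T Tr.T"
    "\<And>k b. k < r \<Longrightarrow> b \<in> carrier AU \<Longrightarrow> j (TU.\<iota> k b) = Tr.\<iota> k b"
    by simp_all
  interpret j: algebra_hom K TU.T Tr.T j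
    by (intro algebra_homI TU.T.algebra_axioms Tr.T.algebra_axioms j)
  have psum: "j (TU.psum b) = Tr.psum b" if b: "b \<in> carrier AU" for b
  proof -
    have bA: "b \<in> carrier A" using b by (simp add: AU_carrier)
    have "j (TU.psum b) = finsum Tr.T (\<lambda>k. j (TU.\<iota> k b)) {..<r}"
      unfolding TU.psum_def using b by (intro j.sum) simp
    also have "\<dots> = finsum Tr.T (\<lambda>k. Tr.\<iota> k b) {..<r}"
      using b bA j(2) by (intro Tr.T.M.finsum_cong') simp_all
    finally show ?thesis by (simp add: Tr.psum_def)
  qed
  define mean where "mean a = recip K m \<odot>\<^bsub>A\<^esub> tr a" for a
  have mean_closed: "mean a \<in> carrier AU" if "a \<in> carrier A" for a
    using TU.factor_smult[of _ "recip K m" "tr a"] that tr_AU[OF that] m_pos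
      module.smult_closed[of K AU "recip K m" "tr a"] AU_algebra
    by (simp add: mean_def algebra_def)
  have ml: "multilinear K {..<r} (\<lambda>_. A) TU.T (\<lambda>x. TU.p (\<lambda>l\<in>{..<r}. mean (x l)))"
  proof (rule multilinear_reindex[where \<tau> = "\<lambda>l. l" and h = "\<lambda>_. mean"])
    show "tensor_alg K {..<r} (\<lambda>_. A)" by (rule Tr.tensor_alg_axioms)
    show "tensor_alg K {..<r} (\<lambda>_. AU)" by (rule TU.tensor_alg_axioms)
    show "bij_betw (\<lambda>l. l) {..<r} {..<r}" by (simp add: bij_betw_def)
    have rc: "recip K m \<in> carrier K" using m_pos by simp
    show "mean (a \<oplus>\<^bsub>A\<^esub> b) = mean a \<oplus>\<^bsub>AU\<^esub> mean b" if "a \<in> carrier A" "b \<in> carrier A" for a b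
      using that rc by (simp add: mean_def tr_add A.smult_r_distr)
    show "mean (c \<odot>\<^bsub>A\<^esub> a) = c \<odot>\<^bsub>AU\<^esub> mean a" if "c \<in> carrier K" "a \<in> carrier A" for c a
      using that rc by (simp add: mean_def tr_smult m_comm flip: A.smult_assoc1)
  qed (rule mean_closed)
  define f where "f = (\<lambda>x. TU.p (\<lambda>l\<in>{..<r}. mean (x l)))"
  interpret L: tensor_lift K "{..<r}" "\<lambda>_. A" TU.T f
    by (intro tensor_lift.intro Tr.tensor_alg_axioms TU.T.algebra_axioms tensor_lift_axioms.intro)
       (unfold f_def, rule ml)
  have pure: "L.lift (j (TU.p x)) = TU.p x" if x: "x \<in> TU.families" for x
  proof -
    have xA: "x \<in> Tr.families" using x by (auto simp: PiE_iff AU_carrier)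
    have "j (TU.p x) = finprod Tr.T (\<lambda>k. j (TU.\<iota> k (x k))) {..<r}"
      unfolding TU.pure_eq_finprod[OF x] using x by (intro j.prod TU.incl_closed) auto
    also have "\<dots> = finprod Tr.T (\<lambda>k. Tr.\<iota> k (x k)) {..<r}"
      using x xA j(2) by (intro Tr.T.finprod_cong') (auto simp: PiE_iff)
    also have "\<dots> = Tr.p x" by (rule Tr.pure_eq_finprod[OF xA, symmetric])
    finally have "L.lift (j (TU.p x)) = f x" using xA by (simp add: L.lift_pure)
    also have "f x = TU.p (\<lambda>l\<in>{..<r}. mean (x l))" by (simp only: f_def)
    also have "(\<lambda>l\<in>{..<r}. mean (x l)) = x"
      using x by (auto simp: PiE_iff extensional_def mean_def mean_of_AU)
    finally show ?thesis .
  qed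
  have "L.lift (j t) = t" if "t \<in> carrier TU.T" for t
    using that
  proof (induction t rule: TU.T_induct)
    case zero
    show ?case by (simp only: j.hom_zero L.lift_zero)
  next
    case (step c x t)
    then show ?case by (simp add: L.lift_add L.lift_smult pure)
  qed
  then have "inj_on j (carrier TU.T)" by (rule inj_on_inverseI)
  then show ?thesis using j(1) psum by blast
qed

abbreviation "Sn \<equiv> sym_power K (r * m) A"
abbreviation "SU \<equiv> sym_power K r AU"
abbreviation "N \<equiv> coinvariant_ideal Sn U (diagonal_action K (r * m) A \<phi>)"

text \<open>The fold sends the power sum of \<open>a\<close> to the power sum of \<open>tr a\<close>, and \<open>tr a\<close> is invariant. As the
  symmetric tensors are generated by power sums, their images are symmetric tensors over the
  invariants; \<open>\<theta>'\<close> is the fold with this smaller target, \<open>\<theta>\<close> the fold on all tensors.\<close>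

lemma fold_Sym_exists:
  "\<exists>\<theta> \<theta>'. \<theta> \<in> alg_hom K Tn.T Tr.T \<and> (\<forall>a\<in>carrier A. \<theta> (Tn.psum a) = Tr.psum (tr a)) \<and>
     \<theta>' \<in> alg_hom K Sn SU \<and> (\<forall>a\<in>carrier A. \<theta>' (Tn.psum a) = TU.psum (tr a)) \<and>
     (\<forall>x\<in>Tn.Sym. \<theta>' x = \<zero>\<^bsub>TU.T\<^esub> \<longrightarrow> \<theta> x = \<zero>\<^bsub>Tr.T\<^esub>)"
proof -
  obtain \<theta> where \<theta>: "\<theta> \<in> alg_hom K Tn.T Tr.T" "\<And>a. a \<in> carrier A \<Longrightarrow> \<theta> (Tn.psum a) = Tr.psum (tr a)"
    using fold_exists by blast
  interpret \<theta>: algebra_hom K Tn.T Tr.T \<theta>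
    by (intro algebra_homI Tn.T.algebra_axioms Tr.T.algebra_axioms \<theta>)
  obtain j where j: "j \<in> alg_hom K TU.T Tr.T" "\<And>b. b \<in> carrier AU \<Longrightarrow> j (TU.psum b) = Tr.psum b"
    "inj_on j (carrier TU.T)"
    using extend_scalars_injective by blast
  interpret j: algebra_hom K TU.T Tr.T j
    by (intro algebra_homI TU.T.algebra_axioms Tr.T.algebra_axioms j)
  have "Tn.Sym \<subseteq> {t \<in> carrier Tn.T. \<theta> t \<in> j ` TU.Sym}"
  proof (rule Tn.power_sums_generate[OF \<theta>.subalg_vimage[OF j.subalg_image[OF TU.Sym_subalg]]])
    fix a assume a: "a \<in> carrier A"
    have "\<theta> (Tn.psum a) = j (TU.psum (tr a))" using a by (simp add: \<theta> j tr_AU)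
    then show "Tn.psum a \<in> {t \<in> carrier Tn.T. \<theta> t \<in> j ` TU.Sym}"
      using a TU.psum_Sym[OF tr_AU[OF a]] by auto
  qed
  then have ex: "\<exists>y\<in>TU.Sym. j y = \<theta> x" if "x \<in> Tn.Sym" for x using that by force
  define \<theta>' where "\<theta>' x = (SOME y. y \<in> TU.Sym \<and> j y = \<theta> x)" for x
  have \<theta>': "\<theta>' x \<in> TU.Sym \<and> j (\<theta>' x) = \<theta> x" if "x \<in> Tn.Sym" for x
    unfolding \<theta>'_def by (rule someI_ex[OF ex[OF that, unfolded Bex_def]])
  have eqI: "\<theta>' x = y" if "x \<in> Tn.Sym" "y \<in> carrier TU.T" "j y = \<theta> x" for x y
    using inj_onD[OF j(3), of "\<theta>' x" y] \<theta>'[OF that(1)] that(2,3) TU.Sym_closed by simp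
  have "\<theta>' \<in> alg_hom K Sn SU"
  proof (rule alg_homI)
    fix x assume "x \<in> carrier Sn"
    then have x: "x \<in> Tn.Sym" by (simp add: Tn.sym_power_eq)
    show "\<theta>' x \<in> carrier SU" using \<theta>'[OF x] by (simp add: TU.sym_power_eq)
    show "\<theta>' (c \<odot>\<^bsub>Sn\<^esub> x) = c \<odot>\<^bsub>SU\<^esub> \<theta>' x" if c: "c \<in> carrier K" for c
      using \<theta>'[OF x] c x Tn.T.subalg_smult[OF Tn.Sym_subalg c x]
      by (simp add: Tn.sym_power_eq TU.sym_power_eq, intro eqI)
         (simp_all add: TU.Sym_closed Tn.Sym_closed)
    fix y assume "y \<in> carrier Sn"
    then have y: "y \<in> Tn.Sym" by (simp add: Tn.sym_power_eq)
    show "\<theta>' (x \<otimes>\<^bsub>Sn\<^esub> y) = \<theta>' x \<otimes>\<^bsub>SU\<^esub> \<theta>' y"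
      using \<theta>'[OF x] \<theta>'[OF y] x y Tn.T.subalg_mult[OF Tn.Sym_subalg x y]
      by (simp add: Tn.sym_power_eq TU.sym_power_eq, intro eqI)
         (simp_all add: TU.Sym_closed Tn.Sym_closed)
    show "\<theta>' (x \<oplus>\<^bsub>Sn\<^esub> y) = \<theta>' x \<oplus>\<^bsub>SU\<^esub> \<theta>' y"
      using \<theta>'[OF x] \<theta>'[OF y] x y Tn.T.subalg_add[OF Tn.Sym_subalg x y]
      by (simp add: Tn.sym_power_eq TU.sym_power_eq, intro eqI)
         (simp_all add: TU.Sym_closed Tn.Sym_closed)
  next
    show "\<theta>' \<one>\<^bsub>Sn\<^esub> = \<one>\<^bsub>SU\<^esub>"
      using Tn.T.subalg_one[OF Tn.Sym_subalg]
      by (simp add: Tn.sym_power_eq TU.sym_power_eq, intro eqI) simp_all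
  qed
  moreover have "\<theta>' (Tn.psum a) = TU.psum (tr a)" if "a \<in> carrier A" for a
    using that by (intro eqI) (simp_all add: Tn.psum_Sym \<theta> j tr_AU)
  moreover have "\<theta> x = \<zero>\<^bsub>Tr.T\<^esub>" if "x \<in> Tn.Sym" "\<theta>' x = \<zero>\<^bsub>TU.T\<^esub>" for x
    using \<theta>'[OF that(1)] that(2) by auto
  ultimately show ?thesis using \<theta> by blast
qed

lemma diag_closed:
  "g \<in> U \<Longrightarrow> x \<in> Tn.Sym \<Longrightarrow> diagonal_action K (r * m) A \<phi> g x \<in> Tn.Sym"
  by (rule Tn.diagonal_Sym[OF \<phi>_hom[OF U_G]])

lemma Sn_algebra: "algebra K Sn"
  by (rule Tn.sym_power_algebra)

lemma Sn_minus: "x \<in> Tn.Sym \<Longrightarrow> y \<in> Tn.Sym \<Longrightarrow> x \<ominus>\<^bsub>Sn\<^esub> y = x \<ominus>\<^bsub>Tn.T\<^esub> y"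
proof -
  assume x: "x \<in> Tn.Sym" and y: "y \<in> Tn.Sym"
  interpret Sn: algebra K Sn by (rule Sn_algebra)
  interpret i: algebra_hom K Sn Tn.T "\<lambda>t. t" by (rule Tn.Sym_incl_hom)
  show ?thesis using i.a_minus[of x y] x y by (simp add: Tn.sym_power_eq)
qed

sublocale coinv: algebra_with_endos K Sn U "diagonal_action K (r * m) A \<phi>"
  by (intro algebra_with_endos.intro algebra_with_endos_axioms.intro Sn_algebra)
     (simp add: Tn.sym_power_eq diag_closed)

definition reynolds where "reynolds t = recip K (fact (r * m)) \<odot>\<^bsub>Tn.T\<^esub> Tn.symmetrize t"

lemma reynolds_Sym: "t \<in> carrier Tn.T \<Longrightarrow> reynolds t \<in> Tn.Sym"
  unfolding reynolds_def by (intro Tn.T.subalg_smult[OF Tn.Sym_subalg] Tn.symmetrize_Sym) auto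

lemma reynolds_add:
  "s \<in> carrier Tn.T \<Longrightarrow> t \<in> carrier Tn.T \<Longrightarrow> reynolds (s \<oplus>\<^bsub>Tn.T\<^esub> t) = reynolds s \<oplus>\<^bsub>Tn.T\<^esub> reynolds t"
  by (simp add: reynolds_def Tn.symmetrize_add Tn.T.smult_r_distr)

lemma reynolds_mult:
  "s \<in> Tn.Sym \<Longrightarrow> t \<in> carrier Tn.T \<Longrightarrow> reynolds (s \<otimes>\<^bsub>Tn.T\<^esub> t) = s \<otimes>\<^bsub>Tn.T\<^esub> reynolds t"
  using Tn.Sym_closed[of s]
  by (simp add: reynolds_def Tn.T.m_comm[of s] Tn.symmetrize_mult Tn.T.smult_assoc2)

lemma reynolds_of_Sym: "t \<in> Tn.Sym \<Longrightarrow> reynolds t = t"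
  using Tn.Sym_closed[of t] char0_field_axioms
  by (simp add: reynolds_def Tn.symmetrize_of_Sym Tn.T.recip_smult)

text \<open>The tensors all of whose multiples have their averages in \<open>J\<close> form an ideal. It meets the symmetric
  tensors in \<open>J\<close> because averaging is linear over the symmetric tensors and fixes them.\<close>

lemma ideal_lies_over:
  assumes J: "ideal J Sn"
  shows "\<exists>Q. ideal Q Tn.T \<and> Q \<inter> Tn.Sym = J"
proof -
  interpret Sn: algebra K Sn by (rule Sn_algebra)
  interpret J: ideal J Sn by fact
  have Sn: "carrier Sn = Tn.Sym" "monoid.mult Sn = monoid.mult Tn.T"
    "ring.add Sn = ring.add Tn.T" "ring.zero Sn = ring.zero Tn.T"
    by (simp_all add: Tn.sym_power_eq)
  have J_Sym: "s \<in> Tn.Sym" if "s \<in> J" for s using J.Icarr[OF that] by (simp add: Sn)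
  let ?Q = "{t \<in> carrier Tn.T. \<forall>u\<in>carrier Tn.T. reynolds (t \<otimes>\<^bsub>Tn.T\<^esub> u) \<in> J}"
  have zero: "\<zero>\<^bsub>Tn.T\<^esub> \<in> J" using J.zero_closed by (simp add: Sn)
  have J_add: "s \<oplus>\<^bsub>Tn.T\<^esub> t \<in> J" if "s \<in> J" "t \<in> J" for s t using J.a_closed[OF that] by (simp add: Sn)
  have J_mult: "s \<otimes>\<^bsub>Tn.T\<^esub> t \<in> J" if "s \<in> J" "t \<in> Tn.Sym" for s t
    using J.I_r_closed[of s t] that by (simp add: Sn)
  have minus_one: "\<ominus>\<^bsub>Tn.T\<^esub> \<one>\<^bsub>Tn.T\<^esub> \<in> Tn.Sym"
    by (rule Tn.T.subalg_a_inv[OF Tn.Sym_subalg Tn.T.subalg_one[OF Tn.Sym_subalg]])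
  have "ideal ?Q Tn.T"
  proof (rule idealI)
    show "ring Tn.T" by (rule Tn.T.ring_axioms)
    show "subgroup ?Q (add_monoid Tn.T)"
    proof (rule Tn.T.M.add.subgroupI)
      show "?Q \<noteq> {}"
        using zero reynolds_of_Sym[OF Tn.T.subalg_zero[OF Tn.Sym_subalg]]
        by (intro ex_in_conv[THEN iffD1] exI[of _ "\<zero>\<^bsub>Tn.T\<^esub>"]) simp
      show "\<ominus>\<^bsub>Tn.T\<^esub> s \<in> ?Q" if s: "s \<in> ?Q" for s
      proof -
        have "reynolds (\<ominus>\<^bsub>Tn.T\<^esub> s \<otimes>\<^bsub>Tn.T\<^esub> u) \<in> J" if u: "u \<in> carrier Tn.T" for u
        proof -
          have "\<ominus>\<^bsub>Tn.T\<^esub> s \<otimes>\<^bsub>Tn.T\<^esub> u = (\<ominus>\<^bsub>Tn.T\<^esub> \<one>\<^bsub>Tn.T\<^esub>) \<otimes>\<^bsub>Tn.T\<^esub> (s \<otimes>\<^bsub>Tn.T\<^esub> u)"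
            using s u by (simp add: Tn.T.l_minus)
          then have "reynolds (\<ominus>\<^bsub>Tn.T\<^esub> s \<otimes>\<^bsub>Tn.T\<^esub> u) = reynolds (s \<otimes>\<^bsub>Tn.T\<^esub> u) \<otimes>\<^bsub>Tn.T\<^esub> (\<ominus>\<^bsub>Tn.T\<^esub> \<one>\<^bsub>Tn.T\<^esub>)"
            using s u reynolds_mult[OF minus_one, of "s \<otimes>\<^bsub>Tn.T\<^esub> u"]
              Tn.Sym_closed[OF reynolds_Sym[of "s \<otimes>\<^bsub>Tn.T\<^esub> u"]]
            by (simp add: Tn.T.m_comm)
          then show ?thesis using s u J_mult[OF _ minus_one] by simp
        qed
        then show ?thesis using s by simp
      qed
      show "s \<oplus>\<^bsub>Tn.T\<^esub> t \<in> ?Q" if "s \<in> ?Q" "t \<in> ?Q" for s t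
        using that J_add by (simp add: Tn.T.l_distr reynolds_add)
    qed auto
    fix s t assume s: "s \<in> ?Q" and t: "t \<in> carrier Tn.T"
    show "s \<otimes>\<^bsub>Tn.T\<^esub> t \<in> ?Q" using s t by (simp add: Tn.T.m_assoc)
    then show "t \<otimes>\<^bsub>Tn.T\<^esub> s \<in> ?Q" using s t by (simp add: Tn.T.m_comm)
  qed
  moreover have "?Q \<inter> Tn.Sym = J"
  proof
    show "?Q \<inter> Tn.Sym \<subseteq> J"
    proof
      fix s assume s: "s \<in> ?Q \<inter> Tn.Sym"
      then have "reynolds (s \<otimes>\<^bsub>Tn.T\<^esub> \<one>\<^bsub>Tn.T\<^esub>) \<in> J" using Tn.T.one_closed by blast
      then show "s \<in> J" using s by (simp add: reynolds_of_Sym)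
    qed
    show "J \<subseteq> ?Q \<inter> Tn.Sym"
    proof
      fix s assume s: "s \<in> J"
      then show "s \<in> ?Q \<inter> Tn.Sym"
        using J_Sym[OF s] Tn.Sym_closed[OF J_Sym[OF s]] J_mult[OF s] reynolds_Sym
        by (simp add: reynolds_mult)
    qed
  qed
  ultimately show ?thesis by blast
qed

end

lemma quot_algebra_FactRing:
  "carrier (quot_algebra A N) = carrier (A Quot N)" "monoid.mult (quot_algebra A N) = monoid.mult (A Quot N)"
  "one (quot_algebra A N) = one (A Quot N)" "ring.zero (quot_algebra A N) = ring.zero (A Quot N)"
  by (simp_all add: quot_algebra_simps FactRing_def)

lemma quot_algebra_domain:
  assumes A: "algebra K A" and Q: "primeideal Q A"
  shows "domain (quot_algebra A Q)"
proof (intro domain.intro domain_axioms.intro)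
  note F = primeideal.quotient_is_domain[OF Q]
  have "algebra_ideal K A Q"
    using A Q by (intro algebra_ideal.intro) (simp_all add: primeideal_def)
  then show "cring (quot_algebra A Q)"
    by (intro algebra.M_cring algebra_ideal.quot_algebra_algebra)
  show "\<one>\<^bsub>quot_algebra A Q\<^esub> \<noteq> \<zero>\<^bsub>quot_algebra A Q\<^esub>"
    unfolding quot_algebra_FactRing by (rule domain.one_not_zero[OF F])
  show "a = \<zero>\<^bsub>quot_algebra A Q\<^esub> \<or> b = \<zero>\<^bsub>quot_algebra A Q\<^esub>"
    if "a \<otimes>\<^bsub>quot_algebra A Q\<^esub> b = \<zero>\<^bsub>quot_algebra A Q\<^esub>"
      "a \<in> carrier (quot_algebra A Q)" "b \<in> carrier (quot_algebra A Q)" for a b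
    using that unfolding quot_algebra_FactRing by (rule domain.integral[OF F])
qed

lemma exists_hom_into_domain:
  fixes A :: "('k, 'a, 'am) module_scheme"
  assumes A: "algebra K A" and N: "ideal N A" and x: "x \<in> carrier A" "\<And>k::nat. x [^]\<^bsub>A\<^esub> k \<notin> N"
  shows "\<exists>(D :: ('k, 'a set) module) q. domain D \<and> algebra K D \<and> q \<in> alg_hom K A D \<and>
    (\<forall>t\<in>N. q t = \<zero>\<^bsub>D\<^esub>) \<and> q x \<noteq> \<zero>\<^bsub>D\<^esub>"
proof -
  interpret A: algebra K A by fact
  obtain Q where Q: "primeideal Q A" "N \<subseteq> Q" "x \<notin> Q"
    using A.exists_prime_avoiding_powers[OF N x] by blast
  interpret Q: primeideal Q A by (rule Q(1))
  interpret QK: algebra_ideal K A Q by (intro algebra_ideal.intro A.algebra_axioms Q.is_ideal)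
  have "Q +>\<^bsub>A\<^esub> t = \<zero>\<^bsub>quot_algebra A Q\<^esub>" if "t \<in> N" for t
    using that Q(2) QK.coset_zero_iff[of t] Q.Icarr by blast
  moreover have "Q +>\<^bsub>A\<^esub> x \<noteq> \<zero>\<^bsub>quot_algebra A Q\<^esub>"
    using Q(3) QK.coset_zero_iff[OF x(1)] by blast
  ultimately show ?thesis
    using quot_algebra_domain[OF A Q(1)] QK.quot_algebra_algebra QK.coset_hom by blast
qed

context sym_fold
begin

lemma Sn_carrier: "carrier Sn = Tn.Sym"
  by (simp add: Tn.sym_power_eq)

lemma N_radical:
  assumes red: "reduced (coinvariants Sn U (diagonal_action K (r * m) A \<phi>))"
    and x: "x \<in> Tn.Sym" and k: "x [^]\<^bsub>Tn.T\<^esub> (k::nat) \<in> N"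
  shows "x \<in> N"
proof -
  interpret N: algebra_ideal K Sn N
    by (intro algebra_ideal.intro Sn_algebra coinv.coinv_ideal)
  interpret i: algebra_hom K Sn Tn.T "\<lambda>t. t" by (rule Tn.Sym_incl_hom)
  have xS: "x \<in> carrier Sn" using x by (simp add: Sn_carrier)
  have pow: "x [^]\<^bsub>Sn\<^esub> k = x [^]\<^bsub>Tn.T\<^esub> k" using i.hom_pow[OF xS, of k] .
  have c: "coinvariants Sn U (diagonal_action K (r * m) A \<phi>) = quot_algebra Sn N"
    by (simp add: coinvariants_def)
  have "(N +>\<^bsub>Sn\<^esub> x) [^]\<^bsub>quot_algebra Sn N\<^esub> k = N +>\<^bsub>Sn\<^esub> (x [^]\<^bsub>Sn\<^esub> k)"
    using N.coset.hom_pow[OF xS, of k] by simp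
  also have "\<dots> = \<zero>\<^bsub>quot_algebra Sn N\<^esub>"
    using N.coset_zero_iff[of "x [^]\<^bsub>Sn\<^esub> k"] xS k unfolding pow by (metis coinv.nat_pow_closed pow)
  finally have "N +>\<^bsub>Sn\<^esub> x = \<zero>\<^bsub>quot_algebra Sn N\<^esub>"
    using red N.coset.closed[OF xS] unfolding c reduced_def by blast
  then show ?thesis using N.coset_zero_iff[OF xS] by simp
qed

text \<open>On points: a function vanishing on all unions of \<open>r\<close> orbits vanishes on all invariant multisets. An
  element \<open>x\<close> outside the radical ideal \<open>N\<close> survives under some homomorphism \<open>q\<close> from the tensor power
  to a domain that kills \<open>N\<close>. The restrictions \<open>\<chi> l\<close> of \<open>q\<close> to the factors form a family with invariant
  sum, hence they come from \<open>r\<close> homomorphisms \<open>\<psi> k\<close>. These define \<open>\<Psi>\<close> on the \<open>r\<close>-fold tensor power, and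
  \<open>q\<close> agrees with \<open>\<Psi> \<circ> \<theta>\<close> on power sums, hence on all symmetric tensors.\<close>

lemma fold_kernel:
  assumes red: "reduced (coinvariants Sn U (diagonal_action K (r * m) A \<phi>))"
    and \<theta>: "\<theta> \<in> alg_hom K Tn.T Tr.T" "\<And>a. a \<in> carrier A \<Longrightarrow> \<theta> (Tn.psum a) = Tr.psum (tr a)"
    and x: "x \<in> Tn.Sym" "\<theta> x = \<zero>\<^bsub>Tr.T\<^esub>"
  shows "x \<in> N"
proof (rule ccontr)
  assume "x \<notin> N"
  then have notN: "x [^]\<^bsub>Tn.T\<^esub> (k::nat) \<notin> N" for k using N_radical[OF red x(1)] by blast
  obtain Q\<^sub>0 where Q\<^sub>0: "ideal Q\<^sub>0 Tn.T" "Q\<^sub>0 \<inter> Tn.Sym = N" using ideal_lies_over[OF coinv.coinv_ideal] by blast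
  interpret i: algebra_hom K Sn Tn.T "\<lambda>t. t" by (rule Tn.Sym_incl_hom)
  have xT: "x \<in> carrier Tn.T" using x Tn.Sym_closed by blast
  have xS: "x \<in> carrier Sn" using x by (simp add: Sn_carrier)
  have "x [^]\<^bsub>Tn.T\<^esub> (k::nat) \<in> Tn.Sym" for k
    using coinv.nat_pow_closed[OF xS, of k] i.hom_pow[OF xS, of k] Sn_carrier by simp
  then have "x [^]\<^bsub>Tn.T\<^esub> (k::nat) \<notin> Q\<^sub>0" for k using notN Q\<^sub>0 by blast
  then obtain D :: "('k, ((nat \<Rightarrow> 'a) \<Rightarrow> 'k) set set) module" and q
    where D: "domain D" "algebra K D" and q: "q \<in> alg_hom K Tn.T D"
      and q_zero: "\<And>t. t \<in> Q\<^sub>0 \<Longrightarrow> q t = \<zero>\<^bsub>D\<^esub>" and qx: "q x \<noteq> \<zero>\<^bsub>D\<^esub>"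
    using exists_hom_into_domain[OF Tn.T.algebra_axioms Q\<^sub>0(1) xT] by blast
  interpret q: algebra_hom K Tn.T D q
    by (intro algebra_homI Tn.T.algebra_axioms D(2) q)
  define \<chi> where "\<chi> l a = q (Tn.\<iota> l a)" for l a
  have \<chi>: "\<chi> l \<in> alg_hom K A D" if "l \<in> {..<r * m}" for l
    unfolding \<chi>_def[abs_def] by (rule alg_hom_comp[OF Tn.incl_hom[OF that] q.hom])
  have sum: "(\<Oplus>\<^bsub>D\<^esub>l\<in>{..<r * m}. \<chi> l a) = q (Tn.psum a)" if "a \<in> carrier A" for a
    unfolding Tn.psum_def \<chi>_def using that by (intro q.sum[symmetric]) simp
  have inv: "(\<Oplus>\<^bsub>D\<^esub>l\<in>{..<r * m}. \<chi> l (\<phi> g a)) = (\<Oplus>\<^bsub>D\<^esub>l\<in>{..<r * m}. \<chi> l a)"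
    if g: "g \<in> U" and a: "a \<in> carrier A" for g a
  proof -
    have ga: "\<phi> g a \<in> carrier A" using g a by (simp add: U_G)
    have "Tn.psum a \<ominus>\<^bsub>Sn\<^esub> diagonal_action K (r * m) A \<phi> g (Tn.psum a) \<in> N"
      using Tn.psum_Sym[OF a] by (intro coinv.coinv_mem g) (simp add: Sn_carrier)
    then have "Tn.psum a \<ominus>\<^bsub>Tn.T\<^esub> Tn.psum (\<phi> g a) \<in> N"
      using Tn.diagonal_psum[of \<phi> g, OF \<phi>_hom[OF U_G[OF g]] a] Tn.psum_Sym[OF a] Tn.psum_Sym[OF ga]
      by (simp add: Sn_minus)
    then have "q (Tn.psum a \<ominus>\<^bsub>Tn.T\<^esub> Tn.psum (\<phi> g a)) = \<zero>\<^bsub>D\<^esub>"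
      using Q\<^sub>0(2) q_zero by blast
    then have "q (Tn.psum a) \<ominus>\<^bsub>D\<^esub> q (Tn.psum (\<phi> g a)) = \<zero>\<^bsub>D\<^esub>"
      using q.a_minus[OF Tn.psum_closed[OF a] Tn.psum_closed[OF ga]] by simp
    then show ?thesis using a ga by (simp add: sum)
  qed
  obtain r' and \<psi> :: "nat \<Rightarrow> 'a \<Rightarrow> ((nat \<Rightarrow> 'a) \<Rightarrow> 'k) set set"
    where card: "card {..<r * m} = r' * card U" and \<psi>: "\<forall>k<r'. \<psi> k \<in> alg_hom K A D"
      and dec: "\<forall>a\<in>carrier A. (\<Oplus>\<^bsub>D\<^esub>l\<in>{..<r * m}. \<chi> l a) = (\<Oplus>\<^bsub>D\<^esub>k\<in>{..<r'}. \<psi> k (tr a))"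
    using invariant_family_decomposition[OF D(1) q.B.algebra_axioms finite_lessThan \<chi> inv] by blast
  have r': "r' = r" using card m_pos by simp
  have \<psi>': "\<psi> k \<in> alg_hom K A D" if "k \<in> {..<r}" for k using \<psi> that r' by simp
  obtain \<Psi> where \<Psi>: "\<Psi> \<in> alg_hom K Tr.T D" "\<forall>k\<in>{..<r}. \<forall>a\<in>carrier A. \<Psi> (Tr.\<iota> k a) = \<psi> k a"
    using Tr.coproduct[where u = \<psi>, OF q.B.algebra_axioms \<psi>'] by blast
  interpret \<Psi>: algebra_hom K Tr.T D \<Psi>
    by (intro algebra_homI Tr.T.algebra_axioms q.B.algebra_axioms \<Psi>(1))
  have "\<Psi> (\<theta> x) = q x"
  proof (rule Tn.Sym_hom_ext[where u = "\<lambda>t. \<Psi> (\<theta> t)" and v = q and C = D])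
    show "algebra_hom K Sn D (\<lambda>t. \<Psi> (\<theta> t))"
      using alg_hom_comp[OF alg_hom_comp[OF i.hom \<theta>(1)] \<Psi>(1)]
      by (intro algebra_homI Sn_algebra q.B.algebra_axioms)
    show "algebra_hom K Sn D q"
      using alg_hom_comp[OF i.hom q.hom]
      by (intro algebra_homI Sn_algebra q.B.algebra_axioms)
    fix a assume a: "a \<in> carrier A"
    have "\<Psi> (\<theta> (Tn.psum a)) = \<Psi> (Tr.psum (tr a))" using \<theta>(2)[OF a] by simp
    also have "\<dots> = (\<Oplus>\<^bsub>D\<^esub>k\<in>{..<r}. \<Psi> (Tr.\<iota> k (tr a)))"
      unfolding Tr.psum_def using a by (intro \<Psi>.sum) simp
    also have "\<dots> = (\<Oplus>\<^bsub>D\<^esub>k\<in>{..<r}. \<psi> k (tr a))"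
      using a \<Psi>(2) by (intro q.B.M.finsum_cong') (simp_all add: alg_hom_closed[OF \<psi>'])
    also have "\<dots> = q (Tn.psum a)" using dec a r' sum[OF a] by simp
    finally show "\<Psi> (\<theta> (Tn.psum a)) = q (Tn.psum a)" .
  qed (rule x(1))
  then have "q x = \<zero>\<^bsub>D\<^esub>" using x(2) by simp
  then show False using qx by simp
qed

text \<open>The fold induces \<open>(S\<^bsup>rm\<^esup>A)\<^sub>U \<cong> S\<^bsup>r\<^esup>(A\<^bsup>U\<^esup>)\<close>. It is onto because in characteristic zero each invariant
  is a trace, so that all power sums over \<open>A\<^bsup>U\<^esup>\<close> are hit.\<close>

theorem sym_power_coinvariants:
  assumes red: "reduced (coinvariants Sn U (diagonal_action K (r * m) A \<phi>))"
  shows "\<exists>\<theta>\<in>alg_hom K Sn SU. \<theta> ` carrier Sn = carrier SU \<and>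
    (\<forall>x\<in>carrier Sn. \<theta> x = \<zero>\<^bsub>SU\<^esub> \<longleftrightarrow> x \<in> N)"
proof -
  obtain \<theta> \<theta>' where F: "\<theta> \<in> alg_hom K Tn.T Tr.T \<and> (\<forall>a\<in>carrier A. \<theta> (Tn.psum a) = Tr.psum (tr a)) \<and>
     \<theta>' \<in> alg_hom K Sn SU \<and> (\<forall>a\<in>carrier A. \<theta>' (Tn.psum a) = TU.psum (tr a)) \<and>
     (\<forall>x\<in>Tn.Sym. \<theta>' x = \<zero>\<^bsub>TU.T\<^esub> \<longrightarrow> \<theta> x = \<zero>\<^bsub>Tr.T\<^esub>)"
    using fold_Sym_exists by (elim exE)
  note \<theta> = F[THEN conjunct1] F[THEN conjunct2, THEN conjunct1, rule_format]
  note F' = F[THEN conjunct2, THEN conjunct2]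
  note \<theta>' = F'[THEN conjunct1] F'[THEN conjunct2, THEN conjunct1, rule_format]
  note ker = F'[THEN conjunct2, THEN conjunct2, rule_format]
  have SU_zero: "\<zero>\<^bsub>SU\<^esub> = \<zero>\<^bsub>TU.T\<^esub>" by (simp add: TU.sym_power_eq)
  interpret \<theta>': algebra_hom K Sn SU \<theta>'
    by (intro algebra_homI Sn_algebra TU.sym_power_algebra \<theta>')
  interpret i: algebra_hom K SU TU.T "\<lambda>t. t" by (rule TU.Sym_incl_hom)
  have "subalg K TU.T (\<theta>' ` carrier Sn)"
    using i.subalg_image[OF \<theta>'.subalg_image[OF coinv.subalg_carrier_self]] by simp
  moreover have "TU.psum b \<in> \<theta>' ` carrier Sn" if b: "b \<in> carrier AU" for b
  proof -
    let ?a = "recip K m \<odot>\<^bsub>A\<^esub> b"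
    have bA: "b \<in> carrier A" using b by (simp add: AU_carrier)
    have rc: "recip K m \<in> carrier K" using m_pos by simp
    have a: "?a \<in> carrier A" using bA rc by simp
    have "tr ?a = b" using mean_of_AU[OF b] bA rc by (simp add: tr_smult)
    then have "TU.psum b = \<theta>' (Tn.psum ?a)" using \<theta>'(2)[OF a] by simp
    moreover have "Tn.psum ?a \<in> carrier Sn" unfolding Sn_carrier by (rule Tn.psum_Sym[OF a])
    ultimately show ?thesis by (rule image_eqI)
  qed
  ultimately have "TU.Sym \<subseteq> \<theta>' ` carrier Sn" by (rule TU.power_sums_generate)
  moreover have "carrier SU = TU.Sym" by (simp add: TU.sym_power_eq)
  ultimately have surj: "\<theta>' ` carrier Sn = carrier SU" using \<theta>'.closed by (intro equalityI image_subsetI) simp_all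
  have N: "\<theta>' x = \<zero>\<^bsub>SU\<^esub>" if "x \<in> N" for x
  proof (rule coinv.coinv_vanish[OF \<theta>'.algebra_hom_axioms _ that])
    fix b g assume b: "b \<in> carrier Sn" and g: "g \<in> U"
    let ?d = "diagonal_action K (r * m) A \<phi> g"
    have d: "?d \<in> alg_hom K Sn Sn" by (rule Tn.diagonal_Sym_hom[of \<phi> g, OF \<phi>_hom[OF U_G[OF g]]])
    show "\<theta>' (?d b) = \<theta>' b"
    proof (rule Tn.Sym_hom_ext[where u = "\<lambda>t. \<theta>' (?d t)" and v = \<theta>' and C = SU])
      show "algebra_hom K Sn SU (\<lambda>t. \<theta>' (?d t))"
        by (intro algebra_homI Sn_algebra TU.sym_power_algebra alg_hom_comp[OF d \<theta>'(1)])
      fix a assume a: "a \<in> carrier A"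
      have ga: "\<phi> g a \<in> carrier A" using g a by (simp add: U_G)
      show "\<theta>' (?d (Tn.psum a)) = \<theta>' (Tn.psum a)"
        using \<theta>'(2)[OF a] \<theta>'(2)[OF ga] tr_shift[OF g a]
          Tn.diagonal_psum[of \<phi> g, OF \<phi>_hom[OF U_G[OF g]] a] by simp
    qed (use b in \<open>simp_all add: \<theta>'.algebra_hom_axioms Sn_carrier\<close>)
  qed
  have K: "x \<in> N" if x: "x \<in> carrier Sn" and z: "\<theta>' x = \<zero>\<^bsub>SU\<^esub>" for x
  proof -
    have xS: "x \<in> Tn.Sym" using x unfolding Sn_carrier .
    show ?thesis by (rule fold_kernel[OF red \<theta> xS ker[OF xS z[unfolded SU_zero]]])
  qed
  show ?thesis
    by (intro bexI[OF _ \<theta>'(1)] conjI surj ballI iffI) (erule K, assumption, erule N)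
qed

end

section \<open>Gluing the coinvariants along the orbits\<close>

text \<open>The factors along an orbit, and the maps on them, are required to be equal and not just isomorphic:
  in the application they depend only on the exponent \<open>r\<^sub>i |\<Gamma>\<^sub>i|\<close>, which is constant on orbits.\<close>

locale orbit_tensor = tensor_alg K I B + G: group G
  for K :: "('k, 'km) ring_scheme" and I :: "'i set" and B :: "'i \<Rightarrow> ('k, 'b, 'bm) module_scheme"
    and G :: "('g, 'gm) monoid_scheme" +
  fixes \<tau> :: "'g \<Rightarrow> 'i \<Rightarrow> 'i" and J :: "'i set" and d :: "'i \<Rightarrow> 'g \<Rightarrow> 'b \<Rightarrow> 'b"
  assumes action: "group_action G I \<tau>"
    and transversal: "orbit_transversal G I \<tau> J"
    and B_orbit: "g \<in> carrier G \<Longrightarrow> i \<in> I \<Longrightarrow> B (\<tau> g i) = B i"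
    and d_orbit: "g \<in> carrier G \<Longrightarrow> i \<in> I \<Longrightarrow> d (\<tau> g i) = d i"
    and d_hom: "g \<in> carrier G \<Longrightarrow> i \<in> I \<Longrightarrow> d i g \<in> alg_hom K (B i) (B i)"
    and d_mult: "g \<in> carrier G \<Longrightarrow> h \<in> carrier G \<Longrightarrow> i \<in> I \<Longrightarrow> b \<in> carrier (B i) \<Longrightarrow>
      d i (g \<otimes>\<^bsub>G\<^esub> h) b = d i g (d i h b)"
    and d_one: "i \<in> I \<Longrightarrow> b \<in> carrier (B i) \<Longrightarrow> d i \<one>\<^bsub>G\<^esub> b = b"
begin

lemma d_closed: "g \<in> carrier G \<Longrightarrow> i \<in> I \<Longrightarrow> b \<in> carrier (B i) \<Longrightarrow> d i g b \<in> carrier (B i)"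
  by (rule alg_hom_closed[OF d_hom])

lemma \<tau>_closed: "g \<in> carrier G \<Longrightarrow> i \<in> I \<Longrightarrow> \<tau> g i \<in> I"
  using group_action.element_image[OF action] by blast

lemma \<tau>_mult: "g \<in> carrier G \<Longrightarrow> h \<in> carrier G \<Longrightarrow> i \<in> I \<Longrightarrow> \<tau> (g \<otimes>\<^bsub>G\<^esub> h) i = \<tau> g (\<tau> h i)"
  by (rule group_action.composition_rule[OF action])

lemma \<tau>_one: "i \<in> I \<Longrightarrow> \<tau> \<one>\<^bsub>G\<^esub> i = i"
  using group_action.id_eq_one[OF action] by (metis restrict_apply')

lemma \<tau>_inv: "g \<in> carrier G \<Longrightarrow> i \<in> I \<Longrightarrow> \<tau> (inv\<^bsub>G\<^esub> g) (\<tau> g i) = i"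
  by (simp add: \<tau>_one flip: \<tau>_mult)

lemma J_I: "j \<in> J \<Longrightarrow> j \<in> I"
  using transversal by (auto simp: orbit_transversal_def)

lemma J_unique: "j \<in> J \<Longrightarrow> g \<in> carrier G \<Longrightarrow> \<tau> g j \<in> J \<Longrightarrow> \<tau> g j = j"
proof -
  assume j: "j \<in> J" and g: "g \<in> carrier G" and gj: "\<tau> g j \<in> J"
  have "orbit G \<tau> j \<in> orbits G I \<tau>" using J_I[OF j] by (auto simp: orbits_def)
  moreover have "\<tau> g j \<in> orbit G \<tau> j" using g by (auto simp: orbit_def)
  moreover have "j \<in> orbit G \<tau> j" using group_action.orbit_refl[OF action J_I[OF j]] .
  ultimately show ?thesis using transversal j gj unfolding orbit_transversal_def by blast
qed

lemma J_exists: "i \<in> I \<Longrightarrow> \<exists>j\<in>J. \<exists>g\<in>carrier G. \<tau> g j = i"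
proof -
  assume i: "i \<in> I"
  have "orbit G \<tau> i \<in> orbits G I \<tau>" using i by (auto simp: orbits_def)
  then obtain j where j: "j \<in> J" "j \<in> orbit G \<tau> i" using transversal by (auto simp: orbit_transversal_def)
  then obtain g where g: "g \<in> carrier G" "\<tau> g i = j" by (auto simp: orbit_def)
  then have "\<tau> (inv\<^bsub>G\<^esub> g) j = i" using \<tau>_inv[OF g(1) i] by simp
  then show ?thesis using j g by blast
qed

definition act where
  "act g = tensor_map K I B (\<lambda>x. \<lambda>i\<in>I. d i g (x (\<tau> (inv\<^bsub>G\<^esub> g) i)))"

lemma \<tau>_bij: "g \<in> carrier G \<Longrightarrow> bij_betw (\<tau> g) I I"
  using group_action.inj_prop[OF action] group_action.surj_prop[OF action] by (simp add: bij_betw_def)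

lemma act_hom: "g \<in> carrier G \<Longrightarrow> algebra_hom K T T (act g)"
  unfolding act_def
  by (intro algebra_homI T.algebra_axioms tensor_map_reindex(1) \<tau>_bij)
     (simp_all add: B_orbit d_hom)

lemma act_incl:
  assumes g: "g \<in> carrier G" and i: "i \<in> I" and b: "b \<in> carrier (B i)"
  shows "act g (\<iota> i b) = \<iota> (\<tau> g i) (d i g b)"
proof -
  have "act g (\<iota> (\<tau> (inv\<^bsub>G\<^esub> g) (\<tau> g i)) b) = \<iota> (\<tau> g i) (d (\<tau> g i) g b)"
    unfolding act_def
    by (rule tensor_map_incl[OF \<tau>_bij])
       (use g i b in \<open>simp_all add: B_orbit d_hom \<tau>_closed \<tau>_inv\<close>)
  then show ?thesis using g i by (simp add: \<tau>_inv d_orbit)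
qed

abbreviation "N \<equiv> coinvariant_ideal T (carrier G) act"

sublocale algebra_with_endos K T "carrier G" act
  by (intro algebra_with_endos.intro T.algebra_axioms algebra_with_endos_axioms.intro algebra_hom.closed[OF act_hom])

sublocale N: algebra_ideal K T N
  by (intro algebra_ideal.intro T.algebra_axioms coinv_ideal)

lemma coinvariants_eq: "coinvariants T (carrier G) act = quot_algebra T N"
  by (simp add: coinvariants_def)

abbreviation "cl \<equiv> (\<lambda>t. N +>\<^bsub>T\<^esub> t)"

lemma cl_act: "g \<in> carrier G \<Longrightarrow> t \<in> carrier T \<Longrightarrow> cl (act g t) = cl t"
  using N.coset_eq_iff[of t "act g t"] coinv_mem[of t g] algebra_hom.closed[OF act_hom] by simp

text \<open>Coinvariants identify a factor with its translates, so that one factor of each orbit is left, with its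
  own coinvariants under the stabilizer. The homomorphism \<open>\<Psi>\<close> carries each factor back to the chosen
  representative of its orbit and applies \<open>\<theta>\<close>; it is invariant because two group elements doing this
  differ by an element of the stabilizer. In the other direction \<open>\<Phi>\<close> is induced by lifting along \<open>\<theta>\<close>
  and including into the big tensor product. Both composites are checked on single factors.\<close>

theorem coinvariants_tensor_product:
  assumes C: "\<And>j. j \<in> J \<Longrightarrow> algebra K (C j)"
    and \<theta>: "\<And>j. j \<in> J \<Longrightarrow> \<theta> j \<in> alg_hom K (B j) (C j)"
    and surj: "\<And>j. j \<in> J \<Longrightarrow> \<theta> j ` carrier (B j) = carrier (C j)"
    and ker: "\<And>j b. j \<in> J \<Longrightarrow> b \<in> carrier (B j) \<Longrightarrow>
      \<theta> j b = \<zero>\<^bsub>C j\<^esub> \<longleftrightarrow> b \<in> coinvariant_ideal (B j) (stabilizer G \<tau> j) (d j)"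
  shows "alg_isomorphic K (tensor_product K J C) (coinvariants T (carrier G) act)"
proof -
  interpret C: tensor_alg K J C
    by (intro tensor_alg.intro K_cring C) (use finite_index finite_subset[of J I] J_I in auto)
  have \<theta>_hom: "algebra_hom K (B j) (C j) (\<theta> j)" if "j \<in> J" for j
    by (intro algebra_homI factor_algebra J_I C \<theta> that)
  have stab: "h \<in> carrier G" "\<tau> h j = j" if "h \<in> stabilizer G \<tau> j" for h j
    using that by (auto simp: stabilizer_def)
  have coinvB: "algebra_with_endos K (B j) (stabilizer G \<tau> j) (d j)" if "j \<in> J" for j
    by (intro algebra_with_endos.intro algebra_with_endos_axioms.intro factor_algebra J_I that) (rule d_closed[OF stab(1) J_I[OF that]])
  have \<theta>_inv: "\<theta> j (d j h b) = \<theta> j b" if j: "j \<in> J" and h: "h \<in> stabilizer G \<tau> j" and b: "b \<in> carrier (B j)" for j h b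
  proof -
    interpret t: algebra_hom K "B j" "C j" "\<theta> j" by (rule \<theta>_hom[OF j])
    have db: "d j h b \<in> carrier (B j)" using d_closed[OF stab(1)[OF h] J_I[OF j] b] .
    have "\<theta> j (b \<ominus>\<^bsub>B j\<^esub> d j h b) = \<zero>\<^bsub>C j\<^esub>"
      using ker[OF j t.A.minus_closed[OF b db]] algebra_with_endos.coinv_mem[OF coinvB[OF j] b h] by blast
    then show ?thesis using t.eq_if_diff_zero[OF b db] by simp
  qed
  obtain rp sg where rp: "\<And>i. i \<in> I \<Longrightarrow> rp i \<in> J" "\<And>i. i \<in> I \<Longrightarrow> sg i \<in> carrier G"
    "\<And>i. i \<in> I \<Longrightarrow> \<tau> (sg i) (rp i) = i"
    using J_exists by metis
  have rpI: "rp i \<in> I" if "i \<in> I" for i using rp(1) J_I that by blast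
  have B_rp: "B (rp i) = B i" "d (rp i) = d i" if "i \<in> I" for i
    using B_orbit[of "sg i" "rp i"] d_orbit[of "sg i" "rp i"] rp that rpI by auto
  have rp_orbit: "rp (\<tau> g i) = rp i" if g: "g \<in> carrier G" and i: "i \<in> I" for g i
  proof -
    have gi: "\<tau> g i \<in> I" using \<tau>_closed g i .
    let ?k = "inv\<^bsub>G\<^esub> (sg (\<tau> g i)) \<otimes>\<^bsub>G\<^esub> (g \<otimes>\<^bsub>G\<^esub> sg i)"
    have "\<tau> ?k (rp i) = \<tau> (inv\<^bsub>G\<^esub> (sg (\<tau> g i))) (\<tau> g i)"
      using g i gi rp rpI by (simp add: \<tau>_mult)
    also have "\<dots> = \<tau> (inv\<^bsub>G\<^esub> (sg (\<tau> g i))) (\<tau> (sg (\<tau> g i)) (rp (\<tau> g i)))" using rp(3)[OF gi] by simp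
    also have "\<dots> = rp (\<tau> g i)" using \<tau>_inv rp(2)[OF gi] rpI[OF gi] by blast
    finally have k: "\<tau> ?k (rp i) = rp (\<tau> g i)" .
    have "?k \<in> carrier G" using g rp(2)[OF i] rp(2)[OF gi] by simp
    then show ?thesis using J_unique[OF rp(1)[OF i], of ?k] k rp(1)[OF gi] by simp
  qed
  \<comment> \<open>\<open>sg i\<close> moves the representative \<open>rp i\<close> to \<open>i\<close>.\<close>
  define u where "u i b = C.\<iota> (rp i) (\<theta> (rp i) (d i (inv\<^bsub>G\<^esub> (sg i)) b))" for i b
  have u: "u i \<in> alg_hom K (B i) C.T" if i: "i \<in> I" for i
  proof -
    have "\<theta> (rp i) \<in> alg_hom K (B i) (C (rp i))" using \<theta>[OF rp(1)[OF i]] B_rp[OF i] by simp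
    then show ?thesis
      unfolding u_def[abs_def] using i rp
      by (intro alg_hom_comp[OF alg_hom_comp[OF d_hom _] C.incl_hom]) simp_all
  qed
  obtain \<Psi> where \<Psi>: "\<Psi> \<in> alg_hom K T C.T" "\<And>i b. i \<in> I \<Longrightarrow> b \<in> carrier (B i) \<Longrightarrow> \<Psi> (\<iota> i b) = u i b"
    using coproduct[where u = u, OF C.T.algebra_axioms u] by blast
  interpret \<Psi>: algebra_hom K T C.T \<Psi>
    by (intro algebra_homI T.algebra_axioms C.T.algebra_axioms \<Psi>(1))
  have u_act: "u (\<tau> g i) (d i g b) = u i b" if g: "g \<in> carrier G" and i: "i \<in> I" and b: "b \<in> carrier (B i)" for g i b
  proof -
    have gi: "\<tau> g i \<in> I" using \<tau>_closed g i .
    let ?s = "sg i" and ?t = "sg (\<tau> g i)" and ?j = "rp i"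
    have s: "?s \<in> carrier G" "?t \<in> carrier G" using rp i gi by auto
    let ?h = "inv\<^bsub>G\<^esub> ?t \<otimes>\<^bsub>G\<^esub> (g \<otimes>\<^bsub>G\<^esub> ?s)"
    have h: "?h \<in> carrier G" using s g by simp
    have "\<tau> ?h ?j = \<tau> (inv\<^bsub>G\<^esub> ?t) (\<tau> g i)"
      using g i gi rp rpI s by (simp add: \<tau>_mult)
    also have "\<dots> = \<tau> (inv\<^bsub>G\<^esub> ?t) (\<tau> ?t (rp (\<tau> g i)))" using rp(3)[OF gi] by simp
    also have "\<dots> = ?j" using \<tau>_inv[OF s(2) rpI[OF gi]] rp_orbit[OF g i] by simp
    finally have hs: "?h \<in> stabilizer G \<tau> ?j" using h by (simp add: stabilizer_def)
    let ?b = "d i (inv\<^bsub>G\<^esub> ?s) b"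
    have b': "?b \<in> carrier (B i)" using d_closed s i b by simp
    have "?h \<otimes>\<^bsub>G\<^esub> inv\<^bsub>G\<^esub> ?s = inv\<^bsub>G\<^esub> ?t \<otimes>\<^bsub>G\<^esub> g" using s g by (simp add: G.m_assoc)
    then have "d i (inv\<^bsub>G\<^esub> ?t) (d i g b) = d i ?h ?b"
      using d_mult[of "inv\<^bsub>G\<^esub> ?t" g i b] d_mult[of ?h "inv\<^bsub>G\<^esub> ?s" i b] s g h i b by simp
    moreover have "\<theta> ?j (d i ?h ?b) = \<theta> ?j ?b"
      using \<theta>_inv[OF rp(1)[OF i] hs, of ?b] b' B_rp[OF i] by simp
    ultimately show ?thesis
      using rp_orbit[OF g i] d_orbit[OF g i] by (simp add: u_def)
  qed
  have \<Psi>_act: "\<Psi> (act g t) = \<Psi> t" if g: "g \<in> carrier G" and t: "t \<in> carrier T" for g t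
  proof (rule hom_ext[where u = "\<lambda>t. \<Psi> (act g t)" and v = \<Psi> and C = C.T])
    show "algebra_hom K T C.T (\<lambda>t. \<Psi> (act g t))"
      using alg_hom_comp[OF algebra_hom.hom[OF act_hom[OF g]] \<Psi>(1)]
      by (intro algebra_homI T.algebra_axioms C.T.algebra_axioms)
    fix i b assume i: "i \<in> I" and b: "b \<in> carrier (B i)"
    have db: "d i g b \<in> carrier (B (\<tau> g i))" using d_closed[OF g i b] B_orbit[OF g i] by simp
    show "\<Psi> (act g (\<iota> i b)) = \<Psi> (\<iota> i b)"
      using act_incl[OF g i b] \<Psi>(2)[OF \<tau>_closed[OF g i] db] \<Psi>(2)[OF i b] u_act[OF g i b] by simp
  qed (use t \<Psi>.algebra_hom_axioms in auto)
  have \<Psi>_N: "\<Psi> t = \<zero>\<^bsub>C.T\<^esub>" if "t \<in> N" for t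
    using coinv_vanish[OF \<Psi>.algebra_hom_axioms \<Psi>_act that] by blast
  have \<Psi>_surj: "carrier C.T \<subseteq> \<Psi> ` carrier T"
  proof (rule C.incl_generate[OF \<Psi>.subalg_image[OF T.subalg_carrier_self]])
    fix j c assume j: "j \<in> J" and c: "c \<in> carrier (C j)"
    then obtain b where b: "b \<in> carrier (B j)" "c = \<theta> j b" using surj by blast
    have jI: "j \<in> I" using J_I[OF j] .
    have rj: "rp j = j" using J_unique[OF rp(1)[OF jI] rp(2)[OF jI]] rp(3)[OF jI] j by simp
    have "sg j \<in> stabilizer G \<tau> j" using rp(2,3)[OF jI] rj by (simp add: stabilizer_def)
    then have "inv\<^bsub>G\<^esub> (sg j) \<in> stabilizer G \<tau> j"
      by (rule group_action.stabilizer_m_inv_closed[OF action jI])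
    from \<theta>_inv[OF j this b(1)] have "\<Psi> (\<iota> j b) = C.\<iota> j c"
      using \<Psi>(2)[OF jI b(1)] b(2) rj by (simp add: u_def)
    then show "C.\<iota> j c \<in> \<Psi> ` carrier T" using incl_closed[OF jI b(1)] by (metis imageI)
  qed
  define Q where "Q = quot_algebra T N"
  have Q: "algebra K Q" unfolding Q_def by (rule N.quot_algebra_algebra)
  have cl_hom: "cl \<in> alg_hom K T Q" unfolding Q_def by (rule N.coset_hom)
  have "\<exists>v\<in>alg_hom K (C j) Q. \<forall>b\<in>carrier (B j). v (\<theta> j b) = cl (\<iota> j b)" if j: "j \<in> J" for j
  proof (rule alg_hom_factor[OF \<theta>_hom[OF j] _ surj[OF j]])
    have jI: "j \<in> I" using J_I[OF j] .
    show \<kappa>: "algebra_hom K (B j) Q (\<lambda>b. cl (\<iota> j b))"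
      using alg_hom_comp[OF incl_hom[OF jI] cl_hom]
      by (intro algebra_homI factor_algebra jI Q)
    fix b assume b: "b \<in> carrier (B j)" "\<theta> j b = \<zero>\<^bsub>C j\<^esub>"
    show "cl (\<iota> j b) = \<zero>\<^bsub>Q\<^esub>"
    proof (rule algebra_with_endos.coinv_vanish[OF coinvB[OF j] \<kappa>])
      show "b \<in> coinvariant_ideal (B j) (stabilizer G \<tau> j) (d j)" using ker[OF j b(1)] b(2) by simp
      fix b h assume b: "b \<in> carrier (B j)" and h: "h \<in> stabilizer G \<tau> j"
      show "cl (\<iota> j (d j h b)) = cl (\<iota> j b)"
        using cl_act[OF stab(1)[OF h] incl_closed[OF jI b]] act_incl[OF stab(1)[OF h] jI b] stab(2)[OF h]
        by simp
    qed
  qed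
  then obtain v where v: "\<And>j. j \<in> J \<Longrightarrow> v j \<in> alg_hom K (C j) Q"
    "\<And>j b. j \<in> J \<Longrightarrow> b \<in> carrier (B j) \<Longrightarrow> v j (\<theta> j b) = cl (\<iota> j b)"
    by metis
  obtain \<Phi> where \<Phi>: "\<Phi> \<in> alg_hom K C.T Q" "\<And>j c. j \<in> J \<Longrightarrow> c \<in> carrier (C j) \<Longrightarrow> \<Phi> (C.\<iota> j c) = v j c"
    using C.coproduct[where u = v, OF Q v(1)] by blast
  have \<Phi>\<Psi>: "\<Phi> (\<Psi> t) = cl t" if t: "t \<in> carrier T" for t
  proof (rule hom_ext[where u = "\<lambda>t. \<Phi> (\<Psi> t)" and v = cl and C = Q])
    show "algebra_hom K T Q (\<lambda>t. \<Phi> (\<Psi> t))"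
      by (intro algebra_homI T.algebra_axioms Q alg_hom_comp[OF \<Psi>(1) \<Phi>(1)])
    show "algebra_hom K T Q cl"
      by (intro algebra_homI T.algebra_axioms Q cl_hom)
    fix i b assume i: "i \<in> I" and b: "b \<in> carrier (B i)"
    let ?b = "d i (inv\<^bsub>G\<^esub> (sg i)) b"
    have s: "sg i \<in> carrier G" using rp(2)[OF i] .
    have b': "?b \<in> carrier (B (rp i))" using d_closed[OF G.inv_closed[OF s] i b] B_rp[OF i] by simp
    have "d (rp i) (sg i) ?b = b"
      using d_mult[OF s G.inv_closed[OF s] i b] d_one[OF i b] s B_rp[OF i] by simp
    then have "act (sg i) (\<iota> (rp i) ?b) = \<iota> i b"
      using act_incl[OF s rpI[OF i] b'] rp(3)[OF i] by simp
    then have "cl (\<iota> (rp i) ?b) = cl (\<iota> i b)" using cl_act[OF s incl_closed[OF rpI[OF i] b']] by simp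
    moreover have "\<Phi> (\<Psi> (\<iota> i b)) = cl (\<iota> (rp i) ?b)"
      using \<Psi>(2)[OF i b] \<Phi>(2)[OF rp(1)[OF i] alg_hom_closed[OF \<theta>[OF rp(1)[OF i]] b']] v(2)[OF rp(1)[OF i] b']
      by (simp add: u_def)
    ultimately show "\<Phi> (\<Psi> (\<iota> i b)) = cl (\<iota> i b)" by simp
  qed (rule t)
  have "bij_betw \<Phi> (carrier C.T) (carrier Q)"
    unfolding bij_betw_def
  proof
    show "inj_on \<Phi> (carrier C.T)"
    proof (rule inj_onI)
      fix x y assume x: "x \<in> carrier C.T" and y: "y \<in> carrier C.T" and eq: "\<Phi> x = \<Phi> y"
      obtain s where s: "x = \<Psi> s" "s \<in> carrier T" using set_mp[OF \<Psi>_surj x] by (rule imageE)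
      obtain t where t: "y = \<Psi> t" "t \<in> carrier T" using set_mp[OF \<Psi>_surj y] by (rule imageE)
      have "cl s = cl t" using eq \<Phi>\<Psi>[OF s(2)] \<Phi>\<Psi>[OF t(2)] unfolding s(1) t(1) by simp
      then have "s \<ominus>\<^bsub>T\<^esub> t \<in> N" unfolding N.coset_eq_iff[OF s(2) t(2)] .
      from \<Psi>_N[OF this] show "x = y" unfolding \<Psi>.eq_if_diff_zero[OF s(2) t(2)] s(1) t(1) .
    qed
    show "\<Phi> ` carrier C.T = carrier Q"
    proof
      show "\<Phi> ` carrier C.T \<subseteq> carrier Q" by (intro image_subsetI alg_hom_closed[OF \<Phi>(1)])
      show "carrier Q \<subseteq> \<Phi> ` carrier C.T"
      proof
        fix z assume "z \<in> carrier Q"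
        then have "z \<in> cl ` carrier T" unfolding Q_def N.coset_surj .
        then obtain t where t: "z = cl t" "t \<in> carrier T" by (rule imageE)
        show "z \<in> \<Phi> ` carrier C.T"
          by (rule image_eqI[OF _ \<Psi>.closed[OF t(2)]]) (simp only: t(1) \<Phi>\<Psi>[OF t(2)])
      qed
    qed
  qed
  then show ?thesis
    unfolding alg_isomorphic_def coinvariants_eq Q_def[symmetric] by (rule bexI[OF _ \<Phi>(1)])
qed

end

section \<open>The weight algebras\<close>

lemma (in tensor_power_alg) diagonal_comp:
  assumes g: "\<phi> g \<in> alg_hom K A A" and h: "\<phi> h \<in> alg_hom K A A" and k: "\<phi> k \<in> alg_hom K A A"
    and eq: "\<And>a. a \<in> carrier A \<Longrightarrow> \<phi> k a = \<phi> g (\<phi> h a)" and t: "t \<in> Sym"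
  shows "diagonal_action K n A \<phi> k t = diagonal_action K n A \<phi> g (diagonal_action K n A \<phi> h t)"
proof (rule Sym_hom_ext[where C = "sym_power K n A" and u = "diagonal_action K n A \<phi> k"
      and v = "\<lambda>t. diagonal_action K n A \<phi> g (diagonal_action K n A \<phi> h t)"])
  show "algebra_hom K (sym_power K n A) (sym_power K n A) (diagonal_action K n A \<phi> k)"
    by (intro algebra_homI sym_power_algebra diagonal_Sym_hom k)
  show "algebra_hom K (sym_power K n A) (sym_power K n A)
      (\<lambda>t. diagonal_action K n A \<phi> g (diagonal_action K n A \<phi> h t))"
    by (intro algebra_homI sym_power_algebra
        alg_hom_comp[OF diagonal_Sym_hom[of \<phi> h, OF h] diagonal_Sym_hom[of \<phi> g, OF g]])
  fix a assume a: "a \<in> carrier A"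
  show "diagonal_action K n A \<phi> k (psum a) = diagonal_action K n A \<phi> g (diagonal_action K n A \<phi> h (psum a))"
    using diagonal_psum[of \<phi> k, OF k a] diagonal_psum[of \<phi> h, OF h a]
      diagonal_psum[of \<phi> g, OF g alg_hom_closed[OF h a]] eq[OF a] by simp
qed (rule t)

lemma (in tensor_power_alg) diagonal_id:
  assumes g: "\<phi> g \<in> alg_hom K A A" and eq: "\<And>a. a \<in> carrier A \<Longrightarrow> \<phi> g a = a" and t: "t \<in> Sym"
  shows "diagonal_action K n A \<phi> g t = t"
proof (rule Sym_hom_ext[where C = "sym_power K n A" and u = "diagonal_action K n A \<phi> g" and v = "\<lambda>t. t"])
  show "algebra_hom K (sym_power K n A) (sym_power K n A) (diagonal_action K n A \<phi> g)"
    by (intro algebra_homI sym_power_algebra diagonal_Sym_hom g)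
  show "algebra_hom K (sym_power K n A) (sym_power K n A) (\<lambda>t. t)"
    by (intro algebra_homI sym_power_algebra alg_homI) simp_all
  fix a assume a: "a \<in> carrier A"
  show "diagonal_action K n A \<phi> g (psum a) = psum a"
    using diagonal_psum[of \<phi> g, OF g a] eq[OF a] by simp
qed (rule t)

lemma (in group_action) orbit_of_translate:
  assumes g: "g \<in> carrier G" and x: "x \<in> E"
  shows "orbit G \<phi> (\<phi> g x) = orbit G \<phi> x"
proof -
  have gx: "\<phi> g x \<in> E" using element_image[OF g x] by blast
  have "\<phi> g x \<in> orbit G \<phi> x" using g by (auto simp: orbit_def)
  moreover have "\<phi> g x \<in> orbit G \<phi> (\<phi> g x)" by (rule orbit_refl[OF gx])
  moreover have "orbit G \<phi> x \<in> orbits G E \<phi>" "orbit G \<phi> (\<phi> g x) \<in> orbits G E \<phi>"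
    using x gx by (auto simp: orbits_def)
  ultimately show ?thesis using disjoint_union by blast
qed

lemma (in group_action) card_stabilizer_translate:
  assumes fin: "finite (carrier G)" and g: "g \<in> carrier G" and x: "x \<in> E"
  shows "card (stabilizer G \<phi> (\<phi> g x)) = card (stabilizer G \<phi> x)"
proof -
  have gx: "\<phi> g x \<in> E" using element_image[OF g x] by blast
  have "orbit G \<phi> x = (\<lambda>h. \<phi> h x) ` carrier G" by (auto simp: orbit_def)
  then have "finite (orbit G \<phi> x)" using fin by simp
  then have "card (orbit G \<phi> x) > 0" using orbit_refl[OF x] by (auto simp: card_gt_0_iff)
  moreover have "card (orbit G \<phi> x) * card (stabilizer G \<phi> (\<phi> g x)) = card (orbit G \<phi> x) * card (stabilizer G \<phi> x)"
    using orbit_stabilizer_theorem[OF x] orbit_stabilizer_theorem[OF gx] orbit_of_translate[OF g x] by simp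
  ultimately show ?thesis by simp
qed

theorem theorem8p8:
  fixes K :: "('k, 'km) ring_scheme"
    and L :: "('k, 'l, 'lm) lie_alg_scheme"
    and I :: "'i set" and C :: "'i \<Rightarrow> 'i \<Rightarrow> int" and e f h :: "'i \<Rightarrow> 'l"
    and A :: "('k, 'a, 'am) module_scheme"
    and \<Gamma> :: "('g, 'gm) monoid_scheme"
    and \<tau> :: "'g \<Rightarrow> 'i \<Rightarrow> 'i" and \<rho> :: "'g \<Rightarrow> 'l \<Rightarrow> 'l" and \<phi> :: "'g \<Rightarrow> 'a \<Rightarrow> 'a"
    and J :: "'i set" and r :: "'i set \<Rightarrow> nat"
  assumes "algebraically_closed K" and "char_zero K"
    and "simple_lie_algebra K L" and "finite_dimensional K L"
    and "chevalley_generators K L I C e f h"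
    and "\<forall>n\<ge>1. \<not> dynkin_type_A I C (2 * n)"
    and "algebra K A" and "finitely_generated_algebra K A"
    and "jacobson_radical A = {\<zero>\<^bsub>A\<^esub>}"
    and "group \<Gamma>" and "finite (carrier \<Gamma>)" and "cyclic_group \<Gamma>" and "carrier \<Gamma> \<noteq> {\<one>\<^bsub>\<Gamma>\<^esub>}"
    and "diagram_automorphism_action K L I C e f h \<Gamma> \<tau> \<rho>"
    and "faithful_action \<Gamma> (carrier L) \<rho>"
    and "algebra_action K A \<Gamma> \<phi>" and "free_on_max_spec A \<Gamma> \<phi>"
    and "orbit_transversal \<Gamma> I \<tau> J"
    and "r \<in> dominant_weights \<Gamma> I \<tau>"
    and "\<forall>i\<in>I. reduced (coinvariants (sym_power K (mult_coeff \<Gamma> \<tau> r i) A) (stabilizer \<Gamma> \<tau> i)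
                        (diagonal_action K (mult_coeff \<Gamma> \<tau> r i) A \<phi>))"
  shows "alg_isomorphic K (A_Gamma K A \<Gamma> \<phi> \<tau> J r)
           (coinvariants (A_full K A \<Gamma> I \<tau> r) (carrier \<Gamma>) (A_full_action K A \<Gamma> \<phi> I \<tau> r))"
proof -
  note K_closed = assms(1) and A = assms(7) and \<Gamma> = assms(10,11) and act = assms(16,17) and J = assms(18)
    and red = assms(20)
  have K: "char0_field K"
    using K_closed assms(2) by (intro char0_field.intro char0_field_axioms.intro) (simp_all add: algebraically_closed_def)
  have fin: "finite I" using assms(5) by (auto simp: chevalley_generators_def simple_roots_def)
  have \<tau>: "group_action \<Gamma> I \<tau>"
    using assms(14) by (simp add: diagram_automorphism_action_def dynkin_action_def)
  have \<phi>: "group_action \<Gamma> (carrier A) \<phi>" "\<And>g. g \<in> carrier \<Gamma> \<Longrightarrow> \<phi> g \<in> alg_hom K A A"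
    using act(1) by (simp_all add: algebra_action_def)
  define n where "n i = mult_coeff \<Gamma> \<tau> r i" for i
  define B where "B i = sym_power K (n i) A" for i
  define d where "d i = diagonal_action K (n i) A \<phi>" for i
  have T: "tensor_power_alg K A" by (intro tensor_power_alg.intro K A)
  have n_orbit: "n (\<tau> g i) = n i" if "g \<in> carrier \<Gamma>" "i \<in> I" for g i
    using group_action.orbit_of_translate[OF \<tau> that] group_action.card_stabilizer_translate[OF \<tau> \<Gamma>(2) that]
    by (simp add: n_def mult_coeff_def coeff_def)
  have B_carrier: "carrier (B i) = tensor_power_alg.Sym K A (n i)" for i
    by (simp add: B_def tensor_power_alg.sym_power_eq[OF T])
  have alg: "tensor_alg K I B"
  proof (rule tensor_alg.intro)
    show "cring K" by (rule algebra.R_cring[OF A])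
    show "algebra K (B i)" for i unfolding B_def by (rule tensor_power_alg.sym_power_algebra[OF T])
  qed (rule fin)
  have orb: "orbit_tensor K I B \<Gamma> \<tau> J d"
  proof (intro orbit_tensor.intro orbit_tensor_axioms.intro alg \<Gamma>(1) \<tau> J)
    fix g i assume g: "g \<in> carrier \<Gamma>" and i: "i \<in> I"
    show "B (\<tau> g i) = B i" "d (\<tau> g i) = d i" using n_orbit[OF g i] by (simp_all add: B_def d_def)
    show "d i g \<in> alg_hom K (B i) (B i)"
      unfolding d_def B_def by (rule tensor_power_alg.diagonal_Sym_hom[where \<phi> = \<phi> and g = g, OF T \<phi>(2)[OF g]])
    fix h b assume h: "h \<in> carrier \<Gamma>" and b: "b \<in> carrier (B i)"
    have gh: "g \<otimes>\<^bsub>\<Gamma>\<^esub> h \<in> carrier \<Gamma>" using \<Gamma>(1) g h by (simp add: group.is_monoid monoid.m_closed)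
    show "d i (g \<otimes>\<^bsub>\<Gamma>\<^esub> h) b = d i g (d i h b)"
      unfolding d_def
    proof (rule tensor_power_alg.diagonal_comp[where \<phi> = \<phi> and g = g and h = h,
          OF T \<phi>(2)[OF g] \<phi>(2)[OF h] \<phi>(2)[OF gh]])
      show "\<phi> (g \<otimes>\<^bsub>\<Gamma>\<^esub> h) a = \<phi> g (\<phi> h a)" if "a \<in> carrier A" for a
        by (rule group_action.composition_rule[OF \<phi>(1) that g h])
    qed (use b B_carrier in simp)
  next
    fix i b assume i: "i \<in> I" and b: "b \<in> carrier (B i)"
    have one: "\<one>\<^bsub>\<Gamma>\<^esub> \<in> carrier \<Gamma>" using \<Gamma>(1) by (simp add: group.is_monoid monoid.one_closed)
    show "d i \<one>\<^bsub>\<Gamma>\<^esub> b = b"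
      unfolding d_def
    proof (rule tensor_power_alg.diagonal_id[where \<phi> = \<phi>, OF T \<phi>(2)[OF one]])
      show "\<phi> \<one>\<^bsub>\<Gamma>\<^esub> a = a" if "a \<in> carrier A" for a
        using group_action.id_eq_one[OF \<phi>(1)] that by (metis restrict_apply')
    qed (use b B_carrier in simp)
  qed
  have J_I: "j \<in> I" if "j \<in> J" for j using J that by (auto simp: orbit_transversal_def)
  define C' where "C' j = sym_power K (coeff \<Gamma> \<tau> r j) (fixed_subalgebra A (stabilizer \<Gamma> \<tau> j) \<phi>)" for j
  have sf: "sym_fold K A \<Gamma> \<phi> (stabilizer \<Gamma> \<tau> j)" if j: "j \<in> J" for j
  proof -
    have sub: "subgroup (stabilizer \<Gamma> \<tau> j) \<Gamma>"
      by (rule group_action.stabilizer_subgroup[OF \<tau> J_I[OF j]])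
    then have "finite (stabilizer \<Gamma> \<tau> j)" using \<Gamma>(2) subgroup.subset finite_subset by blast
    then show ?thesis
      by (intro sym_fold.intro free_action.intro free_action_axioms.intro K A \<Gamma>(1) act sub)
  qed
  have "\<exists>\<theta>\<in>alg_hom K (B j) (C' j). \<theta> ` carrier (B j) = carrier (C' j) \<and>
      (\<forall>b\<in>carrier (B j). \<theta> b = \<zero>\<^bsub>C' j\<^esub> \<longleftrightarrow> b \<in> coinvariant_ideal (B j) (stabilizer \<Gamma> \<tau> j) (d j))"
    if j: "j \<in> J" for j
    using sym_fold.sym_power_coinvariants[OF sf[OF j], of "coeff \<Gamma> \<tau> r j"] red J_I[OF j]
    unfolding B_def C'_def d_def n_def mult_coeff_def by blast
  then obtain \<theta> where \<theta>: "\<And>j. j \<in> J \<Longrightarrow> \<theta> j \<in> alg_hom K (B j) (C' j)"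
    "\<And>j. j \<in> J \<Longrightarrow> \<theta> j ` carrier (B j) = carrier (C' j)"
    "\<And>j b. j \<in> J \<Longrightarrow> b \<in> carrier (B j) \<Longrightarrow>
      \<theta> j b = \<zero>\<^bsub>C' j\<^esub> \<longleftrightarrow> b \<in> coinvariant_ideal (B j) (stabilizer \<Gamma> \<tau> j) (d j)"
    by metis
  have C': "algebra K (C' j)" if j: "j \<in> J" for j
    unfolding C'_def
    by (intro tensor_power_alg.sym_power_algebra tensor_power_alg.intro K sym_fold.AU_algebra[OF sf[OF j]])
  have "alg_isomorphic K (tensor_product K J C')
      (coinvariants (tensor_product K I B) (carrier \<Gamma>) (orbit_tensor.act K I B \<Gamma> \<tau> d))"
    by (rule orbit_tensor.coinvariants_tensor_product[OF orb C' \<theta>])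
  moreover have "tensor_product K J C' = A_Gamma K A \<Gamma> \<phi> \<tau> J r"
    by (simp add: A_Gamma_def C'_def[abs_def])
  moreover have "tensor_product K I B = A_full K A \<Gamma> I \<tau> r"
    by (simp add: A_full_def B_def[abs_def] n_def)
  moreover have "orbit_tensor.act K I B \<Gamma> \<tau> d = A_full_action K A \<Gamma> \<phi> I \<tau> r"
    unfolding fun_eq_iff orbit_tensor.act_def[OF orb] A_full_action_def
    by (simp add: B_def[abs_def] d_def n_def)
  ultimately show ?thesis by simp
qed

end
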